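(* Let $0<\alpha<2$, $H>0$, and let $\mathbf{X}=\{X(t)\}_{t\in\mathbb{R}^d}$ be a real-valued $H$-self-similar $S\alpha S$ random field with stationary increments and integral representation $$X(t)\stackrel{d}{=}\int_E f_t(s)\,M(ds),\qquad t\in\mathbb{R}^d,$$ where $M$ is an $S\alpha S$ random measure on a measurable space $(E,\mathcal{E})$ with $\sigma$-finite control measure $m$ and $f_t\in L^\alpha(E,m)$ for all $t\in\mathbb{R}^d$. Let $V=\{-1,0,1\}^d\setminus\{\mathbf{0}\}$. For $v\in V$ define the random field $Y^{(v)}(t)=X(t+v)-X(t)$, $t\in\mathbb{R}^d$, with integral representation $Y^{(v)}(t)=\int_E f^{(v)}_t(x)\,M(dx)$, where $f^{(v)}_t=f_{v+t}-f_t$, and set $$b^{(v)}_n=\left(\int_E\max_{\mathbf{0}\le t\le(n-1)\mathbf{1}}|f^{(v)}_t(x)|^\alpha\,m(dx)\right)^{1/\alpha},$$ the maximum being over $t\in\mathbb{Z}^d$. Suppose that either (1) $0<\alpha<1$ and there exist constants $0<\theta_2<\alpha H$ and $K>0$ such that for all $v\in V$, $b^{(v)}_n\le K\,n^{\theta_2/\alpha}$ for all sufficiently large $n$; or (2) $1\le\alpha<2$ and there exists $\theta_2\in(0,\alpha H)$ such that for all $v\in V$ the increment field $\{Y^{(v)}(t)\}_{t\in\mathbb{Z}^d}$ has weak effective dimension bounded by $\theta_2$. Then for any $0<\gamma<\alpha$, with $T=[0,1]^d$, $$\limsup_{h\to0+}\ \frac{\sup_{t\in T}\ \sup_{s\in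 T,\ |s-t|_\infty\le h}|X(t)-X(s)|}{h^{H-\theta_2/\alpha}\,(\log(1/h))^{1/\gamma}}=0\qquad\text{almost surely},$$ where $|s-t|_\infty=\max_{1\le j\le d}|s_j-t_j|$.
   Context: $d\ge1$ is an integer. $u\le v$ for vectors means coordinatewise inequality; $\mathbf{0}=(0,\dots,0)$, $\mathbf{1}=(1,\dots,1)$. $\stackrel{d}{=}$ between fields means equality of finite-dimensional distributions. A real-valued field is $S\alpha S$ (symmetric $\alpha$-stable) if every finite linear combination of its values has a symmetric $\alpha$-stable distribution. An $S\alpha S$ random measure $M$ with $\sigma$-finite control measure $m$ is an independently scattered, $\sigma$-additive random set function on sets of finite $m$-measure with $\mathbb{E}e^{i\theta M(A)}=e^{-|\theta|^\alpha m(A)}$; for $g\in L^\alpha(E,m)$, $\mathbb{E}\exp(i\theta\int g\,dM)=\exp(-|\theta|^\alpha\int|g|^\alpha dm)$. $\{X(t)\}_{t\in\mathbb{R}^d}$ is $H$-self-similar ($H>0$) if $\{X(ct)\}\stackrel{d}{=}\{c^HX(t)\}$ for all $c>0$; it has stationary increments if $\{X(t+u)-X(u)\}_{t\in\mathbb{R}^d}\stackrel{d}{=}\{X(t)-X(0)\}_{t\in\mathbb{R}^d}$ for each $u\in\mathbb{R}^d$. Then each $\{Y^{(v)}(t)\}_{t\in\mathbb{Z}^d}$ is a stationary $S\alpha S$ random field. The field $\{Y^{(v)}(t)\}_{t\in\mathbb{Z}^d}$ has weak effective dimension bounded by $\theta_2\in(0,d]$ if there exist constants $c_1>0$, $c_2>0$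 and $\theta_1\in(0,\theta_2]$ such that $c_1n^{\theta_1}\le (b_n^{(v)})^\alpha\le c_2n^{\theta_2}$ for all sufficiently large $n$.
   Formalization: "Almost surely" is proved for X itself when X is separable (in Doob's sense) and, in general, for some separable modification of X; for an arbitrary version the claim fails (e.g. add 1 to X(t) at an independent uniform random point t=U of T). *)

theory Defs
  imports "HOL-Probability.Probability"
begin

text \<open>A random field is a function \<open>X :: 't \<Rightarrow> 'w \<Rightarrow> real\<close> on a probability space \<open>P\<close>.\<close>

definition random_field :: "'w measure \<Rightarrow> ('t \<Rightarrow> 'w \<Rightarrow> real) \<Rightarrow> bool" where
  "random_field P X \<longleftrightarrow> (\<forall>t. X t \<in> borel_measurable P)"

text \<open>Equality in distribution of fields, possibly living on different probability spaces.\<close>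

definition eq_fdd ::
  "'w measure \<Rightarrow> ('t \<Rightarrow> 'w \<Rightarrow> real) \<Rightarrow> 'p measure \<Rightarrow> ('t \<Rightarrow> 'p \<Rightarrow> real) \<Rightarrow> bool" where
  "eq_fdd P X Q Y \<longleftrightarrow>
     (\<forall>J. finite J \<longrightarrow>
        distr P (Pi\<^sub>M J (\<lambda>_. borel)) (\<lambda>\<omega>. \<lambda>t\<in>J. X t \<omega>) =
        distr Q (Pi\<^sub>M J (\<lambda>_. borel)) (\<lambda>\<omega>. \<lambda>t\<in>J. Y t \<omega>))"

text \<open>The degenerate law (\<open>\<sigma> = 0\<close>) counts as symmetric stable, as usual.\<close>

definition symmetric_stable :: "real \<Rightarrow> 'w measure \<Rightarrow> ('w \<Rightarrow> real) \<Rightarrow> bool" where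
  "symmetric_stable \<alpha> P Z \<longleftrightarrow>
     Z \<in> borel_measurable P \<and>
     (\<exists>\<sigma>\<ge>0. \<forall>\<theta>. char (distr P borel Z) \<theta> =
        complex_of_real (exp (- (\<sigma> powr \<alpha> * \<bar>\<theta>\<bar> powr \<alpha>))))"

definition sas_field :: "real \<Rightarrow> 'w measure \<Rightarrow> ('t \<Rightarrow> 'w \<Rightarrow> real) \<Rightarrow> bool" where
  "sas_field \<alpha> P X \<longleftrightarrow>
     (\<forall>J c. finite J \<longrightarrow> symmetric_stable \<alpha> P (\<lambda>\<omega>. \<Sum>t\<in>J. c t * X t \<omega>))"

definition self_similar ::
  "real \<Rightarrow> 'w measure \<Rightarrow> ('t::real_vector \<Rightarrow> 'w \<Rightarrow> real) \<Rightarrow> bool" where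
  "self_similar H P X \<longleftrightarrow>
     (\<forall>c>0. eq_fdd P (\<lambda>t. X (c *\<^sub>R t)) P (\<lambda>t \<omega>. c powr H * X t \<omega>))"

definition stationary_increments ::
  "'w measure \<Rightarrow> ('t::real_vector \<Rightarrow> 'w \<Rightarrow> real) \<Rightarrow> bool" where
  "stationary_increments P X \<longleftrightarrow>
     (\<forall>u. eq_fdd P (\<lambda>t \<omega>. X (t + u) \<omega> - X u \<omega>) P (\<lambda>t \<omega>. X t \<omega> - X 0 \<omega>))"

text \<open>
  The random measure \<open>M\<close> lives on the probability space \<open>Q\<close>; only its values on measurable sets
  of finite \<open>m\<close>-measure are constrained.
\<close>

definition sas_random_measure ::
  "real \<Rightarrow> 'p measure \<Rightarrow> 'e measure \<Rightarrow> ('e set \<Rightarrow> 'p \<Rightarrow> real) \<Rightarrow> bool" where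
  "sas_random_measure \<alpha> Q m M \<longleftrightarrow>
     prob_space Q \<and> sigma_finite_measure m \<and>
     (\<forall>A\<in>sets m. emeasure m A < \<infinity> \<longrightarrow> M A \<in> borel_measurable Q) \<and>
     (\<forall>A\<in>sets m. emeasure m A < \<infinity> \<longrightarrow>
        (\<forall>\<theta>. char (distr Q borel (M A)) \<theta> =
           complex_of_real (exp (- (\<bar>\<theta>\<bar> powr \<alpha> * measure m A))))) \<and>
     (\<forall>(A :: nat \<Rightarrow> 'e set) I. finite I \<and> disjoint_family_on A I \<and>
        (\<forall>i\<in>I. A i \<in> sets m \<and> emeasure m (A i) < \<infinity>) \<longrightarrow>
        prob_space.indep_vars Q (\<lambda>_. borel) (\<lambda>i. M (A i)) I) \<and>
     (\<forall>A :: nat \<Rightarrow> 'e set. disjoint_family A \<and> range A \<subseteq> sets m \<and>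
        emeasure m (\<Union>i. A i) < \<infinity> \<longrightarrow>
        (AE \<omega> in Q. (\<lambda>i. M (A i) \<omega>) sums M (\<Union>i. A i) \<omega>))"

definition in_L_alpha :: "real \<Rightarrow> 'e measure \<Rightarrow> ('e \<Rightarrow> real) \<Rightarrow> bool" where
  "in_L_alpha \<alpha> m g \<longleftrightarrow> g \<in> borel_measurable m \<and> integrable m (\<lambda>x. \<bar>g x\<bar> powr \<alpha>)"

text \<open>
  The integral of a simple function whose support has finite measure. The set where \<open>g\<close> vanishes
  may have infinite measure, but it carries the coefficient 0.
\<close>

definition simple_stable_integral ::
  "'e measure \<Rightarrow> ('e set \<Rightarrow> 'p \<Rightarrow> real) \<Rightarrow> ('e \<Rightarrow> real) \<Rightarrow> 'p \<Rightarrow> real" where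
  "simple_stable_integral m M g \<omega> =
     (\<Sum>y\<in>g ` space m. y * M {x \<in> space m. g x = y} \<omega>)"

text \<open>
  \<open>has_stable_integral \<alpha> Q m M f Z\<close>: the random variable \<open>Z\<close> is a version of the stochastic
  integral of \<open>f\<close> with respect to \<open>M\<close>, i.e. the limit in probability of the integrals of simple
  functions that approximate \<open>f\<close> in \<open>L\<^sup>\<alpha>(m)\<close>.
\<close>

definition has_stable_integral ::
  "real \<Rightarrow> 'p measure \<Rightarrow> 'e measure \<Rightarrow> ('e set \<Rightarrow> 'p \<Rightarrow> real) \<Rightarrow>
     ('e \<Rightarrow> real) \<Rightarrow> ('p \<Rightarrow> real) \<Rightarrow> bool" where
  "has_stable_integral \<alpha> Q m M f Z \<longleftrightarrow>
     in_L_alpha \<alpha> m f \<and> Z \<in> borel_measurable Q \<and>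
     (\<exists>g :: nat \<Rightarrow> 'e \<Rightarrow> real.
        (\<forall>k. simple_function m (g k) \<and> emeasure m {x \<in> space m. g k x \<noteq> 0} < \<infinity>) \<and>
        (\<lambda>k. LINT x|m. \<bar>g k x - f x\<bar> powr \<alpha>) \<longlonglongrightarrow> 0 \<and>
        (\<forall>\<epsilon>>0. (\<lambda>k. measure Q {\<omega> \<in> space Q. \<bar>simple_stable_integral m M (g k) \<omega> - Z \<omega>\<bar> > \<epsilon>})
           \<longlonglongrightarrow> 0))"

definition directions :: "(real ^ 'd) set" where
  "directions = {v. \<forall>i. v $ i \<in> {-1, 0, 1}} - {0}"

text \<open>The kernel of the increment field \<open>Y\<^sup>(\<^sup>v\<^sup>)(t) = X(t + v) - X(t)\<close>.\<close>

definition incr_kernel :: "('t::plus \<Rightarrow> 'e \<Rightarrow> real) \<Rightarrow> 't \<Rightarrow> 't \<Rightarrow> 'e \<Rightarrow> real" where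
  "incr_kernel f v t x = f (v + t) x - f t x"

text \<open>The points of the integer lattice in \<open>[0, n - 1]\<^sup>d\<close>; the order on vectors is coordinatewise.\<close>

definition lattice_box :: "nat \<Rightarrow> (real ^ 'd) set" where
  "lattice_box n = {t. (\<forall>i. t $ i \<in> \<int>) \<and> 0 \<le> t \<and> t \<le> (real n - 1) *\<^sub>R 1}"

text \<open>
  \<open>b\<^sub>n\<close> for a field with kernel \<open>g\<close>. Only \<open>n \<ge> 1\<close> is meaningful, as \<open>lattice_box 0\<close> is empty.
\<close>

definition kernel_max_norm ::
  "real \<Rightarrow> 'e measure \<Rightarrow> (real ^ 'd \<Rightarrow> 'e \<Rightarrow> real) \<Rightarrow> nat \<Rightarrow> real" where
  "kernel_max_norm \<alpha> m g n =
     (LINT x|m. (MAX t\<in>lattice_box n. \<bar>g t x\<bar> powr \<alpha>)) powr (1 / \<alpha>)"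

text \<open>The weak effective dimension of a field on the lattice, in terms of its kernel \<open>g\<close>.\<close>

definition weak_eff_dim_bounded ::
  "real \<Rightarrow> 'e measure \<Rightarrow> (real ^ 'd \<Rightarrow> 'e \<Rightarrow> real) \<Rightarrow> real \<Rightarrow> bool" where
  "weak_eff_dim_bounded \<alpha> m g \<theta>\<^sub>2 \<longleftrightarrow>
     0 < \<theta>\<^sub>2 \<and> \<theta>\<^sub>2 \<le> real CARD('d) \<and>
     (\<exists>c\<^sub>1>0. \<exists>c\<^sub>2>0. \<exists>\<theta>\<^sub>1. 0 < \<theta>\<^sub>1 \<and> \<theta>\<^sub>1 \<le> \<theta>\<^sub>2 \<and>
        (\<forall>\<^sub>F n in sequentially.
           c\<^sub>1 * real n powr \<theta>\<^sub>1 \<le> kernel_max_norm \<alpha> m g n powr \<alpha> \<and>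
           kernel_max_norm \<alpha> m g n powr \<alpha> \<le> c\<^sub>2 * real n powr \<theta>\<^sub>2))"

text \<open>Separability in the sense of Doob; taking \<open>F = {}\<close> shows that \<open>D\<close> is dense.\<close>

definition separable_field ::
  "'w measure \<Rightarrow> ('t::topological_space \<Rightarrow> 'w \<Rightarrow> real) \<Rightarrow> bool" where
  "separable_field P X \<longleftrightarrow>
     (\<exists>D. countable D \<and>
        (AE \<omega> in P. \<forall>G F. open G \<and> closed F \<and> (\<forall>t\<in>G \<inter> D. X t \<omega> \<in> F) \<longrightarrow>
           (\<forall>t\<in>G. X t \<omega> \<in> F)))"

definition modification ::
  "'w measure \<Rightarrow> ('t \<Rightarrow> 'w \<Rightarrow> real) \<Rightarrow> ('t \<Rightarrow> 'w \<Rightarrow> real) \<Rightarrow> bool" where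
  "modification P X X' \<longleftrightarrow> random_field P X' \<and> (\<forall>t. AE \<omega> in P. X' t \<omega> = X t \<omega>)"

text \<open>
  The modulus of continuity of a function \<open>x\<close> on the cube \<open>[0,1]\<^sup>d\<close> in the maximum norm. It is
  \<open>ereal\<close>-valued, since \<open>x\<close> may be unbounded.
\<close>

definition cube_modulus :: "(real ^ 'd \<Rightarrow> real) \<Rightarrow> real \<Rightarrow> ereal" where
  "cube_modulus x h =
     (SUP t\<in>cbox 0 1. SUP s\<in>{s \<in> cbox 0 1. infnorm (s - t) \<le> h}. ereal \<bar>x t - x s\<bar>)"

definition limsup_modulus :: "real \<Rightarrow> real \<Rightarrow> (real ^ 'd \<Rightarrow> real) \<Rightarrow> ereal" where
  "limsup_modulus a b x =
     Limsup (at_right 0) (\<lambda>h. cube_modulus x h / ereal (h powr a * ln (1 / h) powr b))"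

end

theory Submission
  imports Defs
begin

text \<open>
  The modulus is governed by the increments of \<open>X\<close> along the dyadic grids. By self-similarity and
  stationarity, the increments \<open>X (2\<^sup>-\<^sup>k (p + v)) - X (2\<^sup>-\<^sup>k p)\<close> over the \<open>k\<close>-th grid of a cube have
  the joint law of \<open>2\<^sup>-\<^sup>k\<^sup>H (X (p + v) - X p)\<close> over a box of side \<open>n \<approx> 2\<^sup>k\<close> in the integer lattice,
  and the latter are stable integrals whose kernels have a maximum of \<open>L\<^sup>\<alpha>\<close>-norm at most \<open>n\<^sup>\<theta>\<^sup>/\<^sup>\<alpha>\<close>, up
  to a constant, where \<open>\<theta>\<close> is the exponent \<open>\<theta>\<^sub>2\<close>. If the maximum over the box were of the order of
  this norm, the \<open>k\<close>-th increments would be of order \<open>2\<^sup>-\<^sup>k\<^sup>(\<^sup>H\<^sup>-\<^sup>\<theta>\<^sup>/\<^sup>\<alpha>\<^sup>)\<close>, and the factor \<open>k\<^sup>1\<^sup>/\<^sup>\<gamma>\<close> with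
  \<open>\<gamma> < \<alpha>\<close> would pay for a Borel--Cantelli argument with tails of order \<open>\<lambda>\<^sup>-\<^sup>\<alpha>\<close>.

  The heart of the proof is therefore a maximal inequality for finitely many stable integrals. It
  is obtained without a series representation, and in the same way for all \<open>0 < \<alpha> < 2\<close>. For simple
  kernels on a joint partition the integrals are linear combinations of the independent variables
  \<open>M(A\<^sub>i)\<close>, and \<open>max_linear_comb_tail\<close> bounds their maximum by splitting each summand according to
  its size. No large summand occurs, outside a set of probability of order \<open>R\<^sup>-\<^sup>\<alpha>\<close>; the medium ones
  are dominated by one positive sum that does not depend on the integral considered, so that the
  number of integrals does not enter; and the small ones have exponential moments, so that a union
  bound over all integrals costs only a factor in front of an exponential.
  \<open>stable_integral_max_tail\<close> passes to general kernels by approximation.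

  The number of integrals at level \<open>k\<close> is of order \<open>2\<^sup>k\<^sup>d\<close>, so the small summands may exceed their
  threshold by chance unless the latter is large; \<open>summable_tail_bound\<close> shows that \<open>\<gamma> < \<alpha> < 2\<close>
  leaves just enough room to choose the two cut-offs so that all three terms are summable in \<open>k\<close>.
  Hence almost surely the increments at level \<open>k\<close> are eventually below \<open>3 2\<^sup>-\<^sup>k\<^sup>(\<^sup>H\<^sup>-\<^sup>\<theta>\<^sup>/\<^sup>\<alpha>\<^sup>) k\<^sup>1\<^sup>/\<^sup>\<gamma>\<close>
  (\<open>grid_bound_AE\<close>).

  Chaining turns this into a modulus of continuity for the limit \<open>X'\<close> of \<open>X\<close> along dyadic
  approximations of the argument. As \<open>X\<close> is stochastically continuous, \<open>X'\<close> is a modification of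
  \<open>X\<close>, and a separable field coincides everywhere with a continuous modification. The little-o in
  the conclusion comes from running the argument with an exponent strictly between \<open>\<gamma>\<close> and \<open>\<alpha>\<close>.
\<close>

section \<open>Moments of truncated symmetric stable variables\<close>

lemma gaussian_cos_integral:
  "(LINT x|std_normal_distribution. cos (x * z)) = exp (- (z\<^sup>2) / 2)"
proof -
  interpret N: real_distribution std_normal_distribution by (rule real_dist_normal_dist)
  have "complex_of_real (exp (- (z\<^sup>2) / 2)) = (CLINT x|std_normal_distribution. iexp (z * x))"
    using char_std_normal_distribution unfolding char_def by metis
  then have "exp (- (z\<^sup>2) / 2) = Re (CLINT x|std_normal_distribution. iexp (z * x))"
    by (metis Re_complex_of_real)
  also have "\<dots> = (LINT x|std_normal_distribution. Re (iexp (z * x)))"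
    by (rule integral_Re[symmetric]) (rule N.integrable_iexp, simp_all)
  also have "\<dots> = (LINT x|std_normal_distribution. cos (x * z))"
    by (simp add: Re_exp mult.commute)
  finally show ?thesis by simp
qed

lemma gaussian_second_moment:
  "integrable std_normal_distribution (\<lambda>x. x\<^sup>2)" "(LINT x|std_normal_distribution. x\<^sup>2) = 1"
proof -
  have h: "has_bochner_integral lborel (\<lambda>x. std_normal_density x * x ^ (2 * 1)) (fact (2 * 1) / (2 ^ 1 * fact 1))"
    by (rule std_normal_moment_even)
  then have i: "integrable lborel (\<lambda>x. std_normal_density x * x\<^sup>2)" 
    and e: "(LINT x|lborel. std_normal_density x * x\<^sup>2) = 1"
    by (auto simp: has_bochner_integral_iff)
  show "integrable std_normal_distribution (\<lambda>x. x\<^sup>2)"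
    using i by (simp add: integrable_density)
  show "(LINT x|std_normal_distribution. x\<^sup>2) = 1"
    using e by (simp add: integral_density)
qed

lemma one_minus_exp_half_ge:
  assumes "0 \<le> (y::real)"
  shows "min 1 y \<le> 3 * (1 - exp (- y / 2))"
proof -
  have conv: "exp (- u / 2) \<le> 1 - u / 3" if u: "0 \<le> u" "u \<le> 1" for u :: real
  proof -
    have "exp (-(u/2)) = 1 / exp (u/2)" by (simp add: exp_minus field_simps)
    also have "\<dots> \<le> 1 / (1 + u/2)"
      using u exp_ge_add_one_self[of "u/2"] by (intro divide_left_mono) auto
    also have "\<dots> \<le> 1 - u / 3"
    proof -
      have "1 \<le> (1 - u/3) * (1 + u/2)"
        using u mult_left_mono[of u 1 u] by (simp add: algebra_simps)
      then show ?thesis using u by (simp add: divide_le_eq)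
    qed
    finally show ?thesis by simp
  qed
  show ?thesis
  proof (cases "y \<le> 1")
    case True then show ?thesis using conv[of y] assms by simp
  next
    case False
    have "exp (- y/2) \<le> exp (- 1 / 2)" using False by simp
    also have "\<dots> \<le> 1 - 1/3" using conv[of 1] by simp
    finally show ?thesis using False by simp
  qed
qed

text \<open>
  Averaging \<open>1 - cos (x Z / r)\<close> over a standard normal \<open>x\<close> gives \<open>1 - exp (- (Z / r)\<^sup>2 / 2)\<close>, which
  is comparable to \<open>min 1 ((Z / r)\<^sup>2)\<close>. By Fubini its expectation is the Gaussian average of
  \<open>1 - exp (- \<mu> \<bar>x / r\<bar>\<^sup>\<alpha>) \<le> \<mu> \<bar>x / r\<bar>\<^sup>\<alpha>\<close>. This single bound controls both the tail \<open>P(\<bar>Z\<bar> \<ge> r)\<close> and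
  the second moment of \<open>Z\<close> truncated at \<open>r\<close>.
\<close>

lemma truncated_second_moment_le:
  fixes Z :: "'p \<Rightarrow> real"
  assumes Q: "prob_space Q" and Z[measurable]: "Z \<in> borel_measurable Q"
    and \<alpha>: "0 < \<alpha>" "\<alpha> < 2" and \<mu>: "0 \<le> \<mu>" and r: "0 < r"
    and ch: "\<And>\<theta>. char (distr Q borel Z) \<theta> = complex_of_real (exp (- (\<bar>\<theta>\<bar> powr \<alpha> * \<mu>)))"
  shows "(LINT \<omega>|Q. min 1 ((Z \<omega> / r)\<^sup>2)) \<le> 6 * \<mu> * r powr (- \<alpha>)"
proof -
  interpret Q: prob_space Q by fact
  interpret N: real_distribution std_normal_distribution by (rule real_dist_normal_dist)
  interpret P: pair_prob_space std_normal_distribution Q ..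
  have cosZ: "(LINT \<omega>|Q. cos (\<theta> * Z \<omega>)) = exp (- (\<bar>\<theta>\<bar> powr \<alpha> * \<mu>))" for \<theta>
  proof -
    have "exp (- (\<bar>\<theta>\<bar> powr \<alpha> * \<mu>)) = Re (CLINT x|distr Q borel Z. iexp (\<theta> * x))"
      using ch[of \<theta>] unfolding char_def by (metis Re_complex_of_real)
    also have "\<dots> = Re (CLINT \<omega>|Q. iexp (\<theta> * Z \<omega>))"
      by (subst integral_distr) auto
    also have "\<dots> = (LINT \<omega>|Q. Re (iexp (\<theta> * Z \<omega>)))"
      by (rule integral_Re[symmetric]) (rule Q.integrable_iexp, simp_all)
    also have "\<dots> = (LINT \<omega>|Q. cos (\<theta> * Z \<omega>))" by (simp add: Re_exp)
    finally show ?thesis by simp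
  qed
  have int: "integrable (std_normal_distribution \<Otimes>\<^sub>M Q) (\<lambda>(x, \<omega>). 1 - cos (x * (Z \<omega> / r)))"
  proof (rule P.P.integrable_const_bound[where B = 2])
    show "(\<lambda>(x, \<omega>). 1 - cos (x * (Z \<omega> / r))) \<in> borel_measurable (std_normal_distribution \<Otimes>\<^sub>M Q)"
      by measurable
    show "AE x in std_normal_distribution \<Otimes>\<^sub>M Q. norm (case x of (x, \<omega>) \<Rightarrow> 1 - cos (x * (Z \<omega> / r))) \<le> 2"
    proof -
      have "\<bar>1 - cos y\<bar> \<le> 2" for y :: real
        using cos_ge_minus_one[of y] cos_le_one[of y] by linarith
      then show ?thesis by (intro AE_I2) (simp add: split_beta)
    qed
  qed
  have bnd: "integrable Q (\<lambda>\<omega>. cos (c * Z \<omega>))" for c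
    by (rule Q.integrable_const_bound[where B = 1]) auto
  have intN: "integrable std_normal_distribution (\<lambda>x. cos (x * c))" for c
    by (rule N.integrable_const_bound[where B = 1]) auto
  have inner1: "(LINT x|std_normal_distribution. 1 - cos (x * (Z \<omega> / r))) = 1 - exp (- ((Z \<omega> / r)\<^sup>2) / 2)" for \<omega>
    using intN[of "Z \<omega> / r"] N.prob_space
    by (subst Bochner_Integration.integral_diff) (simp_all only: gaussian_cos_integral, simp_all)
  have inner2: "(LINT \<omega>|Q. 1 - cos (x * (Z \<omega> / r))) = 1 - exp (- (\<bar>x / r\<bar> powr \<alpha> * \<mu>))" for x
    using bnd[of "x / r"] cosZ[of "x / r"] Q.prob_space
    by (simp add: Bochner_Integration.integral_diff)
  have eq: "(LINT \<omega>|Q. 1 - exp (- ((Z \<omega> / r)\<^sup>2) / 2))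
      = (LINT x|std_normal_distribution. 1 - exp (- (\<bar>x / r\<bar> powr \<alpha> * \<mu>)))"
    using P.Fubini_integral[OF int] unfolding inner1 inner2 by simp
  have le: "1 - exp (- (\<bar>x / r\<bar> powr \<alpha> * \<mu>)) \<le> \<mu> * r powr (- \<alpha>) * (1 + x\<^sup>2)" for x
  proof -
    have "1 - exp (- (\<bar>x / r\<bar> powr \<alpha> * \<mu>)) \<le> \<bar>x / r\<bar> powr \<alpha> * \<mu>"
      using exp_ge_add_one_self[of "- (\<bar>x / r\<bar> powr \<alpha> * \<mu>)"] by simp
    also have "\<dots> \<le> r powr (- \<alpha>) * (1 + x\<^sup>2) * \<mu>"
    proof (rule mult_right_mono[OF _ \<mu>])
      have "\<bar>x\<bar> powr \<alpha> \<le> 1 + x\<^sup>2"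
      proof (cases "\<bar>x\<bar> \<le> 1")
        case True
        then have "\<bar>x\<bar> powr \<alpha> \<le> 1 powr \<alpha>" using \<alpha> by (intro powr_mono2) auto
        then show ?thesis by (simp add: add_increasing2)
      next
        case False
        then have "\<bar>x\<bar> powr \<alpha> \<le> \<bar>x\<bar> powr 2" using \<alpha> by (intro powr_mono) auto
        also have "\<dots> = x\<^sup>2" using False by (simp add: powr_numeral)
        finally show ?thesis by simp
      qed
      moreover have "\<bar>x / r\<bar> powr \<alpha> = r powr (- \<alpha>) * \<bar>x\<bar> powr \<alpha>"
        using r by (simp add: abs_divide powr_divide powr_minus field_simps)
      ultimately show "\<bar>x / r\<bar> powr \<alpha> \<le> r powr (- \<alpha>) * (1 + x\<^sup>2)"
        by (simp add: mult_left_mono)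
    qed
    finally show ?thesis by (simp add: ac_simps)
  qed
  have "(LINT x|std_normal_distribution. 1 - exp (- (\<bar>x / r\<bar> powr \<alpha> * \<mu>)))
     \<le> (LINT x|std_normal_distribution. \<mu> * r powr (- \<alpha>) * (1 + x\<^sup>2))"
  proof (rule integral_mono[OF _ _ le])
    show "integrable std_normal_distribution (\<lambda>x. 1 - exp (- (\<bar>x / r\<bar> powr \<alpha> * \<mu>)))"
      by (rule N.integrable_const_bound[where B = 1]) (use \<mu> in auto)
    show "integrable std_normal_distribution (\<lambda>x. \<mu> * r powr (- \<alpha>) * (1 + x\<^sup>2))"
      using gaussian_second_moment(1) by auto
  qed
  also have "\<dots> = 2 * \<mu> * r powr (- \<alpha>)"
    using gaussian_second_moment N.prob_space by (simp add: Bochner_Integration.integral_add)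
  finally have *: "(LINT \<omega>|Q. 1 - exp (- ((Z \<omega> / r)\<^sup>2) / 2)) \<le> 2 * \<mu> * r powr (- \<alpha>)"
    unfolding eq .
  have "(LINT \<omega>|Q. min 1 ((Z \<omega> / r)\<^sup>2)) \<le> (LINT \<omega>|Q. 3 * (1 - exp (- ((Z \<omega> / r)\<^sup>2) / 2)))"
  proof (rule integral_mono)
    show "integrable Q (\<lambda>\<omega>. min 1 ((Z \<omega> / r)\<^sup>2))"
      by (rule Q.integrable_const_bound[where B = 1]) auto
    have "integrable Q (\<lambda>\<omega>. 1 - exp (- ((Z \<omega> / r)\<^sup>2) / 2))"
      by (rule Q.integrable_const_bound[where B = 1]) auto
    then show "integrable Q (\<lambda>\<omega>. 3 * (1 - exp (- ((Z \<omega> / r)\<^sup>2) / 2)))"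
      by (rule integrable_mult_right)
  qed (use one_minus_exp_half_ge in auto)
  also have "\<dots> = 3 * (LINT \<omega>|Q. 1 - exp (- ((Z \<omega> / r)\<^sup>2) / 2))"
    by (rule integral_mult_right_zero)
  finally show ?thesis using * by simp
qed

text \<open>
  An even characteristic function forces \<open>Z\<close> and \<open>- Z\<close> to have the same law, and truncation is an
  odd map.
\<close>

lemma symmetric_truncated_mean_eq_0:
  fixes Z :: "'p \<Rightarrow> real"
  assumes Q: "prob_space Q" and Z[measurable]: "Z \<in> borel_measurable Q"
    and ch: "\<And>\<theta>. char (distr Q borel Z) (- \<theta>) = char (distr Q borel Z) \<theta>"
  shows "(LINT \<omega>|Q. (if \<bar>Z \<omega>\<bar> \<le> r then Z \<omega> else 0)) = 0"
proof -
  interpret Q: prob_space Q by fact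
  interpret D1: real_distribution "distr Q borel Z" by (rule Q.real_distribution_distr) simp
  interpret D2: real_distribution "distr Q borel (\<lambda>\<omega>. - Z \<omega>)" by (rule Q.real_distribution_distr) simp
  have "char (distr Q borel (\<lambda>\<omega>. - Z \<omega>)) \<theta> = char (distr Q borel Z) (- \<theta>)" for \<theta>
    unfolding char_def by (simp add: integral_distr)
  then have "distr Q borel Z = distr Q borel (\<lambda>\<omega>. - Z \<omega>)"
    by (intro Levy_uniqueness D1.real_distribution_axioms D2.real_distribution_axioms) (auto simp: ch)
  then have "(LINT x|distr Q borel Z. (if \<bar>x\<bar> \<le> r then x else 0))
      = (LINT x|distr Q borel (\<lambda>\<omega>. - Z \<omega>). (if \<bar>x\<bar> \<le> r then x else 0))" by simp
  then have "(LINT \<omega>|Q. (if \<bar>Z \<omega>\<bar> \<le> r then Z \<omega> else 0)) = (LINT \<omega>|Q. (if \<bar>Z \<omega>\<bar> \<le> r then - Z \<omega> else 0))"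
    by (simp add: integral_distr)
  also have "\<dots> = (LINT \<omega>|Q. - (if \<bar>Z \<omega>\<bar> \<le> r then Z \<omega> else 0))"
    by (rule Bochner_Integration.integral_cong) auto
  also have "\<dots> = - (LINT \<omega>|Q. (if \<bar>Z \<omega>\<bar> \<le> r then Z \<omega> else 0))" by simp
  finally show ?thesis by simp
qed

section \<open>A maximal inequality for sums of independent variables\<close>

text \<open>
  Independence factorises the exponential moment of the sum; the upper bound \<open>b\<close> makes the moments
  finite.
\<close>

lemma (in prob_space) chernoff_indep_sum:
  fixes X :: "'i \<Rightarrow> 'a \<Rightarrow> real"
  assumes I: "finite I" "indep_vars (\<lambda>_. borel) X I"
    and b: "\<And>i \<omega>. i \<in> I \<Longrightarrow> X i \<omega> \<le> b" and c: "0 \<le> c"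
    and q: "\<And>i. i \<in> I \<Longrightarrow> expectation (\<lambda>\<omega>. exp (c * X i \<omega>)) \<le> exp (q i)"
  shows "prob {\<omega> \<in> space M. l \<le> (\<Sum>i\<in>I. X i \<omega>)} \<le> exp ((\<Sum>i\<in>I. q i) - c * l)"
proof -
  have [measurable]: "X i \<in> borel_measurable M" if "i \<in> I" for i
    using I(2) that by (auto simp: indep_vars_def)
  have ind: "indep_vars (\<lambda>_. borel) (\<lambda>i \<omega>. exp (c * X i \<omega>)) I"
    by (rule indep_vars_compose2[OF I(2)]) auto
  have int: "integrable M (\<lambda>\<omega>. exp (c * X i \<omega>))" if "i \<in> I" for i
    using that b[OF that] c
    by (intro integrable_const_bound[where B = "exp (c * b)"]) (auto intro!: mult_left_mono)
  have prod: "exp (c * (\<Sum>i\<in>I. X i \<omega>)) = (\<Prod>i\<in>I. exp (c * X i \<omega>))" for \<omega>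
    using I(1) by (simp add: sum_distrib_left exp_sum)
  have intp: "integrable M (\<lambda>\<omega>. exp (c * (\<Sum>i\<in>I. X i \<omega>)))"
    unfolding prod by (rule indep_vars_integrable[OF I(1) ind int])
  have "prob {\<omega> \<in> space M. l \<le> (\<Sum>i\<in>I. X i \<omega>)}
      \<le> prob {\<omega> \<in> space M. exp (c * (\<Sum>i\<in>I. X i \<omega>)) \<ge> exp (c * l)}"
    by (rule finite_measure_mono) (use c in \<open>auto intro: mult_left_mono\<close>)
  also have "\<dots> \<le> expectation (\<lambda>\<omega>. exp (c * (\<Sum>i\<in>I. X i \<omega>))) / exp (c * l)"
    by (rule integral_Markov_inequality_measure[OF intp, where A = "{}"]) auto
  also have "expectation (\<lambda>\<omega>. exp (c * (\<Sum>i\<in>I. X i \<omega>))) = (\<Prod>i\<in>I. expectation (\<lambda>\<omega>. exp (c * X i \<omega>)))"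
    unfolding prod by (rule indep_vars_lebesgue_integral[OF I(1) ind int])
  also have "\<dots> \<le> (\<Prod>i\<in>I. exp (q i))"
    by (rule prod_mono) (use q in auto)
  also have "\<dots> = exp (\<Sum>i\<in>I. q i)"
    using I(1) by (simp add: exp_sum)
  finally show ?thesis
    by (simp add: exp_diff divide_right_mono)
qed

lemma exp_le_quadratic:
  assumes "\<bar>y\<bar> \<le> (1::real)"
  shows "exp y \<le> 1 + y + y\<^sup>2"
proof (cases "0 \<le> y")
  case True then show ?thesis using exp_bound[of y] assms by simp
next
  case False
  have pos: "0 < 1 - y + y\<^sup>2 / 2" using False by (simp add: add_pos_nonneg)
  have "1 - y + y\<^sup>2 / 2 \<le> exp (- y)"
    using exp_lower_Taylor_quadratic[of "- y"] False by simp
  then have "exp y \<le> 1 / (1 - y + y\<^sup>2 / 2)"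
    using pos by (simp add: exp_minus field_simps)
  also have "\<dots> \<le> 1 + y + y\<^sup>2"
  proof -
    have "(1 + y + y\<^sup>2) * (1 - y + y\<^sup>2 / 2) = 1 + (y\<^sup>2 + - (y * y\<^sup>2) + (y\<^sup>2)\<^sup>2) / 2"
      by (simp add: field_simps power2_eq_square)
    moreover have "y * y\<^sup>2 \<le> 0" "0 \<le> y\<^sup>2 + (y\<^sup>2)\<^sup>2" using False by (simp_all add: mult_le_0_iff)
    ultimately have "1 \<le> (1 + y + y\<^sup>2) * (1 - y + y\<^sup>2 / 2)"
      by (smt (verit) divide_nonneg_nonneg)
    then show ?thesis using pos by (simp add: divide_le_eq)
  qed
  finally show ?thesis .
qed

text \<open>
  The first-order term of the exponential vanishes by symmetry, so the contribution of a small
  summand is quadratic.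
\<close>

lemma (in prob_space) exp_truncated_le:
  fixes W :: "'a \<Rightarrow> real"
  assumes [measurable]: "W \<in> borel_measurable M"
    and h: "\<bar>h\<bar> \<le> 1" and r: "0 < r"
    and sym: "expectation (\<lambda>\<omega>. (if \<bar>W \<omega>\<bar> \<le> r then W \<omega> else 0)) = 0"
  shows "expectation (\<lambda>\<omega>. exp (h * (if \<bar>W \<omega>\<bar> \<le> r then W \<omega> else 0) / r))
    \<le> exp (expectation (\<lambda>\<omega>. min 1 ((W \<omega> / r)\<^sup>2)))"
proof -
  let ?w = "\<lambda>\<omega>. if \<bar>W \<omega>\<bar> \<le> r then W \<omega> else 0"
  have intw: "integrable M ?w"
    by (rule integrable_const_bound[where B = r]) (use r in auto)
  have intm: "integrable M (\<lambda>\<omega>. min 1 ((W \<omega> / r)\<^sup>2))"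
    by (rule integrable_const_bound[where B = 1]) auto
  have le1: "\<bar>h * ?w \<omega> / r\<bar> \<le> 1" for \<omega>
  proof -
    have "\<bar>h\<bar> * \<bar>?w \<omega>\<bar> \<le> 1 * r" using h r by (intro mult_mono) auto
    then show ?thesis using r by (simp add: abs_mult divide_le_eq)
  qed
  have pt: "exp (h * ?w \<omega> / r) \<le> 1 + h * ?w \<omega> / r + min 1 ((W \<omega> / r)\<^sup>2)" for \<omega>
  proof -
    have "exp (h * ?w \<omega> / r) \<le> 1 + h * ?w \<omega> / r + (h * ?w \<omega> / r)\<^sup>2"
      by (rule exp_le_quadratic[OF le1])
    moreover have "(h * ?w \<omega> / r)\<^sup>2 \<le> min 1 ((W \<omega> / r)\<^sup>2)"
    proof (rule min.boundedI)
      show "(h * ?w \<omega> / r)\<^sup>2 \<le> 1" using le1[of \<omega>] by (metis abs_square_le_1)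
      have "\<bar>h * ?w \<omega> / r\<bar> \<le> \<bar>W \<omega> / r\<bar>"
        using h r mult_right_mono[of "\<bar>h\<bar>" 1 "\<bar>W \<omega>\<bar>"] by (auto simp: abs_mult divide_right_mono)
      then show "(h * ?w \<omega> / r)\<^sup>2 \<le> (W \<omega> / r)\<^sup>2" unfolding abs_le_square_iff .
    qed
    ultimately show ?thesis by linarith
  qed
  have "expectation (\<lambda>\<omega>. exp (h * ?w \<omega> / r))
      \<le> expectation (\<lambda>\<omega>. 1 + h * ?w \<omega> / r + min 1 ((W \<omega> / r)\<^sup>2))"
  proof (rule integral_mono[OF _ _ pt])
    show "integrable M (\<lambda>\<omega>. exp (h * ?w \<omega> / r))"
    proof (rule integrable_const_bound[where B = "exp 1"])
      show "AE \<omega> in M. norm (exp (h * ?w \<omega> / r)) \<le> exp 1"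
        using abs_le_D1[OF le1] by (intro AE_I2) (simp only: real_norm_def abs_exp_cancel exp_le_cancel_iff)
    qed measurable
    show "integrable M (\<lambda>\<omega>. 1 + h * ?w \<omega> / r + min 1 ((W \<omega> / r)\<^sup>2))"
      using intw intm by (intro Bochner_Integration.integrable_add integrable_mult_right integrable_divide) auto
  qed
  also have "\<dots> = 1 + h * expectation ?w / r + expectation (\<lambda>\<omega>. min 1 ((W \<omega> / r)\<^sup>2))"
    using intw intm prob_space by (simp add: Bochner_Integration.integral_add)
  also have "\<dots> \<le> exp (expectation (\<lambda>\<omega>. min 1 ((W \<omega> / r)\<^sup>2)))"
    using sym exp_ge_add_one_self by simp
  finally show ?thesis .
qed

text \<open>
  On the event \<open>r < \<bar>W\<bar> \<le> R\<close> one has \<open>\<bar>W\<bar> / R \<le> (R / r) (W / R)\<^sup>2\<close>; thus the truncated second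
  moment at level \<open>R\<close> also controls the first moment of the medium part. The loss \<open>R / r\<close> is
  affordable, see the choice of exponents in the summability argument below.
\<close>

lemma (in prob_space) exp_medium_le:
  fixes W :: "'a \<Rightarrow> real"
  assumes [measurable]: "W \<in> borel_measurable M" and r: "0 < r" and R: "0 < R"
  shows "expectation (\<lambda>\<omega>. exp ((if r < \<bar>W \<omega>\<bar> \<and> \<bar>W \<omega>\<bar> \<le> R then \<bar>W \<omega>\<bar> else 0) / R))
    \<le> exp (2 * (R / r) * expectation (\<lambda>\<omega>. min 1 ((W \<omega> / R)\<^sup>2)))"
proof -
  let ?w = "\<lambda>\<omega>. if r < \<bar>W \<omega>\<bar> \<and> \<bar>W \<omega>\<bar> \<le> R then \<bar>W \<omega>\<bar> else 0"
  have intm: "integrable M (\<lambda>\<omega>. min 1 ((W \<omega> / R)\<^sup>2))"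
    by (rule integrable_const_bound[where B = 1]) auto
  have le1: "0 \<le> ?w \<omega> / R" "?w \<omega> / R \<le> 1" for \<omega>
    using r R by (auto simp: divide_le_eq)
  have pt: "exp (?w \<omega> / R) \<le> 1 + 2 * (R / r) * min 1 ((W \<omega> / R)\<^sup>2)" for \<omega>
  proof -
    have "exp (?w \<omega> / R) \<le> 1 + ?w \<omega> / R + (?w \<omega> / R)\<^sup>2"
      using le1[of \<omega>] by (intro exp_bound)
    also have "(?w \<omega> / R)\<^sup>2 \<le> ?w \<omega> / R"
      using le1[of \<omega>] mult_left_mono[of "?w \<omega> / R" 1 "?w \<omega> / R"] by (simp add: power2_eq_square)
    finally have 1: "exp (?w \<omega> / R) \<le> 1 + 2 * (?w \<omega> / R)" by simp
    have "?w \<omega> / R \<le> (R / r) * min 1 ((W \<omega> / R)\<^sup>2)"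
    proof (cases "r < \<bar>W \<omega>\<bar> \<and> \<bar>W \<omega>\<bar> \<le> R")
      case True
      then have "(W \<omega> / R)\<^sup>2 \<le> 1" using R by (simp add: abs_square_le_1)
      then have "(R / r) * min 1 ((W \<omega> / R)\<^sup>2) = \<bar>W \<omega>\<bar> * \<bar>W \<omega>\<bar> / (r * R)"
        using R by (simp add: min_absorb2 power2_eq_square field_simps)
      moreover have "r * \<bar>W \<omega>\<bar> \<le> \<bar>W \<omega>\<bar> * \<bar>W \<omega>\<bar>" using True by (intro mult_right_mono) auto
      then have "\<bar>W \<omega>\<bar> / R \<le> \<bar>W \<omega>\<bar> * \<bar>W \<omega>\<bar> / (r * R)"
        using r R by (simp add: field_simps)
      ultimately show ?thesis using True by simp
    qed (use r R in auto)
    then show ?thesis using 1 by simp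
  qed
  have "expectation (\<lambda>\<omega>. exp (?w \<omega> / R)) \<le> expectation (\<lambda>\<omega>. 1 + 2 * (R / r) * min 1 ((W \<omega> / R)\<^sup>2))"
  proof (rule integral_mono[OF _ _ pt])
    show "integrable M (\<lambda>\<omega>. exp (?w \<omega> / R))"
    proof (rule integrable_const_bound[where B = "exp 1"])
      show "AE \<omega> in M. norm (exp (?w \<omega> / R)) \<le> exp 1"
        using le1 by (intro AE_I2) simp
    qed measurable
    show "integrable M (\<lambda>\<omega>. 1 + 2 * (R / r) * min 1 ((W \<omega> / R)\<^sup>2))"
      using intm by auto
  qed
  also have "\<dots> = 1 + 2 * (R / r) * expectation (\<lambda>\<omega>. min 1 ((W \<omega> / R)\<^sup>2))"
    using intm prob_space by (simp add: Bochner_Integration.integral_add)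
  also have "\<dots> \<le> exp (2 * (R / r) * expectation (\<lambda>\<omega>. min 1 ((W \<omega> / R)\<^sup>2)))"
    by (rule exp_ge_add_one_self)
  finally show ?thesis .
qed

text \<open>
  Summands with \<open>\<bar>W\<^sub>i\<bar> \<ge> R\<close> are large, those with \<open>1 / s < \<bar>W\<^sub>i\<bar> < R\<close> are medium and the others are
  small. The three terms of the bound belong to these three classes. The medium class has to be
  separated: truncating only at \<open>R\<close> would allow merely the exponential rate \<open>1 / R\<close>, too weak
  against the factor \<open>card T\<close>, and truncating only at \<open>1 / s\<close> would make the first term too large.
  Since \<open>\<bar>h t i\<bar> \<le> 1\<close>, the medium summands contribute at most the sum of their absolute values,
  which is the same variable for all \<open>t\<close>.
\<close>

lemma (in prob_space) max_linear_comb_tail: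
  fixes W :: "'i \<Rightarrow> 'a \<Rightarrow> real" and h :: "'t \<Rightarrow> 'i \<Rightarrow> real"
  assumes I: "finite I" "indep_vars (\<lambda>_. borel) W I" and T: "finite T"
    and h: "\<And>t i. t \<in> T \<Longrightarrow> i \<in> I \<Longrightarrow> \<bar>h t i\<bar> \<le> 1"
    and trunc: "\<And>i r. i \<in> I \<Longrightarrow> 0 < r \<Longrightarrow>
      expectation (\<lambda>\<omega>. min 1 ((W i \<omega> / r)\<^sup>2)) \<le> p i * r powr (- \<alpha>)"
    and sym: "\<And>i r. i \<in> I \<Longrightarrow> expectation (\<lambda>\<omega>. (if \<bar>W i \<omega>\<bar> \<le> r then W i \<omega> else 0)) = 0"
    and D: "sum p I \<le> D" and pos: "0 < s" "0 < R"
  shows "prob {\<omega> \<in> space M. \<exists>t\<in>T. 2 * l < \<bar>\<Sum>i\<in>I. h t i * W i \<omega>\<bar>}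
    \<le> D * R powr (- \<alpha>) + exp (2 * D * s * R powr (1 - \<alpha>) - l / R)
      + 2 * real (card T) * exp (D * s powr \<alpha> - s * l)"
proof -
  have W[measurable]: "W i \<in> borel_measurable M" if "i \<in> I" for i
    using I(2) that by (auto simp: indep_vars_def)
  define r where "r = 1 / s"
  have r: "0 < r" using pos by (simp add: r_def)
  define small where "small i \<omega> = (if \<bar>W i \<omega>\<bar> \<le> r then W i \<omega> else 0)" for i \<omega>
  define med where "med i \<omega> = (if r < \<bar>W i \<omega>\<bar> \<and> \<bar>W i \<omega>\<bar> \<le> R then \<bar>W i \<omega>\<bar> else 0)" for i \<omega>
  have [measurable]: "small i \<in> borel_measurable M" "med i \<in> borel_measurable M" if "i \<in> I" for i
    unfolding small_def med_def using that by measurable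
  \<comment> \<open>the exceptional events of the large, medium and small summands\<close>
  define EL where "EL = (\<Union>i\<in>I. {\<omega> \<in> space M. R \<le> \<bar>W i \<omega>\<bar>})"
  define EM where "EM = {\<omega> \<in> space M. l \<le> (\<Sum>i\<in>I. med i \<omega>)}"
  define ES where "ES = (\<Union>t\<in>T. {\<omega> \<in> space M. l \<le> (\<Sum>i\<in>I. h t i * small i \<omega>)}
      \<union> {\<omega> \<in> space M. l \<le> (\<Sum>i\<in>I. - h t i * small i \<omega>)})"
  have meas: "EL \<in> events" "EM \<in> events" "ES \<in> events"
    unfolding EL_def EM_def ES_def using I(1) T by (auto intro!: sets.finite_UN sets.Un)
  have sub: "{\<omega> \<in> space M. \<exists>t\<in>T. 2 * l < \<bar>\<Sum>i\<in>I. h t i * W i \<omega>\<bar>} \<subseteq> EL \<union> EM \<union> ES"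
  proof (rule subsetI, rule ccontr, goal_cases)
    case (1 \<omega>)
    then obtain t where t: "t \<in> T" "2 * l < \<bar>\<Sum>i\<in>I. h t i * W i \<omega>\<bar>" by blast
    have nl: "\<bar>W i \<omega>\<bar> < R" if "i \<in> I" for i using 1 that by (auto simp: EL_def)
    have nm: "(\<Sum>i\<in>I. med i \<omega>) < l" using 1 by (auto simp: EM_def)
    have ns: "\<bar>\<Sum>i\<in>I. h t i * small i \<omega>\<bar> < l"
      using 1 t by (auto simp: ES_def sum_negf abs_less_iff not_le minus_less_iff)
    have "\<bar>h t i * W i \<omega> - h t i * small i \<omega>\<bar> \<le> med i \<omega>" if "i \<in> I" for i
      using nl[OF that] h[OF t(1) that] mult_right_mono[of "\<bar>h t i\<bar>" 1 "\<bar>W i \<omega>\<bar>"]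
      by (auto simp: small_def med_def abs_mult)
    then have "\<bar>\<Sum>i\<in>I. h t i * W i \<omega> - h t i * small i \<omega>\<bar> \<le> (\<Sum>i\<in>I. med i \<omega>)"
      by (intro order.trans[OF sum_abs] sum_mono)
    then have "\<bar>\<Sum>i\<in>I. h t i * W i \<omega>\<bar> < 2 * l"
      using nm ns by (simp add: sum_subtractf)
    then show False using t by simp
  qed
  have pL: "prob EL \<le> D * R powr (- \<alpha>)"
  proof -
    have "prob EL \<le> (\<Sum>i\<in>I. prob {\<omega> \<in> space M. R \<le> \<bar>W i \<omega>\<bar>})"
      unfolding EL_def by (rule finite_measure_subadditive_finite) (use I(1) in auto)
    also have "\<dots> \<le> (\<Sum>i\<in>I. p i * R powr (- \<alpha>))"
    proof (rule sum_mono)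
      fix i assume i: "i \<in> I"
      have int: "integrable M (\<lambda>\<omega>. min 1 ((W i \<omega> / R)\<^sup>2))"
        by (rule integrable_const_bound[where B = 1]) (use i in auto)
      have "prob {\<omega> \<in> space M. R \<le> \<bar>W i \<omega>\<bar>} \<le> prob {\<omega> \<in> space M. min 1 ((W i \<omega> / R)\<^sup>2) \<ge> 1}"
      proof (rule finite_measure_mono)
        have "1 \<le> (W i \<omega> / R)\<^sup>2" if "R \<le> \<bar>W i \<omega>\<bar>" for \<omega>
        proof -
          have "1 \<le> \<bar>W i \<omega>\<bar> / R" using that pos by (simp add: le_divide_eq)
          then have "1 \<le> \<bar>W i \<omega> / R\<bar>" using pos by simp
          then have "1\<^sup>2 \<le> \<bar>W i \<omega> / R\<bar>\<^sup>2" by (intro power_mono) auto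
          then show ?thesis by (simp only: power2_abs one_power2)
        qed
        then show "{\<omega> \<in> space M. R \<le> \<bar>W i \<omega>\<bar>} \<subseteq> {\<omega> \<in> space M. 1 \<le> min 1 ((W i \<omega> / R)\<^sup>2)}" by auto
      qed (use i in measurable)
      also have "\<dots> \<le> expectation (\<lambda>\<omega>. min 1 ((W i \<omega> / R)\<^sup>2)) / 1"
        by (rule integral_Markov_inequality_measure[OF int, where A = "{}"]) auto
      also have "\<dots> \<le> p i * R powr (- \<alpha>)" using trunc[OF i pos(2)] by simp
      finally show "prob {\<omega> \<in> space M. R \<le> \<bar>W i \<omega>\<bar>} \<le> p i * R powr (- \<alpha>)" .
    qed
    also have "\<dots> \<le> D * R powr (- \<alpha>)"
      using D by (simp flip: sum_distrib_right add: mult_right_mono)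
    finally show ?thesis .
  qed
  have pM: "prob EM \<le> exp (2 * D * s * R powr (1 - \<alpha>) - l / R)"
  proof -
    have ind: "indep_vars (\<lambda>_. borel) med I"
      unfolding med_def
      by (rule indep_vars_compose2[OF I(2), where Y = "\<lambda>i w. if r < \<bar>w\<bar> \<and> \<bar>w\<bar> \<le> R then \<bar>w\<bar> else 0"]) auto
    have "prob EM \<le> exp ((\<Sum>i\<in>I. 2 * s * R powr (1 - \<alpha>) * p i) - 1 / R * l)"
      unfolding EM_def
    proof (rule chernoff_indep_sum[OF I(1) ind, where b = R])
      fix i assume i: "i \<in> I"
      have "expectation (\<lambda>\<omega>. exp (1 / R * med i \<omega>))
          \<le> exp (2 * (R / r) * expectation (\<lambda>\<omega>. min 1 ((W i \<omega> / R)\<^sup>2)))"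
        using exp_medium_le[OF W[OF i] r pos(2)] by (simp add: med_def)
      also have "\<dots> \<le> exp (2 * (R / r) * (p i * R powr (- \<alpha>)))"
        unfolding exp_le_cancel_iff using trunc[OF i pos(2)] r pos by (intro mult_left_mono) auto
      also have "2 * (R / r) * (p i * R powr (- \<alpha>)) = 2 * s * R powr (1 - \<alpha>) * p i"
        using pos by (simp add: r_def powr_diff powr_minus field_simps)
      finally show "expectation (\<lambda>\<omega>. exp (1 / R * med i \<omega>)) \<le> exp (2 * s * R powr (1 - \<alpha>) * p i)" .
    qed (use pos in \<open>auto simp: med_def\<close>)
    also have "\<dots> \<le> exp (2 * D * s * R powr (1 - \<alpha>) - l / R)"
      unfolding sum_distrib_left[symmetric]
      using mult_left_mono[OF D, of "2 * s * R powr (1 - \<alpha>)"] pos by (simp add: mult_ac)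
    finally show ?thesis .
  qed
  have pS1: "prob {\<omega> \<in> space M. l \<le> (\<Sum>i\<in>I. k i * small i \<omega>)} \<le> exp (D * s powr \<alpha> - s * l)"
    if k: "\<And>i. i \<in> I \<Longrightarrow> \<bar>k i\<bar> \<le> 1" for k
  proof -
    have ind: "indep_vars (\<lambda>_. borel) (\<lambda>i \<omega>. k i * small i \<omega>) I"
      unfolding small_def
      by (rule indep_vars_compose2[OF I(2), where Y = "\<lambda>i w. k i * (if \<bar>w\<bar> \<le> r then w else 0)"]) auto
    have "prob {\<omega> \<in> space M. l \<le> (\<Sum>i\<in>I. k i * small i \<omega>)} \<le> exp ((\<Sum>i\<in>I. s powr \<alpha> * p i) - s * l)"
    proof (rule chernoff_indep_sum[OF I(1) ind, where b = r])
      fix i assume i: "i \<in> I"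
      show "k i * small i \<omega> \<le> r" for \<omega>
      proof -
        have "\<bar>k i\<bar> * \<bar>small i \<omega>\<bar> \<le> 1 * r"
          using k[OF i] r by (intro mult_mono) (auto simp: small_def)
        then show ?thesis using abs_le_D1 by (metis abs_mult mult_1)
      qed
      have "expectation (\<lambda>\<omega>. exp (s * (k i * small i \<omega>)))
          \<le> exp (expectation (\<lambda>\<omega>. min 1 ((W i \<omega> / r)\<^sup>2)))"
        using exp_truncated_le[OF W[OF i] k[OF i] r sym[OF i]]
        by (simp add: small_def r_def mult_ac)
      also have "\<dots> \<le> exp (p i * r powr (- \<alpha>))" using trunc[OF i r] by simp
      also have "r powr (- \<alpha>) = s powr \<alpha>"
        using pos by (simp add: r_def powr_minus powr_divide)
      finally show "expectation (\<lambda>\<omega>. exp (s * (k i * small i \<omega>))) \<le> exp (s powr \<alpha> * p i)"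
        by (simp add: mult.commute)
    qed (use pos in auto)
    also have "\<dots> \<le> exp (D * s powr \<alpha> - s * l)"
      unfolding sum_distrib_left[symmetric]
      using mult_left_mono[OF D, of "s powr \<alpha>"] by (simp add: mult_ac)
    finally show ?thesis .
  qed
  have pS: "prob ES \<le> 2 * real (card T) * exp (D * s powr \<alpha> - s * l)"
  proof -
    have "prob ES \<le> (\<Sum>t\<in>T. prob ({\<omega> \<in> space M. l \<le> (\<Sum>i\<in>I. h t i * small i \<omega>)}
      \<union> {\<omega> \<in> space M. l \<le> (\<Sum>i\<in>I. - h t i * small i \<omega>)}))"
      unfolding ES_def by (rule finite_measure_subadditive_finite) (use T in \<open>auto intro!: sets.Un\<close>)
    also have "\<dots> \<le> (\<Sum>t\<in>T. 2 * exp (D * s powr \<alpha> - s * l))"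
    proof (rule sum_mono)
      fix t assume t: "t \<in> T"
      have "prob ({\<omega> \<in> space M. l \<le> (\<Sum>i\<in>I. h t i * small i \<omega>)}
          \<union> {\<omega> \<in> space M. l \<le> (\<Sum>i\<in>I. - h t i * small i \<omega>)})
        \<le> prob {\<omega> \<in> space M. l \<le> (\<Sum>i\<in>I. h t i * small i \<omega>)}
          + prob {\<omega> \<in> space M. l \<le> (\<Sum>i\<in>I. - h t i * small i \<omega>)}"
        by (rule measure_Un_le) auto
      also have "\<dots> \<le> exp (D * s powr \<alpha> - s * l) + exp (D * s powr \<alpha> - s * l)"
        by (intro add_mono pS1) (use h[OF t] in auto)
      finally show "prob ({\<omega> \<in> space M. l \<le> (\<Sum>i\<in>I. h t i * small i \<omega>)}
          \<union> {\<omega> \<in> space M. l \<le> (\<Sum>i\<in>I. - h t i * small i \<omega>)}) \<le> 2 * exp (D * s powr \<alpha> - s * l)" by simp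
    qed
    finally show ?thesis by simp
  qed
  have "prob {\<omega> \<in> space M. \<exists>t\<in>T. 2 * l < \<bar>\<Sum>i\<in>I. h t i * W i \<omega>\<bar>} \<le> prob (EL \<union> EM \<union> ES)"
    by (rule finite_measure_mono[OF sub]) (use meas in auto)
  also have "\<dots> \<le> prob EL + prob EM + prob ES"
    using measure_Un_le[of "EL \<union> EM" M ES] measure_Un_le[of EL M EM] meas by auto
  finally show ?thesis using pL pM pS by linarith
qed

section \<open>Stable integrals of simple functions\<close>

text \<open>
  Countable additivity applied to the sequence of empty sets shows that \<open>M {}\<close> is almost surely
  the sum of a constant series, hence zero; so finite families may be padded with empty sets.
\<close>

lemma random_measure_finite_additive:
  assumes M: "sas_random_measure \<alpha> Q m M" and J: "finite (J :: nat set)" "disjoint_family_on A J"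
    and A: "\<And>i. i \<in> J \<Longrightarrow> A i \<in> sets m" "\<And>i. i \<in> J \<Longrightarrow> emeasure m (A i) < \<infinity>"
  shows "AE \<omega> in Q. M (\<Union>i\<in>J. A i) \<omega> = (\<Sum>i\<in>J. M (A i) \<omega>)"
proof -
  have add: "AE \<omega> in Q. (\<lambda>i. M (B i) \<omega>) sums M (\<Union>i. B i) \<omega>"
    if "disjoint_family B" "range B \<subseteq> sets m" "emeasure m (\<Union>i. B i) < \<infinity>" for B :: "nat \<Rightarrow> 'b set"
    using M that unfolding sas_random_measure_def by blast
  have "AE \<omega> in Q. (\<lambda>i::nat. M {} \<omega>) sums M {} \<omega>"
    using add[of "\<lambda>_. {}"] by (auto simp: disjoint_family_on_def)
  then have empty: "AE \<omega> in Q. M {} \<omega> = 0"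
  proof eventually_elim
    case (elim \<omega>)
    then have "(\<lambda>i::nat. M {} \<omega>) \<longlonglongrightarrow> 0" by (intro summable_LIMSEQ_zero) (rule sums_summable)
    then show ?case by (simp add: LIMSEQ_const_iff)
  qed
  define B where "B i = (if i \<in> J then A i else {})" for i
  have U: "(\<Union>i. B i) = (\<Union>i\<in>J. A i)" by (auto simp: B_def split: if_splits)
  have "emeasure m (\<Union>i\<in>J. A i) \<le> (\<Sum>i\<in>J. emeasure m (A i))"
    using J(1) A(1) by (intro emeasure_subadditive_finite) auto
  also have "\<dots> < \<infinity>" using J(1) A(2) by simp
  finally have fin: "emeasure m (\<Union>i. B i) < \<infinity>" by (simp only: U)
  have "AE \<omega> in Q. (\<lambda>i. M (B i) \<omega>) sums M (\<Union>i. B i) \<omega>"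
  proof (rule add)
    show "disjoint_family B" using J(2) by (auto simp: B_def disjoint_family_on_def)
    show "range B \<subseteq> sets m" using A by (auto simp: B_def)
  qed (rule fin)
  with empty show ?thesis
  proof eventually_elim
    case (elim \<omega>)
    have "(\<lambda>i. M (B i) \<omega>) = (\<lambda>i. if i \<in> J then M (A i) \<omega> else 0)"
      using elim(1) by (auto simp: B_def)
    then have "(\<lambda>i. if i \<in> J then M (A i) \<omega> else 0) sums M (\<Union>i\<in>J. A i) \<omega>"
      using elim(2) U by simp
    moreover have "(\<lambda>i. if i \<in> J then M (A i) \<omega> else 0) sums (\<Sum>i\<in>J. M (A i) \<omega>)"
      by (rule sums_If_finite_set[OF J(1)])
    ultimately show ?case by (rule sums_unique2)
  qed
qed

text \<open>
  The pieces are the level sets of the map \<open>x \<mapsto> (G u x)\<^sub>u\<^sub>\<in>\<^sub>U\<close>. Only patterns with a nonzero entry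
  are kept: their pieces have finite measure, and the remaining piece carries the coefficient zero
  in every integral. The pieces are indexed by natural numbers because independence of \<open>M\<close> is
  available for such families.
\<close>

lemma simple_stable_integrals_joint_partition:
  fixes G :: "'t \<Rightarrow> 'e \<Rightarrow> real"
  assumes M: "sas_random_measure \<alpha> Q m M" and U: "finite U"
    and G: "\<And>u. u \<in> U \<Longrightarrow> simple_function m (G u)"
      "\<And>u. u \<in> U \<Longrightarrow> emeasure m {x \<in> space m. G u x \<noteq> 0} < \<infinity>"
  obtains J :: "nat set" and A and c :: "nat \<Rightarrow> 't \<Rightarrow> real" where
    "finite J" "disjoint_family_on A J"
    "\<And>i. i \<in> J \<Longrightarrow> A i \<in> sets m" "\<And>i. i \<in> J \<Longrightarrow> emeasure m (A i) < \<infinity>"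
    "\<And>i x u. i \<in> J \<Longrightarrow> x \<in> A i \<Longrightarrow> u \<in> U \<Longrightarrow> G u x = c i u"
    "\<And>u. u \<in> U \<Longrightarrow> AE \<omega> in Q. simple_stable_integral m M (G u) \<omega> = (\<Sum>i\<in>J. c i u * M (A i) \<omega>)"
proof -
  define pat where "pat x = restrict (\<lambda>u. G u x) U" for x
  define C where "C = {c \<in> pat ` space m. \<exists>u\<in>U. c u \<noteq> 0}"
  have "pat ` space m \<subseteq> (\<Pi>\<^sub>E u\<in>U. G u ` space m)" by (auto simp: pat_def)
  moreover have "finite (\<Pi>\<^sub>E u\<in>U. G u ` space m)"
    using U G(1) by (intro finite_PiE) (auto simp: simple_function_def)
  ultimately have "finite C" unfolding C_def by (auto intro: finite_subset)
  then obtain e :: "nat \<Rightarrow> 't \<Rightarrow> real" where e: "bij_betw e {0..<card C} C"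
    using ex_bij_betw_nat_finite by blast
  define J where "J = {0..<card C}"
  define A where "A i = {x \<in> space m. pat x = e i}" for i
  have eC: "e i \<in> C" if "i \<in> J" for i using e that by (auto simp: bij_betw_def J_def)
  have val: "G u x = e i u" if "x \<in> A i" "u \<in> U" for i x u
    using that unfolding A_def pat_def by (metis (mono_tags, lifting) mem_Collect_eq restrict_apply')
  have disj: "disjoint_family_on A K" if "K \<subseteq> J" for K
    unfolding disjoint_family_on_def
  proof (intro ballI impI)
    fix i j assume "i \<in> K" "j \<in> K" "i \<noteq> j"
    then have "e i \<noteq> e j" using e that by (metis J_def bij_betw_inv_into_left subsetD)
    then show "A i \<inter> A j = {}" by (auto simp: A_def)
  qed
  have finJ: "finite J" by (simp add: J_def)
  have sets: "A i \<in> sets m" if "i \<in> J" for i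
  proof -
    have "e i \<in> extensional U" using eC[OF that] by (auto simp: C_def pat_def)
    then have "pat x = e i" if "\<forall>u\<in>U. G u x = e i u" for x
      using that by (intro extensionalityI[of _ U]) (auto simp: pat_def)
    then have "A i = {x \<in> space m. \<forall>u\<in>U. G u x = e i u}"
      using val by (auto simp: A_def)
    moreover have "{x \<in> space m. \<forall>u\<in>U. G u x = e i u} \<in> sets m"
      using U borel_measurable_simple_function[OF G(1)] by (intro sets.sets_Collect_finite_All) auto
    ultimately show ?thesis by simp
  qed
  have fin: "emeasure m (A i) < \<infinity>" if i: "i \<in> J" for i
  proof -
    obtain u where u: "u \<in> U" "e i u \<noteq> 0" using eC[OF i] by (auto simp: C_def)
    have "emeasure m (A i) \<le> emeasure m {x \<in> space m. G u x \<noteq> 0}"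
      using u val[OF _ u(1)] borel_measurable_simple_function[OF G(1)[OF u(1)]]
      by (intro emeasure_mono) (auto simp: A_def)
    then show ?thesis using G(2)[OF u(1)] by (rule le_less_trans)
  qed
  have main: "AE \<omega> in Q. simple_stable_integral m M (G u) \<omega> = (\<Sum>i\<in>J. e i u * M (A i) \<omega>)"
    if u: "u \<in> U" for u
  proof -
    have level: "{x \<in> space m. G u x = y} = (\<Union>i\<in>{i \<in> J. e i u = y}. A i)" if y: "y \<noteq> 0" for y
    proof (intro set_eqI iffI)
      fix x assume x: "x \<in> {x \<in> space m. G u x = y}"
      then have "pat x \<in> C" using u y by (auto simp: C_def pat_def)
      then have "pat x \<in> e ` J" unfolding J_def bij_betw_imp_surj_on[OF e] .
      then obtain i where i: "i \<in> J" "e i = pat x" by (metis imageE)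
      then show "x \<in> (\<Union>i\<in>{i \<in> J. e i u = y}. A i)" using x u by (auto simp: A_def pat_def)
    next
      fix x assume "x \<in> (\<Union>i\<in>{i \<in> J. e i u = y}. A i)"
      then obtain i where "i \<in> J" "e i u = y" "x \<in> A i" by blast
      then show "x \<in> {x \<in> space m. G u x = y}" using val[of x i u] u by (simp add: A_def)
    qed
    have fimg: "finite (G u ` space m)" using G(1)[OF u] by (auto simp: simple_function_def)
    have "AE \<omega> in Q. \<forall>y\<in>G u ` space m. y * M {x \<in> space m. G u x = y} \<omega>
        = (\<Sum>i\<in>{i \<in> J. e i u = y}. e i u * M (A i) \<omega>)"
    proof (rule AE_finite_allI[OF fimg])
      fix y
      show "AE \<omega> in Q. y * M {x \<in> space m. G u x = y} \<omega>
        = (\<Sum>i\<in>{i \<in> J. e i u = y}. e i u * M (A i) \<omega>)"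
      proof (cases "y = 0")
        case False
        have "AE \<omega> in Q. M (\<Union>i\<in>{i \<in> J. e i u = y}. A i) \<omega> = (\<Sum>i\<in>{i \<in> J. e i u = y}. M (A i) \<omega>)"
          by (rule random_measure_finite_additive[OF M]) (use finJ disj sets fin in auto)
        then show ?thesis
          unfolding level[OF False] by eventually_elim (simp add: sum_distrib_left)
      qed simp
    qed
    then show ?thesis
    proof eventually_elim
      case (elim \<omega>)
      have "simple_stable_integral m M (G u) \<omega>
          = (\<Sum>y\<in>G u ` space m. \<Sum>i\<in>{i \<in> J. e i u = y}. e i u * M (A i) \<omega>)"
        unfolding simple_stable_integral_def by (rule sum.cong) (use elim in auto)
      also have "\<dots> = (\<Sum>i\<in>J. e i u * M (A i) \<omega>)"
      proof (rule sum.group[OF finJ fimg])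
        show "(\<lambda>i. e i u) ` J \<subseteq> G u ` space m"
        proof
          fix y assume "y \<in> (\<lambda>i. e i u) ` J"
          then obtain i where i: "i \<in> J" "y = e i u" by blast
          then obtain x where "x \<in> space m" "e i = pat x" using eC by (auto simp: C_def)
          then show "y \<in> G u ` space m" using i u by (auto simp: pat_def)
        qed
      qed
      finally show ?case .
    qed
  qed
  show ?thesis
  proof (rule that[of J A e])
    show "disjoint_family_on A J" by (rule disj) simp
    show "G u x = e i u" if "i \<in> J" "x \<in> A i" "u \<in> U" for i x u
      using that by (intro val)
  qed (fact finJ sets fin main)+
qed

lemma char_distr_mult:
  assumes "Z \<in> borel_measurable Q"
  shows "char (distr Q borel (\<lambda>\<omega>. c * Z \<omega>)) \<theta> = char (distr Q borel Z) (\<theta> * c)"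
  using assms unfolding char_def by (simp add: integral_distr mult.assoc)

text \<open>
  The maximal inequality is applied to \<open>W\<^sub>i = w\<^sub>i M(A\<^sub>i)\<close>, which is symmetric stable with scale
  parameter \<open>w\<^sub>i\<^sup>\<alpha> m(A\<^sub>i)\<close>, and to the coefficients \<open>a t i / w i\<close>. If \<open>w i\<close> is the maximum of
  \<open>\<bar>a t i\<bar>\<close> over \<open>t\<close>, then the sum in the bound for \<open>D\<close> is the integral of the \<open>\<alpha>\<close>-th power of the
  pointwise maximum of the kernels.
\<close>

lemma simple_stable_integral_max_tail:
  fixes A :: "nat \<Rightarrow> 'e set" and a :: "'t \<Rightarrow> nat \<Rightarrow> real"
  assumes M: "sas_random_measure \<alpha> Q m M" and \<alpha>: "0 < \<alpha>" "\<alpha> < 2"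
    and J: "finite J" "disjoint_family_on A J"
      "\<And>i. i \<in> J \<Longrightarrow> A i \<in> sets m" "\<And>i. i \<in> J \<Longrightarrow> emeasure m (A i) < \<infinity>"
    and T: "finite T"
    and w: "\<And>t i. t \<in> T \<Longrightarrow> i \<in> J \<Longrightarrow> \<bar>a t i\<bar> \<le> w i" "\<And>i. i \<in> J \<Longrightarrow> 0 \<le> w i"
    and D: "6 * (\<Sum>i\<in>J. w i powr \<alpha> * measure m (A i)) \<le> D" and pos: "0 < s" "0 < R"
  shows "measure Q {\<omega> \<in> space Q. \<exists>t\<in>T. 2 * l < \<bar>\<Sum>i\<in>J. a t i * M (A i) \<omega>\<bar>}
    \<le> D * R powr (- \<alpha>) + exp (2 * D * s * R powr (1 - \<alpha>) - l / R)
      + 2 * real (card T) * exp (D * s powr \<alpha> - s * l)"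
proof -
  interpret Q: prob_space Q using M by (simp add: sas_random_measure_def)
  have meas[measurable]: "M (A i) \<in> borel_measurable Q" if "i \<in> J" for i
    using M J that by (auto simp: sas_random_measure_def)
  have ch: "char (distr Q borel (M (A i))) \<theta>
      = complex_of_real (exp (- (\<bar>\<theta>\<bar> powr \<alpha> * measure m (A i))))" if "i \<in> J" for i \<theta>
    using M J that by (auto simp: sas_random_measure_def)
  have ind: "Q.indep_vars (\<lambda>_. borel) (\<lambda>i. M (A i)) J"
    using M J by (auto simp: sas_random_measure_def)
  define W where "W i \<omega> = w i * M (A i) \<omega>" for i \<omega>
  define h where "h t i = (if w i = 0 then 0 else a t i / w i)" for t i
  have hW: "h t i * W i \<omega> = a t i * M (A i) \<omega>" if "t \<in> T" "i \<in> J" for t i \<omega>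
    using w(1)[OF that] w(2)[OF that(2)] by (auto simp: h_def W_def)
  have chW: "char (distr Q borel (W i)) \<theta>
      = complex_of_real (exp (- (\<bar>\<theta>\<bar> powr \<alpha> * (w i powr \<alpha> * measure m (A i)))))" if "i \<in> J" for i \<theta>
    unfolding W_def char_distr_mult[OF meas[OF that]] ch[OF that]
    using w(2)[OF that] by (simp add: abs_mult powr_mult mult.assoc)
  have Wm: "W i \<in> borel_measurable Q" if "i \<in> J" for i
    unfolding W_def using that by measurable
  have "Q.prob {\<omega> \<in> space Q. \<exists>t\<in>T. 2 * l < \<bar>\<Sum>i\<in>J. h t i * W i \<omega>\<bar>}
    \<le> D * R powr (- \<alpha>) + exp (2 * D * s * R powr (1 - \<alpha>) - l / R)
      + 2 * real (card T) * exp (D * s powr \<alpha> - s * l)"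
  proof (rule Q.max_linear_comb_tail[OF J(1) _ T _ _ _ _ pos, where p = "\<lambda>i. 6 * (w i powr \<alpha> * measure m (A i))"])
    show "Q.indep_vars (\<lambda>_. borel) W J"
      unfolding W_def by (rule Q.indep_vars_compose2[OF ind]) auto
    show "\<bar>h t i\<bar> \<le> 1" if "t \<in> T" "i \<in> J" for t i
      using w(1)[OF that] w(2)[OF that(2)] by (simp add: h_def divide_le_eq)
    show "Q.expectation (\<lambda>\<omega>. min 1 ((W i \<omega> / r)\<^sup>2)) \<le> 6 * (w i powr \<alpha> * measure m (A i)) * r powr (- \<alpha>)"
      if "i \<in> J" "0 < r" for i r
      by (rule truncated_second_moment_le[OF Q.prob_space_axioms Wm \<alpha> _ _ chW]) (use that in auto)
    show "Q.expectation (\<lambda>\<omega>. (if \<bar>W i \<omega>\<bar> \<le> r then W i \<omega> else 0)) = 0" if "i \<in> J" for i r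
      by (rule symmetric_truncated_mean_eq_0[OF Q.prob_space_axioms Wm[OF that]]) (simp add: chW[OF that])
    show "(\<Sum>i\<in>J. 6 * (w i powr \<alpha> * measure m (A i))) \<le> D"
      using D by (simp add: sum_distrib_left)
  qed
  moreover have "(\<Sum>i\<in>J. h t i * W i \<omega>) = (\<Sum>i\<in>J. a t i * M (A i) \<omega>)" if "t \<in> T" for t \<omega>
    by (rule sum.cong) (use hW that in auto)
  then have "(\<exists>t\<in>T. 2 * l < \<bar>\<Sum>i\<in>J. h t i * W i \<omega>\<bar>)
      \<longleftrightarrow> (\<exists>t\<in>T. 2 * l < \<bar>\<Sum>i\<in>J. a t i * M (A i) \<omega>\<bar>)" for \<omega>
    by metis
  ultimately show ?thesis by (simp only:)
qed

section \<open>The maximal inequality for stable integrals\<close>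

text \<open>
  A substitute for the triangle inequality that holds for all \<open>0 < \<alpha> < 2\<close> with the constant
  \<open>4 \<ge> 2\<^sup>\<alpha>\<close>.
\<close>

lemma powr_abs_le_add:
  fixes a b :: real
  assumes "0 < \<alpha>" "\<alpha> < 2"
  shows "\<bar>a\<bar> powr \<alpha> \<le> 4 * (\<bar>b\<bar> powr \<alpha> + \<bar>a - b\<bar> powr \<alpha>)"
proof -
  define c where "c = max \<bar>b\<bar> \<bar>a - b\<bar>"
  have "\<bar>a\<bar> \<le> \<bar>b\<bar> + \<bar>a - b\<bar>" by linarith
  also have "\<dots> \<le> c + c" unfolding c_def by (intro add_mono) simp_all
  finally have "\<bar>a\<bar> \<le> 2 * c" by simp
  then have "\<bar>a\<bar> powr \<alpha> \<le> (2 * c) powr \<alpha>" using assms by (intro powr_mono2) auto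
  also have "\<dots> = 2 powr \<alpha> * c powr \<alpha>" by (simp add: c_def powr_mult)
  also have "\<dots> \<le> 2 powr 2 * c powr \<alpha>" using assms by (intro mult_right_mono powr_mono) auto
  also have "\<dots> = 4 * c powr \<alpha>" by simp
  also have "c powr \<alpha> \<le> \<bar>b\<bar> powr \<alpha> + \<bar>a - b\<bar> powr \<alpha>" by (auto simp: c_def max_def)
  finally show ?thesis by simp
qed

lemma in_L_alpha_diff:
  assumes "0 < \<alpha>" "\<alpha> < 2" "in_L_alpha \<alpha> m f" "in_L_alpha \<alpha> m g"
  shows "in_L_alpha \<alpha> m (\<lambda>x. f x - g x)"
  unfolding in_L_alpha_def
proof
  have [measurable]: "f \<in> borel_measurable m" "g \<in> borel_measurable m" using assms by (auto simp: in_L_alpha_def)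
  show "(\<lambda>x. f x - g x) \<in> borel_measurable m" by measurable
  show "integrable m (\<lambda>x. \<bar>f x - g x\<bar> powr \<alpha>)"
  proof (rule Bochner_Integration.integrable_bound)
    show "integrable m (\<lambda>x. 4 * (\<bar>f x\<bar> powr \<alpha> + \<bar>g x\<bar> powr \<alpha>))"
      using assms by (auto simp: in_L_alpha_def)
    show "AE x in m. norm (\<bar>f x - g x\<bar> powr \<alpha>) \<le> norm (4 * (\<bar>f x\<bar> powr \<alpha> + \<bar>g x\<bar> powr \<alpha>))"
    proof (rule AE_I2)
      fix x
      show "norm (\<bar>f x - g x\<bar> powr \<alpha>) \<le> norm (4 * (\<bar>f x\<bar> powr \<alpha> + \<bar>g x\<bar> powr \<alpha>))"
        using powr_abs_le_add[OF assms(1,2), of "f x - g x" "f x"] by simp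
    qed
  qed measurable
qed

lemma simple_function_in_L_alpha:
  assumes \<alpha>: "0 < \<alpha>" and g: "simple_function m g" "emeasure m {x \<in> space m. g x \<noteq> (0::real)} < \<infinity>"
  shows "in_L_alpha \<alpha> m g"
  unfolding in_L_alpha_def
proof
  show [measurable]: "g \<in> borel_measurable m" using g(1) by (rule borel_measurable_simple_function)
  have "integrable m (\<lambda>x. Max ((\<lambda>y. \<bar>y\<bar> powr \<alpha>) ` g ` space m) * indicator {x \<in> space m. g x \<noteq> 0} x)"
    using g(2) by (intro integrable_mult_right integrable_real_indicator) auto
  then show "integrable m (\<lambda>x. \<bar>g x\<bar> powr \<alpha>)"
  proof (rule Bochner_Integration.integrable_bound)
    show "AE x in m. norm (\<bar>g x\<bar> powr \<alpha>)
       \<le> norm (Max ((\<lambda>y. \<bar>y\<bar> powr \<alpha>) ` g ` space m) * indicator {x \<in> space m. g x \<noteq> 0} x :: real)"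
    proof (rule AE_I2)
      fix x assume x: "x \<in> space m"
      have "\<bar>g x\<bar> powr \<alpha> \<le> Max ((\<lambda>y. \<bar>y\<bar> powr \<alpha>) ` g ` space m)"
        using g(1) x by (intro Max_ge) (auto simp: simple_function_def)
      then show "norm (\<bar>g x\<bar> powr \<alpha>)
       \<le> norm (Max ((\<lambda>y. \<bar>y\<bar> powr \<alpha>) ` g ` space m) * indicator {x \<in> space m. g x \<noteq> 0} x :: real)"
        using \<alpha> x by (cases "g x = 0") auto
    qed
  qed measurable
qed

text \<open>
  All kernels occurring in \<open>T\<close> are approximated simultaneously by simple functions. The pointwise
  maximum of the approximating increments has an \<open>\<alpha>\<close>-th power at most 4 times that of the given
  ones plus 32 times the approximation error; with the factor 6 of the simple case this explains
  the constant 24. The integrals converge in probability, and the strict inequality for \<open>D\<close>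
  absorbs the error. One of the three thresholds \<open>l\<close> pays for the two endpoints of an increment.
\<close>

lemma stable_integral_max_tail:
  fixes f :: "'t \<Rightarrow> 'e \<Rightarrow> real" and I :: "'t \<Rightarrow> 'p \<Rightarrow> real" and T :: "('t \<times> 't) set"
  assumes M: "sas_random_measure \<alpha> Q m M" and \<alpha>: "0 < \<alpha>" "\<alpha> < 2"
    and int: "\<And>u. has_stable_integral \<alpha> Q m M (f u) (I u)"
    and T: "finite T" "T \<noteq> {}"
    and D: "24 * (LINT x|m. (MAX t\<in>T. \<bar>f (fst t) x - f (snd t) x\<bar> powr \<alpha>)) < D"
    and pos: "0 < s" "0 < R" "0 < l"
  shows "measure Q {\<omega> \<in> space Q. \<exists>t\<in>T. 3 * l < \<bar>I (fst t) \<omega> - I (snd t) \<omega>\<bar>}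
    \<le> D * R powr (- \<alpha>) + exp (2 * D * s * R powr (1 - \<alpha>) - l / R)
      + 2 * real (card T) * exp (D * s powr \<alpha> - s * l)" (is "measure Q ?E \<le> ?b")
proof -
  interpret Q: prob_space Q using M by (simp add: sas_random_measure_def)
  define U where "U = fst ` T \<union> snd ` T"
  have U: "finite U" "\<And>t. t \<in> T \<Longrightarrow> fst t \<in> U \<and> snd t \<in> U" using T by (auto simp: U_def)
  have fL: "in_L_alpha \<alpha> m (f u)" and I[measurable]: "I u \<in> borel_measurable Q" for u
    using int[of u] by (auto simp: has_stable_integral_def)
  have fm[measurable]: "f u \<in> borel_measurable m" for u using fL by (auto simp: in_L_alpha_def)
  have "\<forall>u. \<exists>g :: nat \<Rightarrow> 'e \<Rightarrow> real.
        (\<forall>k. simple_function m (g k) \<and> emeasure m {x \<in> space m. g k x \<noteq> 0} < \<infinity>) \<and>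
        (\<lambda>k. LINT x|m. \<bar>g k x - f u x\<bar> powr \<alpha>) \<longlonglongrightarrow> 0 \<and>
        (\<forall>\<epsilon>>0. (\<lambda>k. measure Q {\<omega> \<in> space Q. \<bar>simple_stable_integral m M (g k) \<omega> - I u \<omega>\<bar> > \<epsilon>})
           \<longlonglongrightarrow> 0)"
    using int by (auto simp: has_stable_integral_def)
  from choice[OF this] obtain g :: "'t \<Rightarrow> nat \<Rightarrow> 'e \<Rightarrow> real" where
    gg: "\<forall>u. (\<forall>k. simple_function m (g u k) \<and> emeasure m {x \<in> space m. g u k x \<noteq> 0} < \<infinity>) \<and>
        (\<lambda>k. LINT x|m. \<bar>g u k x - f u x\<bar> powr \<alpha>) \<longlonglongrightarrow> 0 \<and>
        (\<forall>\<epsilon>>0. (\<lambda>k. measure Q {\<omega> \<in> space Q. \<bar>simple_stable_integral m M (g u k) \<omega> - I u \<omega>\<bar> > \<epsilon>})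
           \<longlonglongrightarrow> 0)" ..
  have g: "\<And>u k. simple_function m (g u k)" "\<And>u k. emeasure m {x \<in> space m. g u k x \<noteq> 0} < \<infinity>"
    and g_lim: "\<And>u. (\<lambda>k. LINT x|m. \<bar>g u k x - f u x\<bar> powr \<alpha>) \<longlonglongrightarrow> 0"
    and S_lim: "\<And>u \<epsilon>. 0 < \<epsilon> \<Longrightarrow>
      (\<lambda>k. measure Q {\<omega> \<in> space Q. \<bar>simple_stable_integral m M (g u k) \<omega> - I u \<omega>\<bar> > \<epsilon>}) \<longlonglongrightarrow> 0"
    using gg by simp_all
  define F where "F x = (MAX t\<in>T. \<bar>f (fst t) x - f (snd t) x\<bar> powr \<alpha>)" for x
  have F_ge: "\<bar>f (fst t) x - f (snd t) x\<bar> powr \<alpha> \<le> F x" if "t \<in> T" for t x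
    unfolding F_def using T that by (intro Max_ge) auto
  have F_nonneg: "0 \<le> F x" for x
    using F_ge T(2) powr_ge_zero order.trans by (metis ex_in_conv)
  have F_int: "integrable m F"
  proof (rule Bochner_Integration.integrable_bound)
    show "integrable m (\<lambda>x. \<Sum>t\<in>T. \<bar>f (fst t) x - f (snd t) x\<bar> powr \<alpha>)"
      using in_L_alpha_diff[OF \<alpha> fL fL] by (auto simp: in_L_alpha_def)
    show "F \<in> borel_measurable m"
      unfolding F_def using T(1) by (intro borel_measurable_Max) auto
    show "AE x in m. norm (F x) \<le> norm (\<Sum>t\<in>T. \<bar>f (fst t) x - f (snd t) x\<bar> powr \<alpha>)"
    proof (rule AE_I2)
      fix x
      have "F x \<le> (\<Sum>t\<in>T. \<bar>f (fst t) x - f (snd t) x\<bar> powr \<alpha>)"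
        unfolding F_def using T by (subst Max_le_iff) (auto intro!: member_le_sum)
      then show "norm (F x) \<le> norm (\<Sum>t\<in>T. \<bar>f (fst t) x - f (snd t) x\<bar> powr \<alpha>)"
        using F_nonneg[of x] by (simp add: sum_nonneg)
    qed
  qed
  define err where "err k x = (\<Sum>u\<in>U. \<bar>g u k x - f u x\<bar> powr \<alpha>)" for k x
  have err_int: "integrable m (err k)" for k
    unfolding err_def using in_L_alpha_diff[OF \<alpha> simple_function_in_L_alpha[OF \<alpha>(1) g] fL]
    by (auto simp: in_L_alpha_def)
  have "(\<lambda>k. LINT x|m. err k x) = (\<lambda>k. \<Sum>u\<in>U. LINT x|m. \<bar>g u k x - f u x\<bar> powr \<alpha>)"
    unfolding err_def using in_L_alpha_diff[OF \<alpha> simple_function_in_L_alpha[OF \<alpha>(1) g] fL]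
    by (subst Bochner_Integration.integral_sum) (auto simp: in_L_alpha_def)
  then have "(\<lambda>k. LINT x|m. err k x) \<longlonglongrightarrow> 0"
    using tendsto_sum[of U, OF g_lim] by simp
  then have "(\<lambda>k. 24 * (LINT x|m. F x) + 192 * (LINT x|m. err k x)) \<longlonglongrightarrow> 24 * (LINT x|m. F x) + 192 * 0"
    by (intro tendsto_intros)
  then have ev: "\<forall>\<^sub>F k in sequentially. 24 * (LINT x|m. F x) + 192 * (LINT x|m. err k x) < D"
    using D by (intro order_tendstoD(2)) (auto simp: F_def)
  define bad where "bad k u = {\<omega> \<in> space Q. l / 2 < \<bar>simple_stable_integral m M (g u k) \<omega> - I u \<omega>\<bar>}" for k u
  have "measure Q ?E \<le> ?b + (\<Sum>u\<in>U. measure Q (bad k u))"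
    if k: "24 * (LINT x|m. F x) + 192 * (LINT x|m. err k x) < D" for k
  proof -
    obtain J :: "nat set" and A and c :: "nat \<Rightarrow> 't \<Rightarrow> real" where
      J: "finite J" "disjoint_family_on A J"
        "\<And>i. i \<in> J \<Longrightarrow> A i \<in> sets m" "\<And>i. i \<in> J \<Longrightarrow> emeasure m (A i) < \<infinity>"
      and val: "\<And>i x u. i \<in> J \<Longrightarrow> x \<in> A i \<Longrightarrow> u \<in> U \<Longrightarrow> g u k x = c i u"
      and S: "\<And>u. u \<in> U \<Longrightarrow> AE \<omega> in Q. simple_stable_integral m M (g u k) \<omega> = (\<Sum>i\<in>J. c i u * M (A i) \<omega>)"
      by (rule simple_stable_integrals_joint_partition[OF M U(1), of "\<lambda>u. g u k"]) (use g in blast)+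
    define a where "a t i = c i (fst t) - c i (snd t)" for t i
    define w where "w i = (MAX t\<in>T. \<bar>a t i\<bar>)" for i
    have w: "\<bar>a t i\<bar> \<le> w i" if "t \<in> T" for t i
      unfolding w_def using T that by (intro Max_ge) auto
    have w0: "0 \<le> w i" for i using w T(2) abs_ge_zero order.trans by (metis ex_in_conv)
    have ptw: "w i powr \<alpha> \<le> 4 * F x + 32 * err k x" if i: "i \<in> J" and x: "x \<in> A i" for i x
    proof -
      have "w i \<in> (\<lambda>t. \<bar>a t i\<bar>) ` T" unfolding w_def using T by (intro Max_in) auto
      then obtain t where t: "t \<in> T" "w i = \<bar>a t i\<bar>" by blast
      let ?p = "fst t" and ?q = "snd t"
      have pq: "?p \<in> U" "?q \<in> U" using U(2)[OF t(1)] by auto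
      have le: "\<bar>g u k x - f u x\<bar> powr \<alpha> \<le> err k x" if "u \<in> U" for u
        unfolding err_def using U(1) that by (intro member_le_sum) auto
      \<comment> \<open>the increments differ by at most \<open>8 err k x\<close>, whence \<open>4 (F x + 8 err k x)\<close>\<close>
      have "\<bar>(g ?p k x - g ?q k x) - (f ?p x - f ?q x)\<bar> powr \<alpha>
          \<le> 4 * (\<bar>g ?p k x - f ?p x\<bar> powr \<alpha> + \<bar>(g ?p k x - g ?q k x) - (f ?p x - f ?q x) - (g ?p k x - f ?p x)\<bar> powr \<alpha>)"
        by (rule powr_abs_le_add[OF \<alpha>])
      also have "\<bar>(g ?p k x - g ?q k x) - (f ?p x - f ?q x) - (g ?p k x - f ?p x)\<bar> = \<bar>g ?q k x - f ?q x\<bar>"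
        by linarith
      also have "4 * (\<bar>g ?p k x - f ?p x\<bar> powr \<alpha> + \<bar>g ?q k x - f ?q x\<bar> powr \<alpha>) \<le> 4 * (err k x + err k x)"
        by (intro mult_left_mono add_mono le pq) simp
      finally have 1: "\<bar>(g ?p k x - g ?q k x) - (f ?p x - f ?q x)\<bar> powr \<alpha> \<le> 8 * err k x" by simp
      have "w i powr \<alpha> = \<bar>g ?p k x - g ?q k x\<bar> powr \<alpha>"
        using t val[OF i x pq(1)] val[OF i x pq(2)] by (simp add: a_def)
      also have "\<dots> \<le> 4 * (\<bar>f ?p x - f ?q x\<bar> powr \<alpha> + \<bar>(g ?p k x - g ?q k x) - (f ?p x - f ?q x)\<bar> powr \<alpha>)"
        by (rule powr_abs_le_add[OF \<alpha>])
      also have "\<dots> \<le> 4 * (F x + 8 * err k x)"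
        by (intro mult_left_mono add_mono 1 F_ge[OF t(1)]) simp
      also have "\<dots> = 4 * F x + 32 * err k x" by simp
      finally show ?thesis .
    qed
    have err0: "0 \<le> err k x" for x unfolding err_def by (intro sum_nonneg) auto
    have "(\<Sum>i\<in>J. w i powr \<alpha> * measure m (A i)) = (LINT x|m. (\<Sum>i\<in>J. w i powr \<alpha> * indicator (A i) x))"
      using J by (subst Bochner_Integration.integral_sum) (auto intro!: integrable_mult_right integrable_real_indicator sum.cong dest: sets.sets_into_space simp: Int_absorb2)
    also have "\<dots> \<le> (LINT x|m. 4 * F x + 32 * err k x)"
    proof (rule integral_mono)
      show "integrable m (\<lambda>x. \<Sum>i\<in>J. w i powr \<alpha> * indicator (A i) x)"
        using J by (intro Bochner_Integration.integrable_sum integrable_mult_right integrable_real_indicator) auto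
      show "integrable m (\<lambda>x. 4 * F x + 32 * err k x)"
        using F_int err_int by auto
      fix x
      show "(\<Sum>i\<in>J. w i powr \<alpha> * indicator (A i) x) \<le> 4 * F x + 32 * err k x"
      proof (cases "\<exists>i\<in>J. x \<in> A i")
        case True
        then obtain i where i: "i \<in> J" "x \<in> A i" by blast
        have "(\<Sum>j\<in>J. w j powr \<alpha> * indicator (A j) x) = (\<Sum>j\<in>J. if j = i then w i powr \<alpha> else 0)"
        proof (rule sum.cong)
          fix j assume "j \<in> J"
          then show "w j powr \<alpha> * indicator (A j) x = (if j = i then w i powr \<alpha> else 0)"
            using J(2) i by (auto simp: disjoint_family_on_def indicator_def)
        qed simp
        then show ?thesis using i J(1) ptw[OF i] by simp
      next
        case False
        then have "(\<Sum>i\<in>J. w i powr \<alpha> * indicator (A i) x) = 0" by (intro sum.neutral) auto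
        then show ?thesis using F_nonneg[of x] err0[of x] by simp
      qed
    qed
    also have "\<dots> = 4 * (LINT x|m. F x) + 32 * (LINT x|m. err k x)"
      using F_int err_int by simp
    finally have D': "6 * (\<Sum>i\<in>J. w i powr \<alpha> * measure m (A i)) \<le> D" using k by linarith
    define E' where "E' = {\<omega> \<in> space Q. \<exists>t\<in>T. 2 * l < \<bar>\<Sum>i\<in>J. a t i * M (A i) \<omega>\<bar>}"
    have E': "measure Q E' \<le> ?b"
      unfolding E'_def by (rule simple_stable_integral_max_tail[OF M \<alpha> J T(1) w w0 D' pos(1,2)])
    have MA[measurable]: "M (A i) \<in> borel_measurable Q" if "i \<in> J" for i
      using M J that by (auto simp: sas_random_measure_def)
    have SS: "simple_stable_integral m M (g u k) \<in> borel_measurable Q" for u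
    proof -
      have "(\<lambda>\<omega>. y * M {x \<in> space m. g u k x = y} \<omega>) \<in> borel_measurable Q" for y
      proof (cases "y = 0")
        case False
        have s: "{x \<in> space m. g u k x = y} \<in> sets m" "{x \<in> space m. g u k x \<noteq> 0} \<in> sets m"
          using borel_measurable_simple_function[OF g(1)] by measurable
        then have "emeasure m {x \<in> space m. g u k x = y} \<le> emeasure m {x \<in> space m. g u k x \<noteq> 0}"
          using False by (intro emeasure_mono) auto
        then have "emeasure m {x \<in> space m. g u k x = y} < \<infinity>" using g(2) le_less_trans by blast
        then show ?thesis using M s by (intro borel_measurable_times) (auto simp: sas_random_measure_def)
      qed simp
      then show ?thesis unfolding simple_stable_integral_def[abs_def] by (intro borel_measurable_sum)
    qed
    have bm: "bad k u \<in> sets Q" for u unfolding bad_def using SS[of u] by measurable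
    have E'm: "E' \<in> sets Q"
    proof -
      have "(\<lambda>\<omega>. \<Sum>i\<in>J. a t i * M (A i) \<omega>) \<in> borel_measurable Q" for t
        by (intro borel_measurable_sum borel_measurable_times) auto
      then show ?thesis unfolding E'_def using T(1)
        by (intro sets.sets_Collect_finite_Ex) auto
    qed
    have Um: "E' \<union> (\<Union>u\<in>U. bad k u) \<in> sets Q" using E'm bm U(1) by auto
    have "AE \<omega> in Q. \<forall>u\<in>U. simple_stable_integral m M (g u k) \<omega> = (\<Sum>i\<in>J. c i u * M (A i) \<omega>)"
      using S by (intro AE_finite_allI[OF U(1)])
    then have "AE \<omega> in Q. \<omega> \<in> ?E \<longrightarrow> \<omega> \<in> E' \<union> (\<Union>u\<in>U. bad k u)"
    proof eventually_elim
      case (elim \<omega>)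
      show ?case
      proof (rule impI, rule ccontr)
        assume E: "\<omega> \<in> ?E" and n: "\<omega> \<notin> E' \<union> (\<Union>u\<in>U. bad k u)"
        then obtain t where t: "t \<in> T" "3 * l < \<bar>I (fst t) \<omega> - I (snd t) \<omega>\<bar>" "\<omega> \<in> space Q" by blast
        let ?S = "\<lambda>u. \<Sum>i\<in>J. c i u * M (A i) \<omega>"
        have near: "\<bar>?S u - I u \<omega>\<bar> \<le> l / 2" if "u \<in> U" for u
          using n t(3) that elim by (fastforce simp: bad_def not_less)
        have "(\<Sum>i\<in>J. a t i * M (A i) \<omega>) = ?S (fst t) - ?S (snd t)"
          by (simp add: a_def left_diff_distrib sum_subtractf)
        moreover have "\<bar>\<Sum>i\<in>J. a t i * M (A i) \<omega>\<bar> \<le> 2 * l"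
          using n t unfolding E'_def by (auto simp: not_less)
        ultimately show False
          using near[of "fst t"] near[of "snd t"] U(2)[OF t(1)] t(2) by linarith
      qed
    qed
    then have "measure Q ?E \<le> measure Q (E' \<union> (\<Union>u\<in>U. bad k u))"
      by (rule Q.finite_measure_mono_AE[OF _ Um])
    also have "\<dots> \<le> measure Q E' + measure Q (\<Union>u\<in>U. bad k u)"
      using E'm bm U(1) by (intro measure_Un_le) auto
    also have "measure Q (\<Union>u\<in>U. bad k u) \<le> (\<Sum>u\<in>U. measure Q (bad k u))"
      using bm U(1) by (intro Q.finite_measure_subadditive_finite) auto
    finally show ?thesis using E' by linarith
  qed
  then have "\<forall>\<^sub>F k in sequentially. measure Q ?E \<le> ?b + (\<Sum>u\<in>U. measure Q (bad k u))"
    by (rule eventually_mono[OF ev])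
  moreover have "(\<lambda>k. ?b + (\<Sum>u\<in>U. measure Q (bad k u))) \<longlonglongrightarrow> ?b + (\<Sum>u\<in>U. 0)"
    unfolding bad_def using pos by (intro tendsto_intros S_lim) auto
  ultimately have "measure Q ?E \<le> ?b + (\<Sum>u\<in>U. 0)"
    by (intro tendsto_lowerbound[OF _ _ sequentially_bot])
  then show ?thesis by simp
qed

section \<open>Increments of fields with equal finite-dimensional distributions\<close>

lemma eq_fdd_integral:
  fixes F :: "('t \<Rightarrow> real) \<Rightarrow> real"
  assumes eq: "eq_fdd P X Q Y" and X: "random_field P X" and Y: "random_field Q Y"
    and J: "finite J" and F: "F \<in> borel_measurable (Pi\<^sub>M J (\<lambda>_. borel))"
  shows "(LINT \<omega>|P. F (\<lambda>t\<in>J. X t \<omega>)) = (LINT \<omega>|Q. F (\<lambda>t\<in>J. Y t \<omega>))"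
proof -
  have [measurable]: "X t \<in> borel_measurable P" "Y t \<in> borel_measurable Q" for t
    using X Y by (auto simp: random_field_def)
  have "(LINT z|distr P (Pi\<^sub>M J (\<lambda>_. borel)) (\<lambda>\<omega>. \<lambda>t\<in>J. X t \<omega>). F z)
      = (LINT z|distr Q (Pi\<^sub>M J (\<lambda>_. borel)) (\<lambda>\<omega>. \<lambda>t\<in>J. Y t \<omega>). F z)"
    using eq J by (simp add: eq_fdd_def)
  then show ?thesis
    using F by (subst (asm) (1 2) integral_distr) (auto intro!: measurable_restrict)
qed

lemma eq_fdd_increment_expectation:
  assumes eq: "eq_fdd P X Q Y" and X: "random_field P X" and Y: "random_field Q Y"
  shows "(LINT \<omega>|P. min 1 \<bar>X p \<omega> - X q \<omega>\<bar>) = (LINT \<omega>|Q. min 1 \<bar>Y p \<omega> - Y q \<omega>\<bar>)"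
  using eq_fdd_integral[OF eq X Y, of "{p, q}" "\<lambda>z. min 1 \<bar>z p - z q\<bar>"] by simp

lemma increment_event_eq_integral:
  assumes "finite T" "fst ` T \<union> snd ` T \<subseteq> J"
  shows "measure R {\<omega> \<in> space R. \<exists>t\<in>T. l < \<bar>W (fst t) \<omega> - W (snd t) \<omega>\<bar>}
    = (LINT \<omega>|R. indicator {z. \<exists>t\<in>T. l < \<bar>z (fst t) - z (snd t)\<bar>} (\<lambda>t\<in>J. W t \<omega> :: real))"
proof -
  let ?A = "{\<omega> \<in> space R. \<exists>t\<in>T. l < \<bar>W (fst t) \<omega> - W (snd t) \<omega>\<bar>}"
  have "indicator {z. \<exists>t\<in>T. l < \<bar>z (fst t) - z (snd t)\<bar>} (\<lambda>t\<in>J. W t \<omega>) = (indicator ?A \<omega> :: real)"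
    if \<omega>: "\<omega> \<in> space R" for \<omega>
  proof -
    have "(\<lambda>t\<in>J. W t \<omega>) (fst t) = W (fst t) \<omega>" "(\<lambda>t\<in>J. W t \<omega>) (snd t) = W (snd t) \<omega>" if "t \<in> T" for t
      using that assms by auto
    then show ?thesis using \<omega> by (simp add: indicator_def)
  qed
  then have "(LINT \<omega>|R. indicator {z. \<exists>t\<in>T. l < \<bar>z (fst t) - z (snd t)\<bar>} (\<lambda>t\<in>J. W t \<omega>))
      = (LINT \<omega>|R. (indicator ?A \<omega> :: real))"
    by (intro Bochner_Integration.integral_cong) auto
  also have "\<dots> = measure R ?A" by (simp add: Int_absorb2 Collect_restrict)
  finally show ?thesis by simp
qed

lemma eq_fdd_increment_prob:
  fixes X :: "'t \<Rightarrow> 'w \<Rightarrow> real" and Y :: "'t \<Rightarrow> 'p \<Rightarrow> real"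
  assumes eq: "eq_fdd P X Q Y" and X: "random_field P X" and Y: "random_field Q Y"
    and T: "finite T"
  shows "measure P {\<omega> \<in> space P. \<exists>t\<in>T. l < \<bar>X (fst t) \<omega> - X (snd t) \<omega>\<bar>}
    = measure Q {\<omega> \<in> space Q. \<exists>t\<in>T. l < \<bar>Y (fst t) \<omega> - Y (snd t) \<omega>\<bar>}"
proof -
  define J where "J = fst ` T \<union> snd ` T"
  define S :: "('t \<Rightarrow> real) set" where "S = {z. \<exists>t\<in>T. l < \<bar>z (fst t) - z (snd t)\<bar>}"
  have J: "finite J" using T by (simp add: J_def)
  have "S \<inter> space (Pi\<^sub>M J (\<lambda>_. borel :: real measure)) \<in> sets (Pi\<^sub>M J (\<lambda>_. borel))"
  proof -
    have "{z \<in> space (Pi\<^sub>M J (\<lambda>_. borel)). \<exists>t\<in>T. l < \<bar>z (fst t) - z (snd t) :: real\<bar>} \<in> sets (Pi\<^sub>M J (\<lambda>_. borel))"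
    proof (rule sets.sets_Collect_finite_Ex[OF _ T])
      fix t assume "t \<in> T"
      then have [measurable]: "(\<lambda>z. z (fst t)) \<in> borel_measurable (Pi\<^sub>M J (\<lambda>_. borel :: real measure))"
        "(\<lambda>z. z (snd t)) \<in> borel_measurable (Pi\<^sub>M J (\<lambda>_. borel :: real measure))"
        by (auto simp: J_def intro!: measurable_component_singleton)
      show "{z \<in> space (Pi\<^sub>M J (\<lambda>_. borel)). l < \<bar>z (fst t) - z (snd t) :: real\<bar>} \<in> sets (Pi\<^sub>M J (\<lambda>_. borel))"
        by measurable
    qed
    also have "{z \<in> space (Pi\<^sub>M J (\<lambda>_. borel)). \<exists>t\<in>T. l < \<bar>z (fst t) - z (snd t) :: real\<bar>}
        = S \<inter> space (Pi\<^sub>M J (\<lambda>_. borel :: real measure))" by (auto simp: S_def)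
    finally show ?thesis .
  qed
  then have "(indicator S :: ('t \<Rightarrow> real) \<Rightarrow> real) \<in> borel_measurable (Pi\<^sub>M J (\<lambda>_. borel))"
    by (simp add: borel_measurable_indicator_iff)
  from eq_fdd_integral[OF eq X Y J this] show ?thesis
    unfolding S_def by (simp add: increment_event_eq_integral[OF T, of J] J_def)
qed

text \<open>
  Stationarity removes the shift \<open>u\<close>, self-similarity turns the scale \<open>c\<close> into the factor \<open>c\<^sup>H\<close>,
  and the integral representation passes from \<open>X\<close> to \<open>I\<close>.
\<close>

lemma scaled_shifted_increment_prob:
  fixes X :: "'t::real_vector \<Rightarrow> 'w \<Rightarrow> real" and I :: "'t \<Rightarrow> 'p \<Rightarrow> real"
  assumes X: "random_field P X" and I: "random_field Q I"
    and ss: "self_similar H P X" and si: "stationary_increments P X" and eq: "eq_fdd P X Q I"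
    and T: "finite T" and c: "0 < c"
  shows "measure P {\<omega> \<in> space P. \<exists>t\<in>T. c powr H * y < \<bar>X (c *\<^sub>R fst t + u) \<omega> - X (c *\<^sub>R snd t + u) \<omega>\<bar>}
    = measure Q {\<omega> \<in> space Q. \<exists>t\<in>T. y < \<bar>I (fst t) \<omega> - I (snd t) \<omega>\<bar>}"
proof -
  have Xm: "X t \<in> borel_measurable P" for t using X by (simp add: random_field_def)
  define T' where "T' = (\<lambda>t. (c *\<^sub>R fst t, c *\<^sub>R snd t)) ` T"
  have T': "finite T'" using T by (simp add: T'_def)
  have "measure P {\<omega> \<in> space P. \<exists>t\<in>T'. c powr H * y < \<bar>(X (fst t + u) \<omega> - X u \<omega>) - (X (snd t + u) \<omega> - X u \<omega>)\<bar>}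
      = measure P {\<omega> \<in> space P. \<exists>t\<in>T'. c powr H * y < \<bar>(X (fst t) \<omega> - X 0 \<omega>) - (X (snd t) \<omega> - X 0 \<omega>)\<bar>}"
  proof (rule eq_fdd_increment_prob[OF _ _ _ T'])
    show "eq_fdd P (\<lambda>t \<omega>. X (t + u) \<omega> - X u \<omega>) P (\<lambda>t \<omega>. X t \<omega> - X 0 \<omega>)"
      using si by (simp add: stationary_increments_def)
    show "random_field P (\<lambda>t \<omega>. X (t + u) \<omega> - X u \<omega>)" "random_field P (\<lambda>t \<omega>. X t \<omega> - X 0 \<omega>)"
      unfolding random_field_def by (intro allI Xm borel_measurable_diff)+
  qed
  moreover have "measure P {\<omega> \<in> space P. \<exists>t\<in>T. c powr H * y < \<bar>X (c *\<^sub>R fst t) \<omega> - X (c *\<^sub>R snd t) \<omega>\<bar>}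
      = measure P {\<omega> \<in> space P. \<exists>t\<in>T. c powr H * y < \<bar>c powr H * X (fst t) \<omega> - c powr H * X (snd t) \<omega>\<bar>}"
  proof (rule eq_fdd_increment_prob[OF _ _ _ T])
    show "eq_fdd P (\<lambda>t. X (c *\<^sub>R t)) P (\<lambda>t \<omega>. c powr H * X t \<omega>)"
      using ss c by (simp add: self_similar_def)
    show "random_field P (\<lambda>t. X (c *\<^sub>R t))" "random_field P (\<lambda>t \<omega>. c powr H * X t \<omega>)"
      unfolding random_field_def by (intro allI Xm borel_measurable_times borel_measurable_const)+
  qed
  moreover have "measure P {\<omega> \<in> space P. \<exists>t\<in>T. y < \<bar>X (fst t) \<omega> - X (snd t) \<omega>\<bar>}
      = measure Q {\<omega> \<in> space Q. \<exists>t\<in>T. y < \<bar>I (fst t) \<omega> - I (snd t) \<omega>\<bar>}"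
    by (rule eq_fdd_increment_prob[OF eq X I T])
  moreover have "c powr H * y < \<bar>c powr H * a - c powr H * b\<bar> \<longleftrightarrow> y < \<bar>a - b\<bar>" for a b
    using c by (simp add: abs_mult flip: right_diff_distrib)
  ultimately show ?thesis by (simp add: T'_def)
qed

lemma stationary_increments_expectation:
  fixes X :: "'t::real_vector \<Rightarrow> 'w \<Rightarrow> real"
  assumes "random_field P X" "stationary_increments P X"
  shows "(LINT \<omega>|P. min 1 \<bar>X (p + u) \<omega> - X (q + u) \<omega>\<bar>) = (LINT \<omega>|P. min 1 \<bar>X p \<omega> - X q \<omega>\<bar>)"
proof -
  have X: "X t \<in> borel_measurable P" for t using assms(1) by (simp add: random_field_def)
  have "eq_fdd P (\<lambda>t \<omega>. X (t + u) \<omega> - X u \<omega>) P (\<lambda>t \<omega>. X t \<omega> - X 0 \<omega>)"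
    using assms(2) by (simp add: stationary_increments_def)
  moreover have "random_field P (\<lambda>t \<omega>. X (t + u) \<omega> - X u \<omega>)" "random_field P (\<lambda>t \<omega>. X t \<omega> - X 0 \<omega>)"
    unfolding random_field_def by (intro allI X borel_measurable_diff)+
  ultimately have "(LINT \<omega>|P. min 1 \<bar>(X (p + u) \<omega> - X u \<omega>) - (X (q + u) \<omega> - X u \<omega>)\<bar>)
      = (LINT \<omega>|P. min 1 \<bar>(X p \<omega> - X 0 \<omega>) - (X q \<omega> - X 0 \<omega>)\<bar>)"
    by (rule eq_fdd_increment_expectation)
  then show ?thesis by simp
qed

lemma self_similar_expectation:
  fixes X :: "'t::real_vector \<Rightarrow> 'w \<Rightarrow> real"
  assumes "random_field P X" "self_similar H P X" "0 < c"
  shows "(LINT \<omega>|P. min 1 \<bar>X (c *\<^sub>R p) \<omega> - X (c *\<^sub>R q) \<omega>\<bar>) = (LINT \<omega>|P. min 1 (c powr H * \<bar>X p \<omega> - X q \<omega>\<bar>))"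
proof -
  have X: "X t \<in> borel_measurable P" for t using assms(1) by (simp add: random_field_def)
  have "eq_fdd P (\<lambda>t. X (c *\<^sub>R t)) P (\<lambda>t \<omega>. c powr H * X t \<omega>)"
    using assms(2,3) by (simp add: self_similar_def)
  moreover have "random_field P (\<lambda>t. X (c *\<^sub>R t))" "random_field P (\<lambda>t \<omega>. c powr H * X t \<omega>)"
    unfolding random_field_def by (intro allI X borel_measurable_times borel_measurable_const)+
  ultimately have "(LINT \<omega>|P. min 1 \<bar>X (c *\<^sub>R p) \<omega> - X (c *\<^sub>R q) \<omega>\<bar>)
      = (LINT \<omega>|P. min 1 \<bar>c powr H * X p \<omega> - c powr H * X q \<omega>\<bar>)"
    by (rule eq_fdd_increment_expectation)
  then show ?thesis by (simp add: abs_mult flip: right_diff_distrib)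
qed

section \<open>Stochastic continuity\<close>

text \<open>
  Convergence in probability is measured by \<open>D h = E min 1 \<bar>X h - X 0\<bar>\<close>. Stationarity of the
  increments makes \<open>D\<close> subadditive, so it suffices to treat multiples of the coordinate vectors.
  Along one axis self-similarity reduces \<open>X (c e) - X 0\<close> to \<open>\<bar>c\<bar>\<^sup>H (X (\<plusminus>e) - X 0)\<close>. A direct use of
  self-similarity at \<open>h = \<bar>h\<bar> (h / \<bar>h\<bar>)\<close> would need uniformity over the sphere.
\<close>

lemma (in prob_space) stochastic_continuity:
  fixes X :: "real ^ 'd \<Rightarrow> 'a \<Rightarrow> real"
  assumes X: "random_field M X" and ss: "self_similar H M X" and si: "stationary_increments M X"
    and H: "0 < H" and lim: "(\<lambda>k. s k) \<longlonglongrightarrow> t"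
  shows "(\<lambda>k. expectation (\<lambda>\<omega>. min 1 \<bar>X (s k) \<omega> - X t \<omega>\<bar>)) \<longlonglongrightarrow> 0"
proof -
  have [measurable]: "X t \<in> borel_measurable M" for t using X by (simp add: random_field_def)
  have int: "integrable M (\<lambda>\<omega>. min 1 \<bar>Z \<omega>\<bar>)" if "Z \<in> borel_measurable M" for Z :: "'a \<Rightarrow> real"
    by (rule integrable_const_bound[where B = 1]) (use that in auto)
  define D where "D h = expectation (\<lambda>\<omega>. min 1 \<bar>X h \<omega> - X 0 \<omega>\<bar>)" for h
  have D0: "D 0 = 0" by (simp add: D_def)
  have D_nonneg: "0 \<le> D h" for h unfolding D_def by (rule integral_nonneg_AE) auto
  have D_add: "D (h + h') \<le> D h + D h'" for h h'
  proof -
    have "D (h + h') \<le> expectation (\<lambda>\<omega>. min 1 \<bar>X (h + h') \<omega> - X (0 + h') \<omega>\<bar> + min 1 \<bar>X h' \<omega> - X 0 \<omega>\<bar>)"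
      unfolding D_def by (intro integral_mono Bochner_Integration.integrable_add int) auto
    also have "\<dots> = expectation (\<lambda>\<omega>. min 1 \<bar>X (h + h') \<omega> - X (0 + h') \<omega>\<bar>) + D h'"
      unfolding D_def by (intro Bochner_Integration.integral_add int) auto
    also have "expectation (\<lambda>\<omega>. min 1 \<bar>X (h + h') \<omega> - X (0 + h') \<omega>\<bar>) = D h"
      unfolding D_def by (rule stationary_increments_expectation[OF X si])
    finally show ?thesis .
  qed
  have D_sum: "D (\<Sum>i\<in>F. g i) \<le> (\<Sum>i\<in>F. D (g i))" if "finite F" for F :: "'d set" and g
    using that
  proof (induction F)
    case (insert i F)
    then show ?case using D_add[of "g i" "\<Sum>i\<in>F. g i"] by simp
  qed (simp add: D0)
  have D_axis: "(\<lambda>k. D (c k *\<^sub>R e)) \<longlonglongrightarrow> 0" if c: "c \<longlonglongrightarrow> 0" for c :: "nat \<Rightarrow> real" and e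
  proof -
    define W where "W \<omega> = \<bar>X e \<omega> - X 0 \<omega>\<bar> + \<bar>X (- e) \<omega> - X 0 \<omega>\<bar>" for \<omega>
    have [measurable]: "W \<in> borel_measurable M" unfolding W_def by measurable
    have W0: "0 \<le> W \<omega>" for \<omega> by (simp add: W_def)
    have le: "D (c *\<^sub>R e) \<le> expectation (\<lambda>\<omega>. min 1 (\<bar>c\<bar> powr H * W \<omega>))" for c
    proof -
      have *: "D (r *\<^sub>R v) \<le> expectation (\<lambda>\<omega>. min 1 (r powr H * W \<omega>))"
        if r: "0 < r" and v: "v = e \<or> v = - e" for r v
      proof -
        have "D (r *\<^sub>R v) = expectation (\<lambda>\<omega>. min 1 (r powr H * \<bar>X v \<omega> - X 0 \<omega>\<bar>))"
          using self_similar_expectation[OF X ss r, of v 0] by (simp add: D_def)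
        also have "\<dots> \<le> expectation (\<lambda>\<omega>. min 1 (r powr H * W \<omega>))"
        proof (rule integral_mono)
          show "integrable M (\<lambda>\<omega>. min 1 (r powr H * \<bar>X v \<omega> - X 0 \<omega>\<bar>))"
            by (rule integrable_const_bound[where B = 1]) auto
          show "integrable M (\<lambda>\<omega>. min 1 (r powr H * W \<omega>))"
            by (rule integrable_const_bound[where B = 1]) (auto simp: W0)
          fix \<omega>
          have "\<bar>X v \<omega> - X 0 \<omega>\<bar> \<le> W \<omega>" using v by (auto simp: W_def)
          then have "r powr H * \<bar>X v \<omega> - X 0 \<omega>\<bar> \<le> r powr H * W \<omega>" by (intro mult_left_mono) auto
          then show "min 1 (r powr H * \<bar>X v \<omega> - X 0 \<omega>\<bar>) \<le> min 1 (r powr H * W \<omega>)" by linarith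
        qed
        finally show ?thesis .
      qed
      consider "c = 0" | "0 < c" | "c < 0" by linarith
      then show ?thesis
      proof cases
        case 1
        then show ?thesis using H by (simp add: D0)
      next
        case 2
        then show ?thesis using *[of c e] by simp
      next
        case 3
        then show ?thesis using *[of "- c" "- e"] by simp
      qed
    qed
    have "(\<lambda>k. expectation (\<lambda>\<omega>. min 1 (\<bar>c k\<bar> powr H * W \<omega>))) \<longlonglongrightarrow> expectation (\<lambda>\<omega>. 0)"
    proof (rule integral_dominated_convergence[where w = "\<lambda>_. 1"])
      have "(\<lambda>k. \<bar>c k\<bar> powr H) \<longlonglongrightarrow> 0"
        using tendsto_powr'[OF tendsto_rabs[OF c] tendsto_const[of H]] H by simp
      then have "(\<lambda>k. min 1 (\<bar>c k\<bar> powr H * W \<omega>)) \<longlonglongrightarrow> min 1 (0 * W \<omega>)" for \<omega>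
        by (intro tendsto_intros)
      then show "AE \<omega> in M. (\<lambda>k. min 1 (\<bar>c k\<bar> powr H * W \<omega>)) \<longlonglongrightarrow> 0" by simp
    qed (auto simp: W0)
    then have lim0: "(\<lambda>k. expectation (\<lambda>\<omega>. min 1 (\<bar>c k\<bar> powr H * W \<omega>))) \<longlonglongrightarrow> 0" by simp
    show ?thesis
      by (rule tendsto_sandwich[OF _ _ tendsto_const lim0]) (use le D_nonneg in \<open>auto intro!: always_eventually\<close>)
  qed
  define h where "h k = s k - t" for k
  have "expectation (\<lambda>\<omega>. min 1 \<bar>X (s k) \<omega> - X t \<omega>\<bar>) = D (h k)" for k
    using stationary_increments_expectation[OF X si, of "h k" t 0] by (simp add: D_def h_def)
  moreover have "(\<lambda>k. D (h k)) \<longlonglongrightarrow> 0"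
  proof (rule tendsto_sandwich[OF _ _ tendsto_const])
    have "(\<lambda>k. \<Sum>i\<in>UNIV. D ((h k $ i) *\<^sub>R axis i 1)) \<longlonglongrightarrow> (\<Sum>i\<in>(UNIV :: 'd set). 0)"
    proof (intro tendsto_sum D_axis)
      fix i
      have "(\<lambda>k. s k $ i - t $ i) \<longlonglongrightarrow> t $ i - t $ i" by (intro tendsto_intros lim)
      then show "(\<lambda>k. h k $ i) \<longlonglongrightarrow> 0" by (simp add: h_def)
    qed
    then show "(\<lambda>k. \<Sum>i\<in>UNIV. D ((h k $ i) *\<^sub>R axis i 1)) \<longlonglongrightarrow> 0" by simp
    show "\<forall>\<^sub>F k in sequentially. D (h k) \<le> (\<Sum>i\<in>UNIV. D ((h k $ i) *\<^sub>R axis i 1))"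
    proof (rule always_eventually, rule allI)
      fix k
      have "h k = (\<Sum>i\<in>UNIV. (h k $ i) *\<^sub>R axis i 1)"
        using basis_expansion[of "h k"] by (simp add: scalar_mult_eq_scaleR)
      then show "D (h k) \<le> (\<Sum>i\<in>UNIV. D ((h k $ i) *\<^sub>R axis i 1))"
        using D_sum[OF finite_class.finite_UNIV, of "\<lambda>i. (h k $ i) *\<^sub>R axis i 1"] by simp
    qed
  qed (use D_nonneg in auto)
  ultimately show ?thesis by simp
qed

text \<open>
  Dominated convergence identifies the limit of \<open>E min 1 \<bar>Y\<^sub>k - Z\<bar>\<close> as \<open>E min 1 \<bar>Z' - Z\<bar>\<close>.
\<close>

lemma (in prob_space) AE_eq_of_AE_limit_of_prob_limit:
  fixes Y :: "nat \<Rightarrow> 'a \<Rightarrow> real"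
  assumes [measurable]: "\<And>k. Y k \<in> borel_measurable M" "Z \<in> borel_measurable M" "Z' \<in> borel_measurable M"
    and ae: "AE \<omega> in M. (\<lambda>k. Y k \<omega>) \<longlonglongrightarrow> Z' \<omega>"
    and pr: "(\<lambda>k. expectation (\<lambda>\<omega>. min 1 \<bar>Y k \<omega> - Z \<omega>\<bar>)) \<longlonglongrightarrow> 0"
  shows "AE \<omega> in M. Z' \<omega> = Z \<omega>"
proof -
  have "(\<lambda>k. expectation (\<lambda>\<omega>. min 1 \<bar>Y k \<omega> - Z \<omega>\<bar>)) \<longlonglongrightarrow> expectation (\<lambda>\<omega>. min 1 \<bar>Z' \<omega> - Z \<omega>\<bar>)"
  proof (rule integral_dominated_convergence[where w = "\<lambda>_. 1"])
    show "AE \<omega> in M. (\<lambda>k. min 1 \<bar>Y k \<omega> - Z \<omega>\<bar>) \<longlonglongrightarrow> min 1 \<bar>Z' \<omega> - Z \<omega>\<bar>"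
      using ae by eventually_elim (intro tendsto_intros)
  qed auto
  then have "expectation (\<lambda>\<omega>. min 1 \<bar>Z' \<omega> - Z \<omega>\<bar>) = 0"
    using pr by (rule LIMSEQ_unique)
  moreover have "integrable M (\<lambda>\<omega>. min 1 \<bar>Z' \<omega> - Z \<omega>\<bar>)"
    by (rule integrable_const_bound[where B = 1]) auto
  ultimately have "AE \<omega> in M. min 1 \<bar>Z' \<omega> - Z \<omega>\<bar> = 0"
    by (subst (asm) integral_nonneg_eq_0_iff_AE) auto
  then show ?thesis by eventually_elim (auto simp: min_def split: if_splits)
qed

section \<open>Dyadic chaining\<close>

definition dyadic_floor :: "nat \<Rightarrow> real ^ 'd \<Rightarrow> real ^ 'd" where
  "dyadic_floor k t = (\<chi> i. of_int \<lfloor>2 ^ k * t $ i\<rfloor> / 2 ^ k)"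

text \<open>
  A bound for the increments of \<open>x\<close> between neighbours, diagonal ones included, of the grid of
  mesh \<open>2\<^sup>-\<^sup>k\<close> in the cube \<open>[-L, L]\<^sup>d\<close>. Cubes of all sizes are needed, because separability compares
  the values of a field on open sets, which leave the unit cube.
\<close>

definition grid_bound :: "nat \<Rightarrow> nat \<Rightarrow> real \<Rightarrow> (real ^ 'd \<Rightarrow> real) \<Rightarrow> bool" where
  "grid_bound L k b x \<longleftrightarrow>
     (\<forall>p q. (\<forall>i. 2 ^ k * p $ i \<in> \<int> \<and> 2 ^ k * q $ i \<in> \<int> \<and> \<bar>p $ i\<bar> \<le> real L \<and> \<bar>q $ i\<bar> \<le> real L
        \<and> 2 ^ k * \<bar>p $ i - q $ i\<bar> \<le> 1) \<longrightarrow> \<bar>x p - x q\<bar> \<le> b)"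

lemma grid_boundD:
  assumes "grid_bound L k b x"
    and "\<And>i. 2 ^ k * p $ i \<in> \<int>" "\<And>i. 2 ^ k * q $ i \<in> \<int>"
    and "\<And>i. \<bar>p $ i\<bar> \<le> real L" "\<And>i. \<bar>q $ i\<bar> \<le> real L" "\<And>i. 2 ^ k * \<bar>p $ i - q $ i\<bar> \<le> 1"
  shows "\<bar>x p - x q\<bar> \<le> b"
  using assms unfolding grid_bound_def by blast

lemma dyadic_floor_in_box:
  assumes "\<bar>t $ i\<bar> \<le> real L"
  shows "\<bar>dyadic_floor k t $ i\<bar> \<le> real L"
proof -
  have "2 ^ k * t $ i \<le> 2 ^ k * real L" "2 ^ k * (- real L) \<le> 2 ^ k * t $ i"
    using assms by (intro mult_left_mono; simp add: abs_le_iff minus_le_iff)+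
  then have "real_of_int \<lfloor>2 ^ k * t $ i\<rfloor> \<le> 2 ^ k * real L" "- (2 ^ k * int L) \<le> \<lfloor>2 ^ k * t $ i\<rfloor>"
    by (linarith, simp add: le_floor_iff)
  then have "real_of_int \<lfloor>2 ^ k * t $ i\<rfloor> \<le> 2 ^ k * real L" "real_of_int (- (2 ^ k * int L)) \<le> real_of_int \<lfloor>2 ^ k * t $ i\<rfloor>"
    by (simp, simp only: of_int_le_iff)
  then show ?thesis
    by (simp add: dyadic_floor_def abs_le_iff divide_le_eq le_divide_eq mult.commute minus_divide_left)
qed

lemma dyadic_floor_grid: "2 ^ k * dyadic_floor k t $ i \<in> \<int>"
  by (simp add: dyadic_floor_def)

lemma dyadic_floor_Suc:
  "2 ^ Suc k * dyadic_floor k t $ i \<in> \<int>"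
  "2 ^ Suc k * \<bar>dyadic_floor (Suc k) t $ i - dyadic_floor k t $ i\<bar> \<le> 1"
proof -
  let ?a = "\<lfloor>2 ^ k * t $ i\<rfloor>" and ?b = "\<lfloor>2 ^ Suc k * t $ i\<rfloor>"
  have eq: "2 ^ Suc k * dyadic_floor k t $ i = of_int (2 * ?a)"
    by (simp add: dyadic_floor_def)
  then show "2 ^ Suc k * dyadic_floor k t $ i \<in> \<int>" by (metis Ints_of_int)
  have "?b - 2 * ?a = 0 \<or> ?b - 2 * ?a = 1"
  proof -
    have "2 ^ Suc k * t $ i = 2 * (2 ^ k * t $ i)" by simp
    then show ?thesis by linarith
  qed
  then have "\<bar>real_of_int (?b - 2 * ?a)\<bar> \<le> 1" by auto
  moreover have "2 ^ Suc k * (dyadic_floor (Suc k) t $ i - dyadic_floor k t $ i) = real_of_int (?b - 2 * ?a)"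
    unfolding right_diff_distrib eq by (simp add: dyadic_floor_def)
  then have "2 ^ Suc k * \<bar>dyadic_floor (Suc k) t $ i - dyadic_floor k t $ i\<bar> = \<bar>real_of_int (?b - 2 * ?a)\<bar>"
    by (metis abs_mult abs_of_pos zero_less_numeral zero_less_power)
  ultimately show "2 ^ Suc k * \<bar>dyadic_floor (Suc k) t $ i - dyadic_floor k t $ i\<bar> \<le> 1" by simp
qed

lemma dyadic_floor_near:
  assumes "2 ^ k * \<bar>s $ i - t $ i\<bar> \<le> 1"
  shows "2 ^ k * \<bar>dyadic_floor k s $ i - dyadic_floor k t $ i\<bar> \<le> 1"
proof -
  have "\<bar>2 ^ k * s $ i - 2 ^ k * t $ i\<bar> \<le> 1"
    using assms by (simp add: abs_mult flip: right_diff_distrib)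
  then have "\<bar>\<lfloor>2 ^ k * s $ i\<rfloor> - \<lfloor>2 ^ k * t $ i\<rfloor>\<bar> \<le> 1" by linarith
  then have "\<bar>real_of_int \<lfloor>2 ^ k * s $ i\<rfloor> - real_of_int \<lfloor>2 ^ k * t $ i\<rfloor>\<bar> \<le> 1" by linarith
  moreover have "2 ^ k * \<bar>dyadic_floor k s $ i - dyadic_floor k t $ i\<bar>
      = \<bar>2 ^ k * (dyadic_floor k s $ i - dyadic_floor k t $ i)\<bar>" by (simp add: abs_mult)
  ultimately show ?thesis by (simp add: dyadic_floor_def right_diff_distrib)
qed

lemma dyadic_floor_tendsto: "(\<lambda>k. dyadic_floor k t) \<longlonglongrightarrow> t"
proof (rule vec_tendstoI)
  fix i
  have "(\<lambda>k. dyadic_floor k t $ i - t $ i) \<longlonglongrightarrow> 0"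
  proof (rule Lim_null_comparison)
    show "\<forall>\<^sub>F k in sequentially. norm (dyadic_floor k t $ i - t $ i) \<le> (1 / 2) ^ k"
    proof (rule always_eventually, rule allI)
      fix k
      have "\<bar>real_of_int \<lfloor>2 ^ k * t $ i\<rfloor> - 2 ^ k * t $ i\<bar> \<le> 1" by linarith
      then have "\<bar>(real_of_int \<lfloor>2 ^ k * t $ i\<rfloor> - 2 ^ k * t $ i) / 2 ^ k\<bar> \<le> 1 / 2 ^ k"
        by (simp add: divide_right_mono)
      then show "norm (dyadic_floor k t $ i - t $ i) \<le> (1 / 2) ^ k"
        by (simp add: dyadic_floor_def diff_divide_distrib power_one_over)
    qed
    show "(\<lambda>k. (1 / 2 :: real) ^ k) \<longlonglongrightarrow> 0" by (rule LIMSEQ_realpow_zero) auto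
  qed
  then show "(\<lambda>k. dyadic_floor k t $ i) \<longlonglongrightarrow> t $ i" by (simp add: LIM_zero_iff)
qed

text \<open>
  Consecutive dyadic approximations \<open>dyadic_floor k t\<close> and \<open>dyadic_floor (k + 1) t\<close> are neighbours
  in the finer grid, so the increments along the approximating sequence are dominated by a
  geometric series.
\<close>

lemma dyadic_chaining:
  fixes x :: "real ^ 'd \<Rightarrow> real"
  assumes q: "0 < q" "q < 1" and m: "\<And>k. 0 \<le> m k" "\<And>k. k0 \<le> k \<Longrightarrow> m (Suc k) \<le> q * m k"
    and g: "\<And>k. k0 \<le> k \<Longrightarrow> grid_bound L k (m k) x" and t: "\<And>i. \<bar>t $ i\<bar> \<le> real L"
  shows "convergent (\<lambda>k. x (dyadic_floor k t))"
    and "k0 \<le> k \<Longrightarrow> \<bar>lim (\<lambda>k. x (dyadic_floor k t)) - x (dyadic_floor k t)\<bar> \<le> m k / (1 - q)"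
proof -
  define y where "y k = x (dyadic_floor k t)" for k
  have step: "\<bar>y (Suc k) - y k\<bar> \<le> m k" if k: "k0 \<le> k" for k
  proof -
    have "\<bar>y (Suc k) - y k\<bar> \<le> m (Suc k)"
      unfolding y_def
      by (rule grid_boundD[OF g[OF le_SucI[OF k]] dyadic_floor_grid dyadic_floor_Suc(1)
            dyadic_floor_in_box[OF t] dyadic_floor_in_box[OF t] dyadic_floor_Suc(2)])
    also have "\<dots> \<le> q * m k" by (rule m(2)[OF k])
    also have "\<dots> \<le> m k" using q m(1)[of k] by (simp add: mult_left_le_one_le)
    finally show ?thesis .
  qed
  have geo: "m (k + i) \<le> q ^ i * m k" if "k0 \<le> k" for k i
  proof (induction i)
    case (Suc i)
    have "m (k + Suc i) \<le> q * m (k + i)" using m(2)[of "k + i"] that by simp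
    also have "\<dots> \<le> q * (q ^ i * m k)" using Suc q by (intro mult_left_mono) auto
    finally show ?case by simp
  qed simp
  have tele: "\<bar>y (k + i) - y k\<bar> \<le> m k * ((1 - q ^ i) / (1 - q))" if k: "k0 \<le> k" for k i
  proof (induction i)
    case (Suc i)
    have "\<bar>y (k + Suc i) - y k\<bar> \<le> \<bar>y (Suc (k + i)) - y (k + i)\<bar> + \<bar>y (k + i) - y k\<bar>" by simp
    also have "\<dots> \<le> q ^ i * m k + m k * ((1 - q ^ i) / (1 - q))"
      using step[of "k + i"] geo[OF k, of i] Suc k by (intro add_mono) auto
    also have "\<dots> = m k * (q ^ i + (1 - q ^ i) / (1 - q))" by (simp add: algebra_simps)
    also have "q ^ i + (1 - q ^ i) / (1 - q) = (1 - q ^ Suc i) / (1 - q)"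
      using q by (simp add: field_simps)
    finally show ?case .
  qed simp
  have bound: "\<bar>y (k + i) - y k\<bar> \<le> m k / (1 - q)" if k: "k0 \<le> k" for k i
  proof -
    have "m k * ((1 - q ^ i) / (1 - q)) \<le> m k * (1 / (1 - q))"
      using q m(1)[of k] by (intro mult_left_mono divide_right_mono) auto
    then show ?thesis using tele[OF k, of i] by simp
  qed
  have m0: "(\<lambda>i. m (k0 + i) / (1 - q)) \<longlonglongrightarrow> 0"
  proof (rule Lim_null_comparison)
    show "\<forall>\<^sub>F i in sequentially. norm (m (k0 + i) / (1 - q)) \<le> q ^ i * (m k0 / (1 - q))"
      using geo[of k0] q m(1) by (intro always_eventually allI) (simp add: divide_right_mono)
    have "(\<lambda>i. q ^ i * (m k0 / (1 - q))) \<longlonglongrightarrow> 0 * (m k0 / (1 - q))"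
      using q by (intro tendsto_mult LIMSEQ_realpow_zero tendsto_const) auto
    then show "(\<lambda>i. q ^ i * (m k0 / (1 - q))) \<longlonglongrightarrow> 0" by simp
  qed
  have "Cauchy y"
  proof (rule metric_CauchyI)
    fix e :: real assume "0 < e"
    then have "\<forall>\<^sub>F i in sequentially. m (k0 + i) / (1 - q) < e / 2"
      using m0 by (intro order_tendstoD(2)) auto
    then obtain i where i: "m (k0 + i) / (1 - q) < e / 2" by (auto simp: eventually_sequentially)
    have near: "\<bar>y n - y (k0 + i)\<bar> < e / 2" if "k0 + i \<le> n" for n
    proof -
      have "\<bar>y n - y (k0 + i)\<bar> \<le> m (k0 + i) / (1 - q)"
        using bound[of "k0 + i" "n - (k0 + i)"] that by simp
      also note i
      finally show ?thesis .
    qed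
    show "\<exists>N. \<forall>a\<ge>N. \<forall>b\<ge>N. dist (y a) (y b) < e"
    proof (intro exI[of _ "k0 + i"] allI impI)
      fix a b assume "k0 + i \<le> a" "k0 + i \<le> b"
      then show "dist (y a) (y b) < e" using near[of a] near[of b] unfolding dist_real_def by linarith
    qed
  qed
  then have conv: "convergent y" by (simp add: Cauchy_convergent_iff)
  then show "convergent (\<lambda>k. x (dyadic_floor k t))" by (simp add: y_def[abs_def])
  assume k: "k0 \<le> k"
  have "y \<longlonglongrightarrow> lim y" using conv by (simp add: convergent_LIMSEQ_iff)
  then have "(\<lambda>i. \<bar>y (i + k) - y k\<bar>) \<longlonglongrightarrow> \<bar>lim y - y k\<bar>"
    by (intro tendsto_intros LIMSEQ_ignore_initial_segment)
  then have "\<bar>lim y - y k\<bar> \<le> m k / (1 - q)"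
    using bound[OF k] by (intro LIMSEQ_le_const2) (auto simp: add.commute)
  then show "\<bar>lim (\<lambda>k. x (dyadic_floor k t)) - x (dyadic_floor k t)\<bar> \<le> m k / (1 - q)"
    by (simp add: y_def[abs_def])
qed

text \<open>
  Points at maximum distance at most \<open>2\<^sup>-\<^sup>k\<close> have neighbouring approximations at level \<open>k\<close>; two
  tails of the chaining series and one increment at level \<open>k\<close> give the constant.
\<close>

lemma dyadic_limit_modulus:
  fixes x :: "real ^ 'd \<Rightarrow> real"
  assumes q: "0 < q" "q < 1" and m: "\<And>k. 0 \<le> m k" "\<And>k. k0 \<le> k \<Longrightarrow> m (Suc k) \<le> q * m k"
    and g: "\<And>k. k0 \<le> k \<Longrightarrow> grid_bound L k (m k) x"
    and st: "\<And>i. \<bar>s $ i\<bar> \<le> real L" "\<And>i. \<bar>t $ i\<bar> \<le> real L" "\<And>i. 2 ^ k * \<bar>s $ i - t $ i\<bar> \<le> 1"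
    and k: "k0 \<le> k"
  shows "\<bar>lim (\<lambda>k. x (dyadic_floor k s)) - lim (\<lambda>k. x (dyadic_floor k t))\<bar> \<le> 3 / (1 - q) * m k"
proof -
  have "\<bar>lim (\<lambda>k. x (dyadic_floor k s)) - x (dyadic_floor k s)\<bar> \<le> m k / (1 - q)"
    by (rule dyadic_chaining(2)[OF q m g st(1) k])
  moreover have "\<bar>lim (\<lambda>k. x (dyadic_floor k t)) - x (dyadic_floor k t)\<bar> \<le> m k / (1 - q)"
    by (rule dyadic_chaining(2)[OF q m g st(2) k])
  moreover have "\<bar>x (dyadic_floor k s) - x (dyadic_floor k t)\<bar> \<le> m k"
    by (rule grid_boundD[OF g[OF k] dyadic_floor_grid dyadic_floor_grid
          dyadic_floor_in_box[OF st(1)] dyadic_floor_in_box[OF st(2)] dyadic_floor_near[OF st(3)]])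
  moreover have "m k \<le> m k / (1 - q)" using q m(1)[of k] by (simp add: le_divide_eq mult_left_le)
  moreover have "3 / (1 - q) * m k = 3 * (m k / (1 - q))" by simp
  ultimately show ?thesis by (simp only: abs_le_iff) linarith
qed

text \<open>
  The polynomial factor does not spoil the geometric decay that the chaining argument needs.
\<close>

lemma geometric_decay:
  assumes "0 < \<rho>"
  shows "\<exists>q k0. 0 < q \<and> q < 1 \<and> (\<forall>k\<ge>k0. (2 powr (- \<rho>)) ^ Suc k * real (Suc k) powr b
    \<le> q * ((2 powr (- \<rho>)) ^ k * real k powr b))"
proof -
  define c where "c = 2 powr (- \<rho>)"
  have c: "0 < c" "c < 1" using assms powr_less_mono[of "- \<rho>" 0 2] by (auto simp: c_def)
  have "(\<lambda>k. c * (1 + 1 / real k) powr b) \<longlonglongrightarrow> c * (1 + 0) powr b"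
    by (intro tendsto_intros tendsto_powr lim_1_over_n) simp
  then have "\<forall>\<^sub>F k in sequentially. c * (1 + 1 / real k) powr b < (1 + c) / 2"
    using c by (intro order_tendstoD(2)) auto
  then have "\<forall>\<^sub>F k in sequentially. c ^ Suc k * real (Suc k) powr b \<le> (1 + c) / 2 * (c ^ k * real k powr b)"
    using eventually_gt_at_top[of 0]
  proof eventually_elim
    case (elim k)
    have "real (Suc k) = (1 + 1 / real k) * real k" using elim(2) by (simp add: field_simps)
    then have "real (Suc k) powr b = (1 + 1 / real k) powr b * real k powr b"
      by (simp add: powr_mult)
    then have "c ^ Suc k * real (Suc k) powr b = c * (1 + 1 / real k) powr b * (c ^ k * real k powr b)"
      by simp
    also have "\<dots> \<le> (1 + c) / 2 * (c ^ k * real k powr b)"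
      using elim(1) c by (intro mult_right_mono) auto
    finally show ?case .
  qed
  then obtain k0 where "\<forall>k\<ge>k0. c ^ Suc k * real (Suc k) powr b \<le> (1 + c) / 2 * (c ^ k * real k powr b)"
    by (auto simp: eventually_sequentially)
  moreover have "0 < (1 + c) / 2" "(1 + c) / 2 < 1" using c by auto
  ultimately show ?thesis unfolding c_def by blast
qed

lemma cube_modulus_nonneg:
  assumes "0 \<le> h"
  shows "0 \<le> cube_modulus x h"
proof -
  have "ereal \<bar>x 0 - x 0\<bar> \<le> cube_modulus x h"
    unfolding cube_modulus_def
  proof (rule SUP_upper2[of 0])
    show "(0 :: real ^ 'a) \<in> cbox 0 1" by (simp add: mem_box_cart)
    show "ereal \<bar>x 0 - x 0\<bar> \<le> (SUP s\<in>{s \<in> cbox 0 1. infnorm (s - 0) \<le> h}. ereal \<bar>x 0 - x s\<bar>)"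
      by (rule SUP_upper) (use assms in \<open>simp add: mem_box_cart infnorm_0\<close>)
  qed
  then show ?thesis by (simp add: zero_ereal_def)
qed

text \<open>
  For \<open>2\<^sup>-\<^sup>k\<^sup>-\<^sup>1 < h \<le> 2\<^sup>-\<^sup>k\<close> one has \<open>k \<le> ln (1 / h) / ln 2\<close>, so the assumed bound is of order
  \<open>h\<^sup>a (ln (1 / h))\<^sup>b\<^sup>'\<close>. The gap between the exponents \<open>b'\<close> and \<open>b\<close> sends the quotient to zero.
\<close>

lemma limsup_modulus_eq_0:
  fixes x :: "real ^ 'd \<Rightarrow> real"
  assumes a: "0 < a" and b: "0 \<le> b'" "b' < b" and C: "0 \<le> C"
    and x: "\<And>k s t. k0 \<le> k \<Longrightarrow> s \<in> cbox 0 1 \<Longrightarrow> t \<in> cbox 0 1 \<Longrightarrow> (\<And>i. 2 ^ k * \<bar>s $ i - t $ i\<bar> \<le> 1)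
      \<Longrightarrow> \<bar>x s - x t\<bar> \<le> C * ((2 powr (- a)) ^ k * real k powr b')"
  shows "limsup_modulus a b x = 0"
proof -
  define C' where "C' = C * 2 powr a * (1 / ln 2) powr b'"
  have "(1::real) \<le> 2 ^ Suc k0" by (rule one_le_power) simp
  then have pw: "1 / 2 ^ Suc k0 \<le> (1::real)" by (simp del: power_Suc)
  have cm: "cube_modulus x h \<le> ereal (C' * (h powr a * ln (1 / h) powr b'))"
    if h: "0 < h" "h < 1 / 2 ^ Suc k0" for h
  proof -
    have h1: "h < 1"
      using h(2) pw by linarith
    define y where "y = log 2 (1 / h)"
    have "2 powr real (Suc k0) < 1 / h"
      by (subst powr_realpow) (use h in \<open>simp_all add: field_simps\<close>)
    then have y: "real (Suc k0) < y"
      using h by (simp add: y_def less_log_iff del: of_nat_Suc)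
    define k where "k = nat \<lfloor>y\<rfloor>"
    have ky: "real k \<le> y" "y < real k + 1" and kk: "k0 \<le> k" using y by (auto simp: k_def) linarith+
    have hk: "2 ^ k * h \<le> 1" 
    proof -
      have "2 powr real k \<le> 1 / h" using ky(1) h by (simp add: y_def le_log_iff)
      then show ?thesis using h by (simp add: powr_realpow field_simps)
    qed
    have hk2: "1 < 2 * (2 ^ k * h)"
    proof -
      have "1 / h < 2 powr (real k + 1)" using ky(2) h by (simp add: y_def log_less_iff)
      then show ?thesis using h by (simp add: powr_add powr_realpow field_simps)
    qed
    have "(2 powr (- a)) ^ k \<le> 2 powr a * h powr a"
    proof -
      have "(2 powr (- a)) ^ k = (1 / 2 ^ k) powr a"
        by (simp add: powr_realpow[symmetric] powr_powr powr_divide powr_minus_divide mult.commute)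
      also have "\<dots> \<le> (2 * h) powr a"
        using hk2 a h by (intro powr_mono2) (auto simp: field_simps)
      also have "\<dots> = 2 powr a * h powr a" using h by (simp add: powr_mult)
      finally show ?thesis .
    qed
    moreover have "real k powr b' \<le> (1 / ln 2) powr b' * ln (1 / h) powr b'"
    proof -
      have "real k powr b' \<le> (ln (1 / h) / ln 2) powr b'"
        using ky b by (intro powr_mono2) (auto simp: y_def log_def)
      also have "\<dots> = (1 / ln 2) powr b' * ln (1 / h) powr b'"
        using h h1 by (simp add: powr_divide)
      finally show ?thesis .
    qed
    ultimately have "C * ((2 powr (- a)) ^ k * real k powr b')
        \<le> C * ((2 powr a * h powr a) * ((1 / ln 2) powr b' * ln (1 / h) powr b'))"
      using C by (intro mult_left_mono mult_mono) auto
    then have le: "C * ((2 powr (- a)) ^ k * real k powr b') \<le> C' * (h powr a * ln (1 / h) powr b')"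
      by (simp add: C'_def mult_ac)
    show ?thesis
      unfolding cube_modulus_def
    proof (intro SUP_least)
      fix t s :: "real ^ 'd" assume t: "t \<in> cbox 0 1" and s: "s \<in> {s \<in> cbox 0 1. infnorm (s - t) \<le> h}"
      have "2 ^ k * \<bar>t $ i - s $ i\<bar> \<le> 1" for i
      proof -
        have "\<bar>(s - t) $ i\<bar> \<le> h" using component_le_infnorm_cart[of "s - t" i] s by simp
        then have "2 ^ k * \<bar>t $ i - s $ i\<bar> \<le> 2 ^ k * h" by (simp add: abs_minus_commute)
        then show ?thesis using hk by linarith
      qed
      then have "\<bar>x t - x s\<bar> \<le> C * ((2 powr (- a)) ^ k * real k powr b')"
        using x[OF kk t] s by auto
      then show "ereal \<bar>x t - x s\<bar> \<le> ereal (C' * (h powr a * ln (1 / h) powr b'))" using le by simp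
    qed
  qed
  have small: "\<forall>\<^sub>F h in at_right 0. 0 < h \<and> h < (1 / 2 ^ Suc k0 :: real)"
    unfolding eventually_at_right_field by (intro exI[of _ "1 / 2 ^ Suc k0"]) auto
  have ratio: "\<forall>\<^sub>F h in at_right 0. cube_modulus x h / ereal (h powr a * ln (1 / h) powr b)
      \<le> ereal (C' * ln (1 / h) powr (b' - b))"
    using small
  proof eventually_elim
    case (elim h)
    then have h: "0 < h" "h < 1 / 2 ^ Suc k0" by auto
    have h1: "h < 1"
      using h(2) pw by linarith
    have L: "0 < ln (1 / h)" using h h1 by simp
    have "cube_modulus x h / ereal (h powr a * ln (1 / h) powr b)
        \<le> ereal (C' * (h powr a * ln (1 / h) powr b')) / ereal (h powr a * ln (1 / h) powr b)"
      using h L by (intro ereal_divide_right_mono cm) auto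
    also have "\<dots> = ereal (C' * ln (1 / h) powr (b' - b))"
      using h L by (simp add: powr_diff field_simps)
    finally show ?case .
  qed
  have "filterlim (\<lambda>h :: real. ln (1 / h)) at_top (at_right 0)"
    using filterlim_compose[OF ln_at_top filterlim_inverse_at_top_right] by (simp add: inverse_eq_divide)
  then have "((\<lambda>h. C' * ln (1 / h) powr (b' - b)) \<longlongrightarrow> C' * 0) (at_right 0)"
    using b by (intro tendsto_intros tendsto_neg_powr) auto
  then have "((\<lambda>h. ereal (C' * ln (1 / h) powr (b' - b))) \<longlongrightarrow> ereal 0) (at_right 0)" by simp
  then have "Limsup (at_right 0) (\<lambda>h. ereal (C' * ln (1 / h) powr (b' - b))) = 0"
    by (subst lim_imp_Limsup) (auto simp: zero_ereal_def)
  moreover have "limsup_modulus a b x \<le> Limsup (at_right 0) (\<lambda>h. ereal (C' * ln (1 / h) powr (b' - b)))"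
    unfolding limsup_modulus_def by (rule Limsup_mono[OF ratio])
  moreover have "Limsup (at_right (0::real)) (\<lambda>h. 0 :: ereal) \<le> limsup_modulus a b x"
    unfolding limsup_modulus_def
  proof (rule Limsup_mono)
    show "\<forall>\<^sub>F h in at_right 0. 0 \<le> cube_modulus x h / ereal (h powr a * ln (1 / h) powr b)"
      using small
    proof eventually_elim
      case (elim h)
      then have h: "0 < h" "h < 1" and cm0: "0 \<le> cube_modulus x h"
        using pw by (linarith | intro cube_modulus_nonneg)+
      then have "0 < h powr a * ln (1 / h) powr b" by simp
      from ereal_divide_right_mono[OF cm0, of "ereal (h powr a * ln (1 / h) powr b)"] this
      show ?case by simp
    qed
  qed
  ultimately show ?thesis
    by (simp add: Limsup_const trivial_limit_at_right_real)
qed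

section \<open>Increments over lattice boxes\<close>

lemma lattice_box_subset:
  assumes "1 \<le> n"
  shows "(lattice_box n :: (real ^ 'd) set) \<subseteq> (\<lambda>g. \<chi> i. real (g i)) ` (UNIV \<rightarrow>\<^sub>E {..<n})"
proof
  fix t :: "real ^ 'd" assume "t \<in> lattice_box n"
  then have t: "t $ i \<in> \<int>" "0 \<le> t $ i" "t $ i \<le> real n - 1" for i
    by (auto simp: lattice_box_def less_eq_vec_def)
  have "t $ i = real (nat \<lfloor>t $ i\<rfloor>)" for i
    using t(1,2)[of i] by (simp add: of_int_floor)
  moreover have "nat \<lfloor>t $ i\<rfloor> < n" for i
    using t(2,3)[of i] assms by linarith
  ultimately show "t \<in> (\<lambda>g. \<chi> i. real (g i)) ` (UNIV \<rightarrow>\<^sub>E {..<n})"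
    by (intro image_eqI[of _ _ "\<lambda>i. nat \<lfloor>t $ i\<rfloor>"]) (auto simp: vec_eq_iff)
qed

lemma finite_lattice_box:
  assumes "1 \<le> n"
  shows "finite (lattice_box n :: (real ^ 'd) set)"
    and "card (lattice_box n :: (real ^ 'd) set) \<le> n ^ CARD('d)"
proof -
  have fin: "finite ((UNIV :: 'd set) \<rightarrow>\<^sub>E {..<n})" by (intro finite_PiE) auto
  then show "finite (lattice_box n :: (real ^ 'd) set)"
    by (rule finite_subset[OF lattice_box_subset[OF assms] finite_imageI])
  have "card (lattice_box n :: (real ^ 'd) set) \<le> card ((\<lambda>g. (\<chi> i. real (g i)) :: real ^ 'd) ` (UNIV \<rightarrow>\<^sub>E {..<n}))"
    by (intro card_mono finite_imageI fin lattice_box_subset assms)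
  also have "\<dots> \<le> card ((UNIV :: 'd set) \<rightarrow>\<^sub>E {..<n})" by (rule card_image_le[OF fin])
  also have "\<dots> = n ^ CARD('d)" by (subst card_PiE) auto
  finally show "card (lattice_box n :: (real ^ 'd) set) \<le> n ^ CARD('d)" .
qed

lemma zero_in_lattice_box:
  assumes "1 \<le> n"
  shows "0 \<in> lattice_box n"
  using assms by (auto simp: lattice_box_def less_eq_vec_def)

lemma finite_directions: "finite (directions :: (real ^ 'd) set)"
proof -
  have "directions \<subseteq> (\<lambda>g. (\<chi> i. g i) :: real ^ 'd) ` (UNIV \<rightarrow>\<^sub>E {-1, 0, 1})"
  proof
    fix v :: "real ^ 'd" assume "v \<in> directions"
    then show "v \<in> (\<lambda>g. (\<chi> i. g i) :: real ^ 'd) ` (UNIV \<rightarrow>\<^sub>E {-1, 0, 1})"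
      by (intro image_eqI[of _ _ "\<lambda>i. v $ i"]) (auto simp: directions_def vec_eq_iff)
  qed
  moreover have "finite ((UNIV :: 'd set) \<rightarrow>\<^sub>E {-1, 0, 1 :: real})" by (intro finite_PiE) auto
  ultimately show ?thesis by (rule finite_subset[OF _ finite_imageI])
qed

text \<open>
  The maximum over \<open>lattice_box 0\<close>, an empty set, is unspecified; hence \<open>n \<ge> 1\<close>.
\<close>

lemma kernel_max_norm_powr_eq_integral:
  fixes g :: "real ^ 'd \<Rightarrow> 'e \<Rightarrow> real"
  assumes "0 < \<alpha>" "1 \<le> n"
  shows "kernel_max_norm \<alpha> m g n powr \<alpha> = (LINT x|m. (MAX t\<in>lattice_box n. \<bar>g t x\<bar> powr \<alpha>))"
proof -
  have "0 \<le> (MAX t\<in>lattice_box n. \<bar>g t x\<bar> powr \<alpha>)" for x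
    using finite_lattice_box(1)[OF assms(2)] zero_in_lattice_box[OF assms(2)]
    by (intro Max_ge_iff[THEN iffD2]) auto
  then have "0 \<le> (LINT x|m. (MAX t\<in>lattice_box n. \<bar>g t x\<bar> powr \<alpha>))"
    by (intro integral_nonneg_AE) auto
  then show ?thesis using assms(1) by (simp add: kernel_max_norm_def powr_powr)
qed

lemma lattice_increments_tail:
  fixes X :: "real ^ 'd \<Rightarrow> 'w \<Rightarrow> real" and I :: "real ^ 'd \<Rightarrow> 'p \<Rightarrow> real"
  assumes X: "random_field P X" and ss: "self_similar H P X" and si: "stationary_increments P X"
    and M: "sas_random_measure \<alpha> Q m M" and \<alpha>: "0 < \<alpha>" "\<alpha> < 2"
    and int: "\<And>t. has_stable_integral \<alpha> Q m M (f t) (I t)" and eq: "eq_fdd P X Q I"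
    and n: "1 \<le> n" and c: "0 < c"
    and D: "24 * (LINT x|m. (MAX t\<in>lattice_box n. \<bar>incr_kernel f v t x\<bar> powr \<alpha>)) < D"
    and pos: "0 < s" "0 < R" "0 < l"
  shows "measure P {\<omega> \<in> space P. \<exists>p\<in>lattice_box n.
        c powr H * (3 * l) < \<bar>X (c *\<^sub>R (v + p) + u) \<omega> - X (c *\<^sub>R p + u) \<omega>\<bar>}
    \<le> D * R powr (- \<alpha>) + exp (2 * D * s * R powr (1 - \<alpha>) - l / R)
      + 2 * real n ^ CARD('d) * exp (D * s powr \<alpha> - s * l)"
proof -
  define T where "T = (\<lambda>p. (v + p, p)) ` (lattice_box n :: (real ^ 'd) set)"
  have T: "finite T" "T \<noteq> {}" using finite_lattice_box[OF n] zero_in_lattice_box[OF n] by (auto simp: T_def)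
  have "card T \<le> n ^ CARD('d)"
    using card_image_le[OF finite_lattice_box(1)[OF n]] finite_lattice_box(2)[OF n] unfolding T_def by (meson order.trans)
  then have card: "real (card T) \<le> real n ^ CARD('d)" by (simp flip: of_nat_power)
  have rI: "random_field Q I" using int by (simp add: random_field_def has_stable_integral_def)
  have img: "(\<lambda>t. \<bar>f (fst t) x - f (snd t) x\<bar> powr \<alpha>) ` T = (\<lambda>t. \<bar>incr_kernel f v t x\<bar> powr \<alpha>) ` lattice_box n" for x
    by (auto simp: T_def incr_kernel_def image_image)
  have "measure P {\<omega> \<in> space P. \<exists>t\<in>T. c powr H * (3 * l) < \<bar>X (c *\<^sub>R fst t + u) \<omega> - X (c *\<^sub>R snd t + u) \<omega>\<bar>}
      = measure Q {\<omega> \<in> space Q. \<exists>t\<in>T. 3 * l < \<bar>I (fst t) \<omega> - I (snd t) \<omega>\<bar>}"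
    by (rule scaled_shifted_increment_prob[OF X rI ss si eq T(1) c])
  also have "\<dots> \<le> D * R powr (- \<alpha>) + exp (2 * D * s * R powr (1 - \<alpha>) - l / R)
      + 2 * real (card T) * exp (D * s powr \<alpha> - s * l)"
    by (rule stable_integral_max_tail[OF M \<alpha> int T _ pos]) (use D img in simp)
  also have "\<dots> \<le> D * R powr (- \<alpha>) + exp (2 * D * s * R powr (1 - \<alpha>) - l / R)
      + 2 * real n ^ CARD('d) * exp (D * s powr \<alpha> - s * l)"
    using card by (intro add_left_mono mult_right_mono) auto
  finally show ?thesis by (simp add: T_def)
qed

text \<open>
  The map \<open>z \<mapsto> 2\<^sup>-\<^sup>k z - L \<one>\<close>, where \<open>\<one>\<close> is the vector of ones, carries the lattice box of side
  \<open>2 L 2\<^sup>k + 1\<close> onto the grid of mesh \<open>2\<^sup>-\<^sup>k\<close> in \<open>[-L, L]\<^sup>d\<close>.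
\<close>

lemma grid_boundI:
  fixes x :: "real ^ 'd \<Rightarrow> real"
  assumes b: "0 \<le> b"
    and x: "\<And>v p. v \<in> directions \<Longrightarrow> p \<in> lattice_box (2 * L * 2 ^ k + 1) \<Longrightarrow>
      \<bar>x ((1 / 2 ^ k) *\<^sub>R (v + p) - real L *\<^sub>R 1) - x ((1 / 2 ^ k) *\<^sub>R p - real L *\<^sub>R 1)\<bar> \<le> b"
  shows "grid_bound L k b x"
  unfolding grid_bound_def
proof (intro allI impI)
  fix p q :: "real ^ 'd"
  assume pq: "\<forall>i. 2 ^ k * p $ i \<in> \<int> \<and> 2 ^ k * q $ i \<in> \<int> \<and> \<bar>p $ i\<bar> \<le> real L \<and> \<bar>q $ i\<bar> \<le> real L
        \<and> 2 ^ k * \<bar>p $ i - q $ i\<bar> \<le> 1"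
  show "\<bar>x p - x q\<bar> \<le> b"
  proof (cases "p = q")
    case False
    define v where "v = 2 ^ k *\<^sub>R (p - q)"
    define z where "z = 2 ^ k *\<^sub>R (q + real L *\<^sub>R 1)"
    have "v $ i \<in> {-1, 0, 1}" for i
    proof -
      have "2 ^ k * p $ i - 2 ^ k * q $ i \<in> \<int>" using pq by (intro Ints_diff) auto
      then have "v $ i \<in> \<int>" by (simp add: v_def right_diff_distrib)
      then obtain j where j: "v $ i = of_int j" by (auto elim: Ints_cases)
      have "\<bar>v $ i\<bar> = 2 ^ k * \<bar>p $ i - q $ i\<bar>" by (simp add: v_def abs_mult)
      then have "\<bar>v $ i\<bar> \<le> 1" using pq by simp
      then have "\<bar>j\<bar> \<le> 1" using j by simp
      then have "j = -1 \<or> j = 0 \<or> j = 1" by linarith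
      then show ?thesis using j by auto
    qed
    then have v: "v \<in> directions" using False by (simp add: directions_def v_def)
    have z: "z \<in> lattice_box (2 * L * 2 ^ k + 1)"
    proof -
      have "z $ i \<in> \<int> \<and> 0 \<le> z $ i \<and> z $ i \<le> real (2 * L * 2 ^ k + 1) - 1" for i
      proof -
        have zi: "z $ i = 2 ^ k * q $ i + 2 ^ k * real L" by (simp add: z_def distrib_left)
        have "2 ^ k * real L \<in> \<int>" by (intro Ints_mult Ints_power) auto
        then have "z $ i \<in> \<int>" unfolding zi using pq by (intro Ints_add) auto
        moreover have "0 \<le> q $ i + real L" "q $ i + real L \<le> 2 * real L"
          using pq[rule_format, of i] by (auto simp: abs_le_iff)
        then have "2 ^ k * 0 \<le> 2 ^ k * (q $ i + real L)" "2 ^ k * (q $ i + real L) \<le> 2 ^ k * (2 * real L)"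
          by (intro mult_left_mono; simp)+
        ultimately show ?thesis by (simp add: zi distrib_left mult_ac)
      qed
      then show ?thesis by (simp add: lattice_box_def less_eq_vec_def)
    qed
    have "(1 / 2 ^ k) *\<^sub>R (v + z) - real L *\<^sub>R 1 = p" "(1 / 2 ^ k) *\<^sub>R z - real L *\<^sub>R 1 = q"
      by (simp_all add: v_def z_def vec_eq_iff distrib_left right_diff_distrib)
    then show ?thesis using x[OF v z] by simp
  qed (use b in simp)
qed

section \<open>Almost sure bounds at all dyadic levels\<close>

lemma eventually_powr_dominates:
  assumes "e1 < e2" "0 < e2"
  shows "\<forall>\<^sub>F k in sequentially. c * real k powr e1 - real k powr e2 \<le> - (2 * ln (real k))"
proof -
  have "(\<lambda>k. real k powr (e1 - e2)) \<longlonglongrightarrow> 0"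
    using assms by (intro tendsto_neg_powr filterlim_real_sequentially) auto
  then have "(\<lambda>k. c * real k powr (e1 - e2) + 2 * (ln (real k) / real k powr e2)) \<longlonglongrightarrow> c * 0 + 2 * 0"
    using assms by (intro tendsto_intros lim_ln_over_power) auto
  then have "\<forall>\<^sub>F k in sequentially. c * real k powr (e1 - e2) + 2 * (ln (real k) / real k powr e2) < 1"
    by (intro order_tendstoD(2)) auto
  then show ?thesis using eventually_gt_at_top[of 0]
  proof eventually_elim
    case (elim k)
    have pos: "0 < real k powr e2" using elim by simp
    have "(c * real k powr (e1 - e2) + 2 * (ln (real k) / real k powr e2)) * real k powr e2 \<le> 1 * real k powr e2"
      using elim pos by (intro mult_right_mono) auto
    moreover have "(c * real k powr (e1 - e2) + 2 * (ln (real k) / real k powr e2)) * real k powr e2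
        = c * real k powr e1 + 2 * ln (real k)"
      using pos elim by (simp add: powr_diff field_simps)
    ultimately show ?case by simp
  qed
qed

lemma summable_exp_of_log_bound:
  assumes "\<forall>\<^sub>F k in sequentially. g k \<le> - (2 * ln (real k))"
  shows "summable (\<lambda>k. exp (g k))"
proof (rule summable_comparison_test_ev)
  show "\<forall>\<^sub>F k in sequentially. norm (exp (g k)) \<le> real k powr (- 2)"
    using assms eventually_gt_at_top[of 0]
  proof eventually_elim
    case (elim k)
    then show ?case by (simp add: powr_def)
  qed
  show "summable (\<lambda>k. real k powr (- 2))" by (simp add: summable_real_powr_iff)
qed

text \<open>
  In units of the natural scale of level \<open>k\<close> the maximal inequality is used with \<open>l = k\<^sup>1\<^sup>/\<^sup>\<gamma>\<close>,
  \<open>s = A k\<^sup>1\<^sup>-\<^sup>1\<^sup>/\<^sup>\<gamma>\<close> and \<open>R = k\<^sup>1\<^sup>/\<^sup>\<gamma>\<^sup>'\<close>. Then \<open>s l = A k\<close> beats the number \<open>N 2\<^sup>k\<^sup>d\<close> of increments if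
  \<open>A > d ln 2\<close>, as \<open>s\<^sup>\<alpha>\<close> is of lower order because of \<open>\<alpha> (1 - 1 / \<gamma>) < \<alpha> - 1 < 1\<close>. The first term
  is summable if \<open>\<gamma>' < \<alpha>\<close>. In the second one \<open>l / R = k\<^sup>1\<^sup>/\<^sup>\<gamma>\<^sup>-\<^sup>1\<^sup>/\<^sup>\<gamma>\<^sup>'\<close> must dominate \<open>s R\<^sup>1\<^sup>-\<^sup>\<alpha>\<close>, that is,
  \<open>(2 - \<alpha>) / \<gamma>' + 1 < 2 / \<gamma>\<close>; for \<open>\<gamma>' = \<alpha>\<close> this reads \<open>\<gamma> < \<alpha>\<close>, so it holds for \<open>\<gamma>'\<close> close to \<open>\<alpha>\<close>.
\<close>

lemma summable_tail_bound:
  assumes \<alpha>: "0 < \<alpha>" "\<alpha> < 2" and \<gamma>: "0 < \<gamma>" "\<gamma> < \<alpha>" and c: "0 \<le> c" "0 \<le> N"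
  shows "\<exists>A \<gamma>'. 0 < A \<and> 0 < \<gamma>' \<and> summable (\<lambda>k. c * (real k powr (1 / \<gamma>')) powr (- \<alpha>)
    + exp (2 * c * (A * real k powr (1 - 1 / \<gamma>)) * (real k powr (1 / \<gamma>')) powr (1 - \<alpha>)
        - real k powr (1 / \<gamma>) / real k powr (1 / \<gamma>'))
    + 2 * (N * (2 ^ k) ^ d) * exp (c * (A * real k powr (1 - 1 / \<gamma>)) powr \<alpha>
        - A * real k powr (1 - 1 / \<gamma>) * real k powr (1 / \<gamma>)))"
proof -
  have "\<gamma> < 2" using \<alpha> \<gamma> by simp
  have "(2 - \<alpha>) * \<gamma> < \<alpha> * (2 - \<gamma>)" using \<gamma> by (simp add: algebra_simps)
  then have "(2 - \<alpha>) * \<gamma> / (2 - \<gamma>) < \<alpha>" using \<open>\<gamma> < 2\<close> by (simp add: divide_less_eq)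
  \<comment> \<open>the lower bound for \<open>\<gamma>'\<close> is the condition \<open>(2 - \<alpha>) / \<gamma>' + 1 < 2 / \<gamma>\<close> solved for \<open>\<gamma>'\<close>\<close>
  then obtain \<gamma>' where \<gamma>': "max \<gamma> ((2 - \<alpha>) * \<gamma> / (2 - \<gamma>)) < \<gamma>'" "\<gamma>' < \<alpha>"
    using \<gamma> dense[of "max \<gamma> ((2 - \<alpha>) * \<gamma> / (2 - \<gamma>))" \<alpha>] by auto
  then have g0: "0 < \<gamma>'" "\<gamma> < \<gamma>'" using \<gamma> by auto
  define e1 where "e1 = 1 - 1 / \<gamma> + (1 - \<alpha>) / \<gamma>'"
  define e2 where "e2 = 1 / \<gamma> - 1 / \<gamma>'"
  define e3 where "e3 = \<alpha> * (1 - 1 / \<gamma>)"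
  have e2: "0 < e2" using g0 \<gamma> by (simp add: e2_def frac_less2)
  have e12: "e1 < e2"
  proof -
    have "(2 - \<alpha>) * \<gamma> < \<gamma>' * (2 - \<gamma>)" using \<gamma>' \<open>\<gamma> < 2\<close> by (simp add: divide_less_eq)
    then have "(2 - \<alpha>) / \<gamma>' < (2 - \<gamma>) / \<gamma>" using \<gamma> g0 by (simp add: divide_less_eq field_simps)
    also have "(2 - \<gamma>) / \<gamma> = 2 / \<gamma> - 1" using \<gamma> by (simp add: field_simps)
    finally show ?thesis by (simp add: e1_def e2_def diff_divide_distrib)
  qed
  have e3: "e3 < 1"
  proof -
    have "1 < \<alpha> / \<gamma>" using \<gamma> by simp
    then show ?thesis using \<alpha> by (simp add: e3_def right_diff_distrib)
  qed
  define A where "A = real d * ln 2 + 1"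
  have A: "0 < A" by (simp add: A_def add_nonneg_pos)
  have s1: "summable (\<lambda>k. c * (real k powr (1 / \<gamma>')) powr (- \<alpha>))"
  proof -
    have "(real k powr (1 / \<gamma>')) powr (- \<alpha>) = real k powr (- (\<alpha> / \<gamma>'))" for k
      by (simp add: powr_powr)
    moreover have "- (\<alpha> / \<gamma>') < - 1" using \<gamma>' g0 by simp
    ultimately show ?thesis by (intro summable_mult) (simp add: summable_real_powr_iff)
  qed
  have s2: "summable (\<lambda>k. exp (2 * c * (A * real k powr (1 - 1 / \<gamma>)) * (real k powr (1 / \<gamma>')) powr (1 - \<alpha>)
        - real k powr (1 / \<gamma>) / real k powr (1 / \<gamma>')))"
  proof -
    have "2 * c * (A * real k powr (1 - 1 / \<gamma>)) * (real k powr (1 / \<gamma>')) powr (1 - \<alpha>)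
        - real k powr (1 / \<gamma>) / real k powr (1 / \<gamma>') = 2 * c * A * real k powr e1 - real k powr e2" for k
    proof -
      have "real k powr (1 - 1 / \<gamma>) * (real k powr (1 / \<gamma>')) powr (1 - \<alpha>) = real k powr e1"
        by (simp add: powr_powr e1_def flip: powr_add)
      moreover have "real k powr (1 / \<gamma>) / real k powr (1 / \<gamma>') = real k powr e2"
        by (simp add: e2_def powr_diff)
      ultimately show ?thesis by (simp add: mult.assoc)
    qed
    then show ?thesis
      using eventually_powr_dominates[OF e12 e2, of "2 * c * A"] by (intro summable_exp_of_log_bound) simp
  qed
  have s3: "summable (\<lambda>k. 2 * (N * (2 ^ k) ^ d) * exp (c * (A * real k powr (1 - 1 / \<gamma>)) powr \<alpha>
        - A * real k powr (1 - 1 / \<gamma>) * real k powr (1 / \<gamma>)))"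
  proof -
    have "2 * (N * (2 ^ k) ^ d) * exp (c * (A * real k powr (1 - 1 / \<gamma>)) powr \<alpha>
        - A * real k powr (1 - 1 / \<gamma>) * real k powr (1 / \<gamma>))
      = 2 * N * exp (c * A powr \<alpha> * real k powr e3 - real k powr 1)" for k
    proof -
      have "(A * real k powr (1 - 1 / \<gamma>)) powr \<alpha> = A powr \<alpha> * real k powr e3"
        by (simp add: powr_mult powr_powr e3_def mult.commute)
      moreover have "A * real k powr (1 - 1 / \<gamma>) * real k powr (1 / \<gamma>) = real d * ln 2 * real k + real k powr 1"
        by (simp add: A_def distrib_right mult.assoc flip: powr_add)
      moreover have "((2::real) ^ k) ^ d = exp (real d * ln 2 * real k)"
      proof -
        have "((2::real) ^ k) ^ d = 2 powr (real d * real k)"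
          by (simp add: powr_realpow power_mult[symmetric] mult.commute flip: of_nat_mult)
        then show ?thesis by (simp add: powr_def mult_ac)
      qed
      ultimately show ?thesis by (simp add: exp_diff exp_add mult_ac)
    qed
    then show ?thesis
      using eventually_powr_dominates[OF e3, of "c * A powr \<alpha>"]
      by (simp only:) (intro summable_mult summable_exp_of_log_bound, simp)
  qed
  show ?thesis
    by (intro exI[of _ A] exI[of _ \<gamma>'] conjI A g0(1) summable_add s1 s2 s3)
qed

text \<open>
  Borel--Cantelli for each of the finitely many directions. The box at level \<open>k\<close> has side of order
  \<open>2\<^sup>k\<close>, so the kernel maximum has norm of order \<open>B = 2\<^sup>k\<^sup>\<theta>\<^sup>/\<^sup>\<alpha>\<close>, and rescaling the thresholds by \<open>B\<close>
  makes the tail bound independent of \<open>B\<close>.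
\<close>

lemma grid_bound_AE:
  fixes X :: "real ^ 'd \<Rightarrow> 'w \<Rightarrow> real" and I :: "real ^ 'd \<Rightarrow> 'p \<Rightarrow> real"
  assumes P: "prob_space P"
    and X: "random_field P X" and ss: "self_similar H P X" and si: "stationary_increments P X"
    and M: "sas_random_measure \<alpha> Q m M" and \<alpha>: "0 < \<alpha>" "\<alpha> < 2"
    and int: "\<And>t. has_stable_integral \<alpha> Q m M (f t) (I t)" and eq: "eq_fdd P X Q I"
    and \<theta>: "0 < \<theta>"
    and ker: "\<And>v. v \<in> directions \<Longrightarrow> \<exists>K>0. \<forall>\<^sub>F n in sequentially.
        (LINT x|m. (MAX t\<in>lattice_box n. \<bar>incr_kernel f v t x\<bar> powr \<alpha>)) \<le> K * real n powr \<theta>"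
    and \<gamma>: "0 < \<gamma>" "\<gamma> < \<alpha>" and L: "1 \<le> L"
  shows "AE \<omega> in P. \<forall>\<^sub>F k in sequentially.
    grid_bound L k (3 * ((2 powr (- (H - \<theta> / \<alpha>))) ^ k * real k powr (1 / \<gamma>))) (\<lambda>t. X t \<omega>)"
proof -
  interpret P: prob_space P by fact
  have [measurable]: "X t \<in> borel_measurable P" for t using X by (simp add: random_field_def)
  define n where "n k = 2 * L * 2 ^ k + 1" for k
  define b where "b k = 3 * ((2 powr (- (H - \<theta> / \<alpha>))) ^ k * real k powr (1 / \<gamma>))" for k
  define u :: "real ^ 'd" where "u = - (real L *\<^sub>R 1)"
  define E where "E v k = {\<omega> \<in> space P. \<exists>p\<in>lattice_box (n k). b k < \<bar>X ((1 / 2 ^ k) *\<^sub>R (v + p) + u) \<omega> - X ((1 / 2 ^ k) *\<^sub>R p + u) \<omega>\<bar>}" for v k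
  have n1: "1 \<le> n k" for k by (simp add: n_def)
  have nle: "real (n k) \<le> (2 * real L + 1) * 2 ^ k" for k
    by (simp add: n_def distrib_right)
  have Em: "E v k \<in> sets P" for v k
    unfolding E_def by (intro sets.sets_Collect_finite_Ex finite_lattice_box(1)[OF n1]) measurable
  have ae: "AE \<omega> in P. \<forall>\<^sub>F k in sequentially. \<omega> \<in> space P - E v k" if v: "v \<in> directions" for v
  proof -
    obtain K where K: "0 < K" and Kb: "\<forall>\<^sub>F n in sequentially.
        (LINT x|m. (MAX t\<in>lattice_box n. \<bar>incr_kernel f v t x\<bar> powr \<alpha>)) \<le> K * real n powr \<theta>"
      using ker[OF v] by blast
    define c where "c = 25 * K * (2 * real L + 1) powr \<theta>"
    define N where "N = (2 * real L + 1) ^ CARD('d)"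
    have c: "0 < c" using K by (simp add: c_def)
    obtain A \<gamma>' where A: "0 < A" "0 < \<gamma>'" and
      sm: "summable (\<lambda>k. c * (real k powr (1 / \<gamma>')) powr (- \<alpha>)
        + exp (2 * c * (A * real k powr (1 - 1 / \<gamma>)) * (real k powr (1 / \<gamma>')) powr (1 - \<alpha>)
            - real k powr (1 / \<gamma>) / real k powr (1 / \<gamma>'))
        + 2 * (N * (2 ^ k) ^ CARD('d)) * exp (c * (A * real k powr (1 - 1 / \<gamma>)) powr \<alpha>
            - A * real k powr (1 - 1 / \<gamma>) * real k powr (1 / \<gamma>)))"
      using summable_tail_bound[OF \<alpha> \<gamma>, of c N "CARD('d)"] c by (auto simp: N_def)
    have "filterlim n at_top sequentially"
    proof (rule filterlim_at_top_mono)
      show "filterlim (\<lambda>k. k :: nat) at_top sequentially" by (rule filterlim_ident)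
      show "\<forall>\<^sub>F k in sequentially. k \<le> n k" 
      proof (rule always_eventually, rule allI)
        fix k :: nat
        have "k \<le> 2 ^ k" using less_exp[of k] by simp
        also have "\<dots> \<le> 2 * L * 2 ^ k" using L by simp
        finally show "k \<le> n k" by (simp add: n_def)
      qed
    qed
    then have ev: "\<forall>\<^sub>F k in sequentially.
        (LINT x|m. (MAX t\<in>lattice_box (n k). \<bar>incr_kernel f v t x\<bar> powr \<alpha>)) \<le> K * real (n k) powr \<theta>"
      using Kb by (rule eventually_compose_filterlim[rotated])
    have "\<forall>\<^sub>F k in sequentially. norm (P.prob (E v k)) \<le> c * (real k powr (1 / \<gamma>')) powr (- \<alpha>)
        + exp (2 * c * (A * real k powr (1 - 1 / \<gamma>)) * (real k powr (1 / \<gamma>')) powr (1 - \<alpha>)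
            - real k powr (1 / \<gamma>) / real k powr (1 / \<gamma>'))
        + 2 * (N * (2 ^ k) ^ CARD('d)) * exp (c * (A * real k powr (1 - 1 / \<gamma>)) powr \<alpha>
            - A * real k powr (1 - 1 / \<gamma>) * real k powr (1 / \<gamma>))"
      using ev eventually_gt_at_top[of 0]
    proof eventually_elim
      case (elim k)
      \<comment> \<open>the order of the \<open>L\<^sup>\<alpha>\<close>-norm of the kernel maximum over a box of side \<open>2\<^sup>k\<close>\<close>
      define B where "B = (2 ^ k) powr (\<theta> / \<alpha>)"
      have B: "0 < B" by (simp add: B_def)
      have B\<alpha>: "B powr \<alpha> = (2 ^ k) powr \<theta>" using \<alpha> by (simp add: B_def powr_powr)
      define R where "R = real k powr (1 / \<gamma>')"
      define s where "s = A * real k powr (1 - 1 / \<gamma>)"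
      define l where "l = real k powr (1 / \<gamma>)"
      have pos: "0 < R" "0 < s" "0 < l" using A elim(2) by (auto simp: R_def s_def l_def)
      define D where "D = c * B powr \<alpha>"
      \<comment> \<open>any constant above 24 yields the strict inequality required of \<open>D\<close>\<close>
      have "24 * (K * real (n k) powr \<theta>) < 25 * K * real (n k) powr \<theta>"
        using K n1[of k] by simp
      also have "\<dots> \<le> 25 * K * ((2 * real L + 1) * 2 ^ k) powr \<theta>"
        using K nle[of k] \<theta> by (intro mult_left_mono powr_mono2) auto
      also have "\<dots> = D" by (simp add: D_def c_def B\<alpha> powr_mult)
      finally have D: "24 * (LINT x|m. (MAX t\<in>lattice_box (n k). \<bar>incr_kernel f v t x\<bar> powr \<alpha>)) < D"
        using elim(1) by linarith
      have bk: "(1 / 2 ^ k) powr H * (3 * (B * l)) = b k"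
      proof -
        have "(1 / 2 ^ k) powr H * B = 2 powr (- (real k * H)) * 2 powr (real k * (\<theta> / \<alpha>))"
          by (simp add: B_def powr_divide powr_minus_divide powr_powr flip: powr_realpow)
        also have "\<dots> = (2 powr (- (H - \<theta> / \<alpha>))) ^ k"
          by (simp add: powr_powr algebra_simps flip: powr_add powr_realpow)
        finally show ?thesis by (simp add: b_def l_def mult_ac)
      qed
      have "P.prob (E v k) \<le> D * (B * R) powr (- \<alpha>) + exp (2 * D * (s / B) * (B * R) powr (1 - \<alpha>) - (B * l) / (B * R))
          + 2 * real (n k) ^ CARD('d) * exp (D * (s / B) powr \<alpha> - (s / B) * (B * l))"
        unfolding E_def bk[symmetric]
        by (rule lattice_increments_tail[OF X ss si M \<alpha> int eq n1 _ D]) (use pos B in auto)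
      also have "D * (B * R) powr (- \<alpha>) = c * R powr (- \<alpha>)"
        using B by (simp add: D_def powr_mult powr_minus field_simps)
      also have "2 * D * (s / B) * (B * R) powr (1 - \<alpha>) = 2 * c * s * R powr (1 - \<alpha>)"
        using B pos by (simp add: D_def powr_mult powr_diff field_simps)
      also have "(B * l) / (B * R) = l / R" using B by simp
      also have "D * (s / B) powr \<alpha> = c * s powr \<alpha>"
        using B pos by (simp add: D_def powr_divide)
      also have "(s / B) * (B * l) = s * l" using B by simp
      also have "2 * real (n k) ^ CARD('d) * exp (c * s powr \<alpha> - s * l)
          \<le> 2 * (N * (2 ^ k) ^ CARD('d)) * exp (c * s powr \<alpha> - s * l)"
      proof -
        have "real (n k) ^ CARD('d) \<le> ((2 * real L + 1) * 2 ^ k) ^ CARD('d)"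
          using nle by (intro power_mono) auto
        then show ?thesis by (simp add: N_def power_mult_distrib)
      qed
      finally show ?case by (simp add: R_def s_def l_def)
    qed
    then have "summable (\<lambda>k. P.prob (E v k))"
      by (rule summable_comparison_test_ev[OF _ sm])
    then show ?thesis
      using Em by (intro borel_cantelli_AE1) (auto simp: P.emeasure_eq_measure)
  qed
  have "AE \<omega> in P. \<forall>v\<in>directions. \<forall>\<^sub>F k in sequentially. \<omega> \<in> space P - E v k"
    by (rule AE_finite_allI[OF finite_directions ae])
  then show ?thesis
  proof eventually_elim
    case (elim \<omega>)
    then have "\<forall>\<^sub>F k in sequentially. \<forall>v\<in>directions. \<omega> \<in> space P - E v k"
      by (intro eventually_ball_finite finite_directions)
    then show ?case
    proof eventually_elim
      case (elim k)
      show ?case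
      proof (rule grid_boundI)
        show "0 \<le> 3 * ((2 powr (- (H - \<theta> / \<alpha>))) ^ k * real k powr (1 / \<gamma>))" by simp
        fix v p :: "real ^ 'd" assume "v \<in> directions" "p \<in> lattice_box (2 * L * 2 ^ k + 1)"
        then show "\<bar>X ((1 / 2 ^ k) *\<^sub>R (v + p) - real L *\<^sub>R 1) \<omega> - X ((1 / 2 ^ k) *\<^sub>R p - real L *\<^sub>R 1) \<omega>\<bar>
            \<le> 3 * ((2 powr (- (H - \<theta> / \<alpha>))) ^ k * real k powr (1 / \<gamma>))"
          using elim by (auto simp: E_def n_def u_def b_def not_less)
      qed
    qed
  qed
qed

section \<open>Continuous modifications and separability\<close>

text \<open>
  The modification is the limit of \<open>X\<close> along dyadic approximations of the argument. It is
  measurable for every \<open>t\<close>, because \<open>lim\<close> is total and preserves measurability, and its continuity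
  comes from the chaining bounds on the cubes \<open>[-L, L]\<^sup>d\<close> for all \<open>L\<close>.
\<close>

lemma continuous_modification_with_modulus:
  fixes X :: "real ^ 'd \<Rightarrow> 'w \<Rightarrow> real"
  assumes P: "prob_space P"
    and X: "random_field P X" and ss: "self_similar H P X" and si: "stationary_increments P X"
    and H: "0 < H" and \<rho>: "0 < \<rho>" and b: "0 \<le> b'" "b' < b"
    and grid: "\<And>L. 1 \<le> L \<Longrightarrow> AE \<omega> in P. \<forall>\<^sub>F k in sequentially.
      grid_bound L k (3 * ((2 powr (- \<rho>)) ^ k * real k powr b')) (\<lambda>t. X t \<omega>)"
  shows "\<exists>X'. modification P X X' \<and> (AE \<omega> in P. continuous_on UNIV (\<lambda>t. X' t \<omega>)
    \<and> limsup_modulus \<rho> b (\<lambda>t. X' t \<omega>) = 0)"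
proof -
  interpret P: prob_space P by fact
  have Xm[measurable]: "X t \<in> borel_measurable P" for t using X by (simp add: random_field_def)
  define m where "m k = 3 * ((2 powr (- \<rho>)) ^ k * real k powr b')" for k
  obtain q k1 where q: "0 < q" "q < 1" and "\<forall>k\<ge>k1. (2 powr (- \<rho>)) ^ Suc k * real (Suc k) powr b'
    \<le> q * ((2 powr (- \<rho>)) ^ k * real k powr b')"
    using geometric_decay[OF \<rho>, of b'] by blast
  then have m_decay: "m (Suc k) \<le> q * m k" if "k1 \<le> k" for k
    using that unfolding m_def by fastforce
  have m0: "0 \<le> m k" for k by (simp add: m_def)
  have "summable m"
    by (rule summable_ratio_test[OF q(2), of k1]) (use m_decay m0 in auto)
  then have m_lim: "m \<longlonglongrightarrow> 0" by (rule summable_LIMSEQ_zero)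
  define C where "C = 3 / (1 - q)"
  have C: "0 < C" using q by (simp add: C_def)
  have ev_all: "AE \<omega> in P. \<forall>L::nat. 1 \<le> L \<longrightarrow> (\<forall>\<^sub>F k in sequentially. grid_bound L k (m k) (\<lambda>t. X t \<omega>))"
    using grid unfolding m_def[symmetric] by (subst AE_all_countable) auto
  have from_k0: "\<exists>k0\<ge>k1. \<forall>k\<ge>k0. grid_bound L k (m k) x"
    if ev: "\<forall>\<^sub>F k in sequentially. grid_bound L k (m k) x" for L and x :: "real ^ 'd \<Rightarrow> real"
  proof -
    obtain k0 where "\<forall>k\<ge>k0. grid_bound L k (m k) x" using ev by (auto simp: eventually_sequentially)
    then show ?thesis by (intro exI[of _ "max k0 k1"]) auto
  qed
  have good: "AE \<omega> in P. \<forall>L::nat. 1 \<le> L \<longrightarrow> (\<exists>k0\<ge>k1. \<forall>k\<ge>k0. grid_bound L k (m k) (\<lambda>t. X t \<omega>))"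
    using ev_all by eventually_elim (use from_k0 in blast)
  have box: "\<exists>L::nat. 1 \<le> L \<and> (\<forall>i. \<bar>t $ i\<bar> + 1 \<le> real L)" for t :: "real ^ 'd"
  proof -
    obtain L :: nat where "norm t + 1 \<le> real L" using real_arch_simple by blast
    then have "1 \<le> real L" "\<bar>t $ i\<bar> + 1 \<le> real L" for i
      using component_le_norm_cart[of t i] norm_ge_zero[of t] by linarith+
    then show ?thesis by auto
  qed
  define X' where "X' t \<omega> = lim (\<lambda>k. X (dyadic_floor k t) \<omega>)" for t \<omega>
  have X'm[measurable]: "X' t \<in> borel_measurable P" for t
    unfolding X'_def by (rule borel_measurable_lim_metric) (rule Xm)
  have near: "\<bar>X' s \<omega> - X' t \<omega>\<bar> \<le> C * m k"
    if "k1 \<le> k0" "\<And>k. k0 \<le> k \<Longrightarrow> grid_bound L k (m k) (\<lambda>t. X t \<omega>)"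
      "\<And>i. \<bar>s $ i\<bar> \<le> real L" "\<And>i. \<bar>t $ i\<bar> \<le> real L" "\<And>i. 2 ^ k * \<bar>s $ i - t $ i\<bar> \<le> 1" "k0 \<le> k"
    for s t k k0 L \<omega>
    unfolding X'_def C_def
    by (rule dyadic_limit_modulus[where x = "\<lambda>t. X t \<omega>" and L = L, OF q m0 m_decay that(2-6)])
      (use that(1) in auto)
  have mod: "AE \<omega> in P. X' t \<omega> = X t \<omega>" for t
  proof (rule P.AE_eq_of_AE_limit_of_prob_limit[where Y = "\<lambda>k. X (dyadic_floor k t)"])
    obtain L :: nat where L: "1 \<le> L" "\<And>i. \<bar>t $ i\<bar> \<le> real L"
    proof -
      obtain L :: nat where L: "1 \<le> L" "\<And>i. \<bar>t $ i\<bar> + 1 \<le> real L" using box by blast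
      have "\<bar>t $ i\<bar> \<le> real L" for i using L(2)[of i] by linarith
      then show ?thesis using that L(1) by blast
    qed
    show "AE \<omega> in P. (\<lambda>k. X (dyadic_floor k t) \<omega>) \<longlonglongrightarrow> X' t \<omega>"
      using good
    proof eventually_elim
      case (elim \<omega>)
      then obtain k0 where k0: "k1 \<le> k0" "\<And>k. k0 \<le> k \<Longrightarrow> grid_bound L k (m k) (\<lambda>t. X t \<omega>)"
        using L by blast
      have "convergent (\<lambda>k. X (dyadic_floor k t) \<omega>)"
        by (rule dyadic_chaining(1)[where x = "\<lambda>t. X t \<omega>" and L = L, OF q m0 m_decay k0(2) L(2)])
          (use k0(1) in auto)
      then show ?case by (simp add: X'_def convergent_LIMSEQ_iff)
    qed
    show "(\<lambda>k. P.expectation (\<lambda>\<omega>. min 1 \<bar>X (dyadic_floor k t) \<omega> - X t \<omega>\<bar>)) \<longlonglongrightarrow> 0"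
      by (rule P.stochastic_continuity[OF X ss si H dyadic_floor_tendsto])
  qed measurable
  have "AE \<omega> in P. continuous_on UNIV (\<lambda>t. X' t \<omega>) \<and> limsup_modulus \<rho> b (\<lambda>t. X' t \<omega>) = 0"
    using good
  proof eventually_elim
    case (elim \<omega>)
    have "continuous_on UNIV (\<lambda>t. X' t \<omega>)"
      unfolding continuous_on_iff
    proof (intro ballI allI impI)
      fix t :: "real ^ 'd" and e :: real assume e: "0 < e"
      obtain L :: nat where L: "1 \<le> L" "\<And>i. \<bar>t $ i\<bar> + 1 \<le> real L" using box by blast
      obtain k0 where k0: "k1 \<le> k0" "\<And>k. k0 \<le> k \<Longrightarrow> grid_bound L k (m k) (\<lambda>t. X t \<omega>)"
        using elim L(1) by blast
      have "(\<lambda>k. C * m k) \<longlonglongrightarrow> C * 0" by (intro tendsto_intros m_lim)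
      then have "\<forall>\<^sub>F k in sequentially. C * m k < e" using e by (intro order_tendstoD(2)) auto
      then have "\<forall>\<^sub>F k in sequentially. C * m k < e \<and> k0 \<le> k"
        using eventually_ge_at_top[of k0] by eventually_elim auto
      then obtain k where k: "C * m k < e" "k0 \<le> k" by (auto simp: eventually_sequentially)
      show "\<exists>d>0. \<forall>s\<in>UNIV. dist s t < d \<longrightarrow> dist (X' s \<omega>) (X' t \<omega>) < e"
      proof (intro exI[of _ "1 / 2 ^ k"] conjI ballI impI)
        fix s assume s: "dist s t < 1 / 2 ^ k"
        have st: "\<bar>s $ i - t $ i\<bar> \<le> 1 / 2 ^ k" for i
          using component_le_norm_cart[of "s - t" i] s by (simp add: dist_norm)
        have "1 / 2 ^ k \<le> (1 :: real)" by simp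
        then have sL: "\<bar>s $ i\<bar> \<le> real L" for i using st[of i] L(2)[of i] by linarith
        have tL: "\<bar>t $ i\<bar> \<le> real L" for i using L(2)[of i] by linarith
        have "2 ^ k * \<bar>s $ i - t $ i\<bar> \<le> 1" for i using st[of i] by (simp add: field_simps)
        from near[OF k0 sL tL this k(2)] show "dist (X' s \<omega>) (X' t \<omega>) < e"
          using k(1) by (simp add: dist_real_def)
      qed simp
    qed
    moreover have "limsup_modulus \<rho> b (\<lambda>t. X' t \<omega>) = 0"
    proof -
      obtain k0 where k0: "k1 \<le> k0" "\<And>k. k0 \<le> k \<Longrightarrow> grid_bound 1 k (m k) (\<lambda>t. X t \<omega>)"
        using elim by (metis order_refl)
      show ?thesis
      proof (rule limsup_modulus_eq_0[OF \<rho> b, of "C * 3" k0])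
        fix k and s t :: "real ^ 'd"
        assume k: "k0 \<le> k" and s: "s \<in> cbox 0 1" and t: "t \<in> cbox 0 1" and st: "\<And>i. 2 ^ k * \<bar>s $ i - t $ i\<bar> \<le> 1"
        have sL: "\<bar>s $ i\<bar> \<le> real 1" for i using s by (simp add: mem_box_cart)
        have tL: "\<bar>t $ i\<bar> \<le> real 1" for i using t by (simp add: mem_box_cart)
        show "\<bar>X' s \<omega> - X' t \<omega>\<bar> \<le> C * 3 * ((2 powr (- \<rho>)) ^ k * real k powr b')"
          using near[OF k0 sL tL st k] by (simp add: m_def)
      qed (use C in simp)
    qed
    ultimately show ?case ..
  qed
  then show ?thesis
    using mod X'm by (intro exI[of _ X']) (auto simp: modification_def random_field_def)
qed

lemma separable_field_of_continuous:
  fixes X :: "real ^ 'd \<Rightarrow> 'w \<Rightarrow> real"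
  assumes "AE \<omega> in P. continuous_on UNIV (\<lambda>t. X t \<omega>)"
  shows "separable_field P X"
proof -
  obtain D :: "(real ^ 'd) set" where D: "countable D" "\<And>U. open U \<Longrightarrow> U \<noteq> {} \<Longrightarrow> \<exists>d\<in>D. d \<in> U"
    using countable_dense_setE by blast
  have "AE \<omega> in P. \<forall>G F. open G \<and> closed F \<and> (\<forall>t\<in>G \<inter> D. X t \<omega> \<in> F) \<longrightarrow> (\<forall>t\<in>G. X t \<omega> \<in> F)"
    using assms
  proof eventually_elim
    case (elim \<omega>)
    show ?case
    proof (intro allI impI ballI, rule ccontr)
      fix G F t assume GF: "open G \<and> closed F \<and> (\<forall>t\<in>G \<inter> D. X t \<omega> \<in> F)" and t: "t \<in> G" "X t \<omega> \<notin> F"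
      have "open ((\<lambda>t. X t \<omega>) -` (- F))" using elim GF by (intro open_vimage) auto
      then have "open (G \<inter> (\<lambda>t. X t \<omega>) -` (- F))" using GF by auto
      then obtain d where "d \<in> D" "d \<in> G \<inter> (\<lambda>t. X t \<omega>) -` (- F)" using D(2) t by blast
      then show False using GF by auto
    qed
  qed
  then show ?thesis using D(1) unfolding separable_field_def by blast
qed

text \<open>
  Almost surely the two fields agree on a countable separating set. Near \<open>t\<close> the continuous one
  takes values in a small closed interval around \<open>X' t\<close>; separability confines \<open>X t\<close> to this
  interval.
\<close>

lemma separable_eq_continuous_modification:
  fixes X X' :: "real ^ 'd \<Rightarrow> 'w \<Rightarrow> real"
  assumes sep: "separable_field P X" and X': "modification P X X'"
    and cont: "AE \<omega> in P. continuous_on UNIV (\<lambda>t. X' t \<omega>)"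
  shows "AE \<omega> in P. (\<lambda>t. X t \<omega>) = (\<lambda>t. X' t \<omega>)"
proof -
  obtain D where D: "countable D" and ae: "AE \<omega> in P. \<forall>G F. open G \<and> closed F \<and> (\<forall>t\<in>G \<inter> D. X t \<omega> \<in> F)
      \<longrightarrow> (\<forall>t\<in>G. X t \<omega> \<in> F)"
    using sep unfolding separable_field_def by blast
  have "AE \<omega> in P. \<forall>t\<in>D. X' t \<omega> = X t \<omega>"
    using X' D by (subst AE_ball_countable) (auto simp: modification_def)
  with ae cont show ?thesis
  proof eventually_elim
    case (elim \<omega>)
    show ?case
    proof (rule ext, rule ccontr)
      fix t assume ne: "X t \<omega> \<noteq> X' t \<omega>"
      define e where "e = \<bar>X t \<omega> - X' t \<omega>\<bar> / 2"
      define G where "G = (\<lambda>s. X' s \<omega>) -` ball (X' t \<omega>) e"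
      have e: "0 < e" using ne by (simp add: e_def)
      have "open G" unfolding G_def using elim(2) by (intro open_vimage) auto
      moreover have "\<forall>s\<in>G \<inter> D. X s \<omega> \<in> cball (X' t \<omega>) e"
        using elim(3) by (auto simp: G_def)
      moreover have "t \<in> G" using e by (simp add: G_def)
      ultimately have "X t \<omega> \<in> cball (X' t \<omega>) e" using elim(1) by blast
      then have "\<bar>X t \<omega> - X' t \<omega>\<bar> \<le> e" by (simp add: dist_real_def abs_minus_commute)
      then show False using e by (simp add: e_def)
    qed
  qed
qed

theorem theorem4p1:
  fixes P :: "'w measure" and X :: "real ^ 'd \<Rightarrow> 'w \<Rightarrow> real"
    and Q :: "'p measure" and m :: "'e measure" and M :: "'e set \<Rightarrow> 'p \<Rightarrow> real"
    and f :: "real ^ 'd \<Rightarrow> 'e \<Rightarrow> real" and I :: "real ^ 'd \<Rightarrow> 'p \<Rightarrow> real"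
    and \<alpha> H \<theta>\<^sub>2 \<gamma> :: real
  assumes "0 < \<alpha>" and "\<alpha> < 2" and "0 < H"
    and "prob_space P" and "random_field P X"
    and "sas_field \<alpha> P X" and "self_similar H P X" and "stationary_increments P X"
    and "sas_random_measure \<alpha> Q m M"
    and "\<And>t. in_L_alpha \<alpha> m (f t)"
    and "\<And>t. has_stable_integral \<alpha> Q m M (f t) (I t)"
    and "eq_fdd P X Q I"
    and "0 < \<theta>\<^sub>2" and "\<theta>\<^sub>2 < \<alpha> * H"
    and "(\<alpha> < 1 \<and>
           (\<exists>K>0. \<forall>v\<in>directions. \<forall>\<^sub>F n in sequentially.
              kernel_max_norm \<alpha> m (incr_kernel f v) n \<le> K * real n powr (\<theta>\<^sub>2 / \<alpha>))) \<or>
         (1 \<le> \<alpha> \<and>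
           (\<forall>v\<in>directions. weak_eff_dim_bounded \<alpha> m (incr_kernel f v) \<theta>\<^sub>2))"
    and "0 < \<gamma>" and "\<gamma> < \<alpha>"
  shows "(separable_field P X \<longrightarrow>
            (AE \<omega> in P. limsup_modulus (H - \<theta>\<^sub>2 / \<alpha>) (1 / \<gamma>) (\<lambda>t. X t \<omega>) = 0)) \<and>
         (\<exists>X'. modification P X X' \<and> separable_field P X' \<and>
            (AE \<omega> in P. limsup_modulus (H - \<theta>\<^sub>2 / \<alpha>) (1 / \<gamma>) (\<lambda>t. X' t \<omega>) = 0))"
proof -
  note \<alpha> = \<open>0 < \<alpha>\<close> \<open>\<alpha> < 2\<close>
  have \<rho>: "0 < H - \<theta>\<^sub>2 / \<alpha>" using assms(14) \<alpha> by (simp add: divide_less_eq mult.commute)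
  have ker: "\<exists>K>0. \<forall>\<^sub>F n in sequentially.
      (LINT x|m. (MAX t\<in>lattice_box n. \<bar>incr_kernel f v t x\<bar> powr \<alpha>)) \<le> K * real n powr \<theta>\<^sub>2"
    if v: "v \<in> directions" for v
    using assms(15)
  proof (elim disjE conjE exE)
    fix K :: real assume K: "0 < K" and "\<forall>v\<in>directions. \<forall>\<^sub>F n in sequentially.
        kernel_max_norm \<alpha> m (incr_kernel f v) n \<le> K * real n powr (\<theta>\<^sub>2 / \<alpha>)"
    then have "\<forall>\<^sub>F n in sequentially. kernel_max_norm \<alpha> m (incr_kernel f v) n \<le> K * real n powr (\<theta>\<^sub>2 / \<alpha>)"
      using v by blast
    then have "\<forall>\<^sub>F n in sequentially.
        (LINT x|m. (MAX t\<in>lattice_box n. \<bar>incr_kernel f v t x\<bar> powr \<alpha>)) \<le> K powr \<alpha> * real n powr \<theta>\<^sub>2"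
      using eventually_ge_at_top[of 1]
    proof eventually_elim
      case (elim n)
      have "0 \<le> kernel_max_norm \<alpha> m (incr_kernel f v) n" by (simp add: kernel_max_norm_def)
      then have "kernel_max_norm \<alpha> m (incr_kernel f v) n powr \<alpha> \<le> (K * real n powr (\<theta>\<^sub>2 / \<alpha>)) powr \<alpha>"
        using elim(1) \<alpha> by (intro powr_mono2) auto
      also have "\<dots> = K powr \<alpha> * real n powr \<theta>\<^sub>2"
        using \<alpha> by (simp add: powr_mult powr_powr)
      finally show ?case by (simp only: kernel_max_norm_powr_eq_integral[OF \<alpha>(1) elim(2)])
    qed
    then show ?thesis using K by (intro exI[of _ "K powr \<alpha>"]) auto
  next
    assume "\<forall>v\<in>directions. weak_eff_dim_bounded \<alpha> m (incr_kernel f v) \<theta>\<^sub>2"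
    then have "weak_eff_dim_bounded \<alpha> m (incr_kernel f v) \<theta>\<^sub>2" using v by (rule bspec)
    then obtain c\<^sub>1 c\<^sub>2 \<theta>\<^sub>1 where c: "0 < c\<^sub>2" and both: "\<forall>\<^sub>F n in sequentially.
           c\<^sub>1 * real n powr \<theta>\<^sub>1 \<le> kernel_max_norm \<alpha> m (incr_kernel f v) n powr \<alpha> \<and>
           kernel_max_norm \<alpha> m (incr_kernel f v) n powr \<alpha> \<le> c\<^sub>2 * real n powr \<theta>\<^sub>2"
      unfolding weak_eff_dim_bounded_def by (elim conjE exE) (rule that)
    from both have ev: "\<forall>\<^sub>F n in sequentially.
        kernel_max_norm \<alpha> m (incr_kernel f v) n powr \<alpha> \<le> c\<^sub>2 * real n powr \<theta>\<^sub>2"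
      by (rule eventually_mono) (rule conjunct2)
    have "\<forall>\<^sub>F n in sequentially.
        (LINT x|m. (MAX t\<in>lattice_box n. \<bar>incr_kernel f v t x\<bar> powr \<alpha>)) \<le> c\<^sub>2 * real n powr \<theta>\<^sub>2"
      using ev eventually_ge_at_top[of 1]
      by eventually_elim (simp only: kernel_max_norm_powr_eq_integral[OF \<alpha>(1)])
    then show ?thesis using c by blast
  qed
  \<comment> \<open>the slack between \<open>\<gamma>\<close> and \<open>\<gamma>'\<close> turns a bounded quotient into one that tends to zero\<close>
  obtain \<gamma>' where \<gamma>': "\<gamma> < \<gamma>'" "\<gamma>' < \<alpha>" using \<open>\<gamma> < \<alpha>\<close> dense by blast
  then have "0 < \<gamma>'" using \<open>0 < \<gamma>\<close> by simp
  have b: "0 \<le> 1 / \<gamma>'" "1 / \<gamma>' < 1 / \<gamma>"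
    using \<gamma>' \<open>0 < \<gamma>\<close> \<open>0 < \<gamma>'\<close> by (auto simp: frac_less2)
  obtain X' where X': "modification P X X'"
    and ae: "AE \<omega> in P. continuous_on UNIV (\<lambda>t. X' t \<omega>) \<and> limsup_modulus (H - \<theta>\<^sub>2 / \<alpha>) (1 / \<gamma>) (\<lambda>t. X' t \<omega>) = 0"
    using continuous_modification_with_modulus[OF assms(4,5,7,8,3) \<rho> b
        grid_bound_AE[OF assms(4,5,7,8,9) \<alpha> assms(11,12,13) ker \<open>0 < \<gamma>'\<close> \<gamma>'(2)]]
    by blast
  have cont: "AE \<omega> in P. continuous_on UNIV (\<lambda>t. X' t \<omega>)"
    and lim: "AE \<omega> in P. limsup_modulus (H - \<theta>\<^sub>2 / \<alpha>) (1 / \<gamma>) (\<lambda>t. X' t \<omega>) = 0"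
    using ae by auto
  have "AE \<omega> in P. limsup_modulus (H - \<theta>\<^sub>2 / \<alpha>) (1 / \<gamma>) (\<lambda>t. X t \<omega>) = 0" if "separable_field P X"
    using separable_eq_continuous_modification[OF that X' cont] lim by eventually_elim simp
  then show ?thesis
    using X' separable_field_of_continuous[OF cont] lim by blast
qed

end
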